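(* Let $X,\partial X$ be Banach spaces and let $A:D(A)\subseteq X\to X$ and $L:D(A)\to\partial X$ be linear operators such that (G1) the restriction $A_0:=A|_{\ker(L)}$, $D(A_0):=\ker(L)$, is closed and densely defined in $X$ and has non-empty resolvent set; (G2) $L:D(A)\to\partial X$ is surjective; (G3) the operator $\binom AL:D(A)\subseteq X\to X\times\partial X$, $u\mapsto(Au,Lu)$, is closed. Assume that $A_0$ generates a strongly continuous semigroup $(T(t))_{t\ge0}$ on $X$. Let $\mathcal A$ be the operator on $\mathcal X:=X\times\partial X$ given by $\mathcal A\binom uv:=\binom{Au}{0}$ on $D(\mathcal A):=\{\binom uv\in D(A)\times\partial X: Lu=v\}$, and let $(\mathcal T(t))_{t\ge0}$ be the strongly continuous semigroup on $\mathcal X$ generated by $\mathcal A$. Let $f\in X$, $g\in\partial X$. If $\psi\in L^1(\mathbb R_+,\partial X)$, then the unique mild solution to the inhomogeneous problem $$\dot{\mathcal U}(t)=\mathcal A\,\mathcal U(t)+\binom{0}{\psi(t)},\quad t\ge0,\qquad \mathcal U(0)=\binom fg,$$ is given by $$\mathcal U:\mathbb R_+\to\mathcal X,\qquad \mathcal U(t):=\mathcal T(t)\binom fg+\int_0^t\mathcal T(t-s)\binom{0}{\psi(s)}\,ds.$$ In the particular case where $A_0$ is invertible, $\mathcal U$ is given by $$\mathcal U(t)=\binom{T(t)f+\mathcal D_0g-T(t)\mathcal D_0g+\int_0^t\big(\mathcal D_0\psi(s)-T(t-s)\mathcal D_0\psi(s)\big)\,ds}{g+\int_0^t\psi(s)\,ds}.$$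 Moreover, if $f\in D(A)$, $Lf=g$, and $\psi\in W^{1,1}(\mathbb R_+,\partial X)$, then $\mathcal U$ is a classical solution to the inhomogeneous problem.
   Context: $\mathbb R_+=[0,\infty)$. Under (G1)-(G3), $\mathcal A$ generates a strongly continuous semigroup on $\mathcal X$ whenever $A_0$ generates one on $X$. "$A_0$ invertible" means $0\in\rho(A_0)$; in this case the restriction $L|_{\ker(A)}:\ker(A)\to\partial X$ is bijective and the Dirichlet operator $\mathcal D_0:=(L|_{\ker(A)})^{-1}:\partial X\to\ker(A)\subseteq X$ is bounded. A mild solution of $\dot{\mathcal U}(t)=\mathcal A\,\mathcal U(t)+F(t)$, $\mathcal U(0)=\mathbf x$, with $F\in L^1(\mathbb R_+,\mathcal X)$ and $\mathbf x\in\mathcal X$, is a function $\mathcal U\in C(\mathbb R_+,\mathcal X)$ such that $\int_0^t\mathcal U(s)\,ds\in D(\mathcal A)$ and $\mathcal U(t)=\mathbf x+\mathcal A\int_0^t\mathcal U(s)\,ds+\int_0^tF(s)\,ds$ for all $t\ge0$. A classical solution is a function $\mathcal U\in C^1(\mathbb R_+,\mathcal X)$ with $\mathcal U(t)\in D(\mathcal A)$ for all $t\ge0$ that satisfies the differential equation for all $t\ge 0$ and the initial condition. *)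

theory Defs
  imports "HOL-Analysis.Analysis"
begin

(* Scalars.  A type of class real_normed_field is, up to isometric isomorphism, the field of real
   or of complex numbers.  A Banach space over it is a type of class banach (which supplies the
   norm, completeness and the underlying real structure) with a compatible scalar multiplication;
   real Banach spaces are the case sc = scaleR. *)

definition banach_space_over :: "('k::real_normed_field \<Rightarrow> 'a::banach \<Rightarrow> 'a) \<Rightarrow> bool" where
  "banach_space_over sc \<longleftrightarrow>
     vector_space sc \<and>
     (\<forall>c x. norm (sc c x) = norm c * norm x) \<and>
     (\<forall>r x. sc (of_real r) x = r *\<^sub>R x)"

definition scale_prod ::
    "('k \<Rightarrow> 'a \<Rightarrow> 'a) \<Rightarrow> ('k \<Rightarrow> 'b \<Rightarrow> 'b) \<Rightarrow> 'k \<Rightarrow> 'a \<times> 'b \<Rightarrow> 'a \<times> 'b" where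
  "scale_prod sX sY c = (\<lambda>(u, v). (sX c u, sY c v))"


(* A partially defined operator is a domain D together with a function B; the values of B outside
   D are irrelevant.  In particular the restriction of B to a smaller domain is again B. *)

definition linear_operator ::
    "('k::real_normed_field \<Rightarrow> 'a::banach \<Rightarrow> 'a) \<Rightarrow> ('k \<Rightarrow> 'b::banach \<Rightarrow> 'b) \<Rightarrow>
     'a set \<Rightarrow> ('a \<Rightarrow> 'b) \<Rightarrow> bool" where
  "linear_operator sX sY D B \<longleftrightarrow>
     module.subspace sX D \<and>
     (\<forall>x\<in>D. \<forall>y\<in>D. B (x + y) = B x + B y) \<and>
     (\<forall>c. \<forall>x\<in>D. B (sX c x) = sY c (B x))"

definition closed_operator :: "'a::banach set \<Rightarrow> ('a \<Rightarrow> 'b::banach) \<Rightarrow> bool" where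
  "closed_operator D B \<longleftrightarrow> closed {(x, B x) | x. x \<in> D}"

definition densely_defined :: "'a::banach set \<Rightarrow> bool" where
  "densely_defined D \<longleftrightarrow> closure D = UNIV"

definition bounded_operator ::
    "('k::real_normed_field \<Rightarrow> 'a::banach \<Rightarrow> 'a) \<Rightarrow> ('k \<Rightarrow> 'b::banach \<Rightarrow> 'b) \<Rightarrow>
     ('a \<Rightarrow> 'b) \<Rightarrow> bool" where
  "bounded_operator sX sY B \<longleftrightarrow> Vector_Spaces.linear sX sY B \<and> bounded_linear B"

definition resolvent_set ::
    "('k::real_normed_field \<Rightarrow> 'a::banach \<Rightarrow> 'a) \<Rightarrow> 'a set \<Rightarrow> ('a \<Rightarrow> 'a) \<Rightarrow> 'k set" where
  "resolvent_set sX D B =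
     {\<mu>. \<exists>R. bounded_operator sX sX R \<and>
             (\<forall>u\<in>D. R (sX \<mu> u - B u) = u) \<and>
             (\<forall>x. R x \<in> D \<and> sX \<mu> (R x) - B (R x) = x)}"

definition kernel_on :: "'a set \<Rightarrow> ('a \<Rightarrow> 'b::zero) \<Rightarrow> 'a set" where
  "kernel_on D B = {u \<in> D. B u = 0}"


definition C0_semigroup ::
    "('k::real_normed_field \<Rightarrow> 'a::banach \<Rightarrow> 'a) \<Rightarrow> (real \<Rightarrow> 'a \<Rightarrow> 'a) \<Rightarrow> bool" where
  "C0_semigroup sX T \<longleftrightarrow>
     (\<forall>t\<ge>0. bounded_operator sX sX (T t)) \<and>
     T 0 = id \<and>
     (\<forall>s\<ge>0. \<forall>t\<ge>0. T (s + t) = T s \<circ> T t) \<and>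
     (\<forall>x. continuous_on {0..} (\<lambda>t. T t x))"

definition generates_semigroup ::
    "('k::real_normed_field \<Rightarrow> 'a::banach \<Rightarrow> 'a) \<Rightarrow> 'a set \<Rightarrow> ('a \<Rightarrow> 'a) \<Rightarrow>
     (real \<Rightarrow> 'a \<Rightarrow> 'a) \<Rightarrow> bool" where
  "generates_semigroup sX D B T \<longleftrightarrow>
     C0_semigroup sX T \<and>
     D = {x. \<exists>y. ((\<lambda>h. (1 / h) *\<^sub>R (T h x - x)) \<longlongrightarrow> y) (at_right 0)} \<and>
     (\<forall>x\<in>D. ((\<lambda>h. (1 / h) *\<^sub>R (T h x - x)) \<longlongrightarrow> B x) (at_right 0))"


(* Bochner integral.  This is has_bochner_integral from HOL-Analysis.Bochner_Integration without
   the sort constraint second_countable_topology, which would restrict the value space to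
   separable Banach spaces.  Strong measurability is implied: f is Borel measurable and an
   L1-limit of simple functions. *)

definition has_banach_integral :: "'a measure \<Rightarrow> ('a \<Rightarrow> 'b::banach) \<Rightarrow> 'b \<Rightarrow> bool" where
  "has_banach_integral M f x \<longleftrightarrow>
     f \<in> borel_measurable M \<and>
     (\<exists>s. (\<forall>i::nat. Bochner_Integration.simple_bochner_integrable M (s i)) \<and>
          (\<lambda>i. \<integral>\<^sup>+\<omega>. ennreal (norm (f \<omega> - s i \<omega>)) \<partial>M) \<longlonglongrightarrow> 0 \<and>
          (\<lambda>i. Bochner_Integration.simple_bochner_integral M (s i)) \<longlonglongrightarrow> x)"

definition banach_integrable :: "'a measure \<Rightarrow> ('a \<Rightarrow> 'b::banach) \<Rightarrow> bool" where
  "banach_integrable M f \<longleftrightarrow> (\<exists>x. has_banach_integral M f x)"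

definition banach_integral :: "'a measure \<Rightarrow> ('a \<Rightarrow> 'b::banach) \<Rightarrow> 'b" where
  "banach_integral M f =
     (if banach_integrable M f then THE x. has_banach_integral M f x else 0)"

lemma has_banach_integral_eq_has_bochner_integral:
  fixes f :: "'a \<Rightarrow> 'b::{banach, second_countable_topology}"
  shows "has_banach_integral M f x \<longleftrightarrow> has_bochner_integral M f x"
  by (auto simp: has_banach_integral_def has_bochner_integral.simps)


definition L1_halfline :: "(real \<Rightarrow> 'b::banach) \<Rightarrow> bool" where
  "L1_halfline \<psi> \<longleftrightarrow> banach_integrable (lebesgue_on {0..}) \<psi>"

definition test_function :: "(real \<Rightarrow> real) \<Rightarrow> bool" where
  "test_function \<eta> \<longleftrightarrow>
     (\<forall>n t. (deriv ^^ n) \<eta> field_differentiable at t) \<and>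
     (\<exists>a b. 0 < a \<and> (\<forall>t. t \<notin> {a..b} \<longrightarrow> \<eta> t = 0))"

(* The elements of the Sobolev space W^{1,1} on [0,\<infinity>) are classes of a.e. equal functions; each
   class contains exactly one function that is continuous on [0,\<infinity>), and, as usual, the class is
   identified with that representative (pointwise statements make no sense otherwise). *)

definition W11_halfline :: "(real \<Rightarrow> 'b::banach) \<Rightarrow> bool" where
  "W11_halfline \<psi> \<longleftrightarrow>
     continuous_on {0..} \<psi> \<and>
     L1_halfline \<psi> \<and>
     (\<exists>\<phi>. L1_halfline \<phi> \<and>
          (\<forall>\<eta>. test_function \<eta> \<longrightarrow>
             banach_integral (lebesgue_on {0..}) (\<lambda>t. deriv \<eta> t *\<^sub>R \<psi> t) =
             - banach_integral (lebesgue_on {0..}) (\<lambda>t. \<eta> t *\<^sub>R \<phi> t)))"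


(* Solutions of U' = B U + F on [0,\<infinity>) with U 0 = x.  The integrals of the continuous function U
   over compact intervals are taken with the library's gauge integral, which agrees with the
   Bochner integral there. *)

definition mild_solution ::
    "'a::banach set \<Rightarrow> ('a \<Rightarrow> 'a) \<Rightarrow> (real \<Rightarrow> 'a) \<Rightarrow> 'a \<Rightarrow> (real \<Rightarrow> 'a) \<Rightarrow> bool" where
  "mild_solution D B F x U \<longleftrightarrow>
     L1_halfline F \<and>
     continuous_on {0..} U \<and>
     (\<forall>t\<ge>0. integral {0..t} U \<in> D \<and>
            U t = x + B (integral {0..t} U) + banach_integral (lebesgue_on {0..t}) F)"

definition classical_solution ::
    "'a::banach set \<Rightarrow> ('a \<Rightarrow> 'a) \<Rightarrow> (real \<Rightarrow> 'a) \<Rightarrow> 'a \<Rightarrow> (real \<Rightarrow> 'a) \<Rightarrow> bool" where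
  "classical_solution D B F x U \<longleftrightarrow>
     U 0 = x \<and>
     (\<exists>U'. continuous_on {0..} U' \<and>
           (\<forall>t\<ge>0. (U has_vector_derivative U' t) (at t within {0..}) \<and>
                  U t \<in> D \<and>
                  U' t = B (U t) + F t))"


definition block_domain :: "'a set \<Rightarrow> ('a \<Rightarrow> 'b) \<Rightarrow> ('a \<times> 'b) set" where
  "block_domain D L = {(u, v). u \<in> D \<and> L u = v}"

definition block_operator :: "('a \<Rightarrow> 'a) \<Rightarrow> 'a \<times> 'b \<Rightarrow> 'a \<times> 'b::zero" where
  "block_operator A = (\<lambda>(u, v). (A u, 0))"

definition dirichlet_operator ::
    "'a set \<Rightarrow> ('a \<Rightarrow> 'a::zero) \<Rightarrow> ('a \<Rightarrow> 'b) \<Rightarrow> 'b \<Rightarrow> 'a" where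
  "dirichlet_operator D A L = inv_into (kernel_on D A) L"

end

theory Submission
  imports Defs
begin

text \<open>
  A mild solution is unique because the difference \<open>u\<close> of the integrals of two of them satisfies
  \<open>u' = B u\<close>, \<open>u 0 = 0\<close>, so that \<open>s \<mapsto> T (t - s) (u s)\<close> has derivative zero.
  The variation of constants formula gives a mild solution for inhomogeneities that are step
  functions \<open>1\<^bsub>[a,\<infinity>)\<^esub> y\<close> by direct computation. Since generators are closed, the inhomogeneities
  for which it does so are stable under limits in \<open>L\<^sup>1\<close>, hence contain all of \<open>L\<^sup>1\<close> by a Dynkin argument.
  The Bochner integral of the definitions agrees with the gauge integral, so that values of integrals
  can be computed with the latter.
\<close>

section \<open>Bochner integrals in arbitrary Banach spaces\<close>

text \<open>The boundary space may be nonseparable. There, sums and differences of Borel functions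
  need not be Borel, so integrability is proved by exhibiting approximants with small L1 error.
  Measurability comes out at the end, from almost everywhere convergence of simple functions. The
  errors are measured by real functions, to which ordinary Lebesgue theory applies. Steps are the
  right starting point for the Dynkin argument because their convolution with the semigroup is an
  integrated orbit, on which the generator acts explicitly; more general sets require no further
  computation with the semigroup. For invertible \<open>A\<close> on the kernel of \<open>L\<close>,
  the block semigroup is computed by checking that a candidate solves the homogeneous mild equation,
  so the resolvent enters only through a stationary problem. For classical solutions the weak
  derivative has to become absolute continuity,
  \<open>\<psi> t = \<psi> 0 + integral {0..t} \<phi>\<close>. This requires test functions all of
  whose iterated derivatives exist, hence an explicit family built from
  \<open>exp (- (1 / x))\<close>.\<close>

lemma has_integral_L1_limit_cbox:
  fixes f :: "'a::euclidean_space \<Rightarrow> 'b::banach"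
  assumes approx: "\<And>e. 0 < e \<Longrightarrow> \<exists>s k y c. (s has_integral y) (cbox a b) \<and> (k has_integral c) (cbox a b) \<and>
      c < e \<and> norm (y - x) < e \<and> (\<forall>t\<in>cbox a b. norm (f t - s t) \<le> k t)"
  shows "(f has_integral x) (cbox a b)"
  unfolding has_integral
proof (intro allI impI)
  fix e :: real assume "e > 0"
  then have e4: "e/4 > 0" by simp
  from approx[OF e4] obtain s k y c where s: "(s has_integral y) (cbox a b)"
    and k: "(k has_integral c) (cbox a b)" and c: "c < e/4" and y: "norm (y - x) < e/4"
    and le: "\<forall>t\<in>cbox a b. norm (f t - s t) \<le> k t" by (elim exE conjE)
  from has_integralD[OF s e4] obtain \<gamma>1 where g1: "gauge \<gamma>1"
    and s': "\<And>\<D>. \<D> tagged_division_of (cbox a b) \<Longrightarrow> \<gamma>1 fine \<D> \<Longrightarrow>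
        norm ((\<Sum>(x, k)\<in>\<D>. measure lborel k *\<^sub>R s x) - y) < e/4" by metis
  from has_integralD[OF k e4] obtain \<gamma>2 where g2: "gauge \<gamma>2"
    and k': "\<And>\<D>. \<D> tagged_division_of (cbox a b) \<Longrightarrow> \<gamma>2 fine \<D> \<Longrightarrow>
        norm ((\<Sum>(x, K)\<in>\<D>. measure lborel K *\<^sub>R k x) - c) < e/4" by metis
  have "norm ((\<Sum>(x, k)\<in>\<D>. measure lborel k *\<^sub>R f x) - x) < e"
    if D: "\<D> tagged_division_of (cbox a b)" and fine: "(\<lambda>x. \<gamma>1 x \<inter> \<gamma>2 x) fine \<D>" for \<D>
  proof -
    \<comment> \<open>Riemann sums over one and the same tagged division are compared, so the
      pointwise bound suffices. The errors are \<open>c + e/4 < e/2\<close> here, \<open>e/4\<close>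
      for the sums of \<open>s\<close>, and \<open>e/4\<close> for \<open>y\<close>.\<close>
    have "norm ((\<Sum>(x, k)\<in>\<D>. measure lborel k *\<^sub>R f x) - (\<Sum>(x, k)\<in>\<D>. measure lborel k *\<^sub>R s x))
        = norm (\<Sum>(x, k)\<in>\<D>. measure lborel k *\<^sub>R (f x - s x))"
      by (simp add: sum_subtractf[symmetric] scaleR_diff_right split_def)
    also have "\<dots> \<le> (\<Sum>(x, K)\<in>\<D>. measure lborel K *\<^sub>R k x)"
      by (rule sum_norm_le) (use le tag_in_interval[OF D] in \<open>auto intro!: mult_left_mono\<close>)
    also have "\<dots> < c + e/4"
    proof -
      have "norm ((\<Sum>(x, K)\<in>\<D>. measure lborel K *\<^sub>R k x) - c) < e/4"
        using k'[OF D] fine by (auto simp: fine_Int)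
      then show ?thesis unfolding real_norm_def by linarith
    qed
    finally have 1: "norm ((\<Sum>(x, k)\<in>\<D>. measure lborel k *\<^sub>R f x) - (\<Sum>(x, k)\<in>\<D>. measure lborel k *\<^sub>R s x)) < e/2"
      using c by simp
    have 2: "norm ((\<Sum>(x, k)\<in>\<D>. measure lborel k *\<^sub>R s x) - y) < e/4"
      using s'[OF D] fine by (auto simp: fine_Int)
    have "norm (u - x) < e" if "norm (u - v) < e/2" "norm (v - y) < e/4" for u v
    proof -
      show ?thesis using that y norm_triangle_ineq[of "u - v" "v - y"] norm_triangle_ineq[of "u - y" "y - x"]
        by simp
    qed
    from this[OF 1 2] show ?thesis .
  qed
  moreover have "gauge (\<lambda>x. \<gamma>1 x \<inter> \<gamma>2 x)" using g1 g2 by (rule gauge_Int)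
  ultimately show "\<exists>\<gamma>. gauge \<gamma> \<and> (\<forall>\<D>. \<D> tagged_division_of cbox a b \<and> \<gamma> fine \<D> \<longrightarrow>
      norm ((\<Sum>(x, k)\<in>\<D>. measure lborel k *\<^sub>R f x) - x) < e)" by blast
qed

text \<open>On every box the integrals of \<open>s n\<close> form a Cauchy sequence, and the box
  lemma applies with their limit. Since \<open>c n\<close> is the integral of \<open>k n\<close>
  over all of \<open>S\<close>, the error bound is the same for all boxes; this uniformity carries
  the result to unbounded \<open>S\<close>.\<close>

lemma has_integral_L1_limit:
  fixes f :: "'a::euclidean_space \<Rightarrow> 'b::banach"
  assumes s: "\<And>n::nat. (s n has_integral y n) S" and k: "\<And>n. (k n has_integral c n) S"
    and c: "c \<longlonglongrightarrow> 0" and y: "y \<longlonglongrightarrow> x" and le: "\<And>n t. t \<in> S \<Longrightarrow> norm (f t - s n t) \<le> k n t"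
  shows "(f has_integral x) S"
proof -
  define f0 where "f0 t = (if t \<in> S then f t else 0)" for t
  define s0 where "s0 n t = (if t \<in> S then s n t else 0)" for n t
  define k0 where "k0 n t = (if t \<in> S then k n t else 0)" for n t
  have le0: "norm (f0 t - s0 n t) \<le> k0 n t" for n t
    using le by (auto simp: f0_def s0_def k0_def)
  have k0_nn: "0 \<le> k0 n t" for n t using norm_ge_zero le0 order_trans by blast
  have s0U: "(s0 n has_integral y n) UNIV" for n
    using s[of n] unfolding s0_def has_integral_restrict_UNIV .
  have k0U: "(k0 n has_integral c n) UNIV" for n
    using k[of n] unfolding k0_def has_integral_restrict_UNIV .
  have s0: "s0 n integrable_on cbox a b" for n a b
    using s0U integrable_on_subcbox by blast
  have k0: "k0 n integrable_on cbox a b" for n a b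
    using k0U integrable_on_subcbox by blast
  have kc: "integral (cbox a b) (k0 n) \<le> c n" for n a b
    using integral_subset_le[of "cbox a b" UNIV "k0 n"] k0 k0U k0_nn integral_unique[OF k0U]
    by (metis has_integral_integrable_integral subset_UNIV)
  have box: "\<exists>z. (f0 has_integral z) (cbox a b) \<and> (\<forall>n. norm (z - integral (cbox a b) (s0 n)) \<le> c n)" for a b
  proof -
    define w where "w n = integral (cbox a b) (s0 n)" for n
    have dist_w: "norm (w m - w n) \<le> c m + c n" for m n
    proof -
      have "norm (w m - w n) = norm (integral (cbox a b) (\<lambda>t. s0 m t - s0 n t))"
        unfolding w_def by (simp add: integral_diff s0)
      also have "\<dots> \<le> integral (cbox a b) (\<lambda>t. k0 m t + k0 n t)"
      proof (rule integral_norm_bound_integral)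
        fix t 
        show "norm (s0 m t - s0 n t) \<le> k0 m t + k0 n t"
          using le0[of t m] le0[of t n] norm_triangle_ineq4[of "f0 t - s0 n t" "f0 t - s0 m t"] by simp
      qed (auto intro!: integrable_diff integrable_add s0 k0)
      also have "\<dots> \<le> c m + c n" using kc by (simp add: integral_add k0 add_mono)
      finally show ?thesis .
    qed
    have "Cauchy w"
    proof (rule metric_CauchyI)
      fix e :: real assume "e > 0"
      then have "eventually (\<lambda>n. c n < e/2) sequentially"
        using order_tendstoD(2)[OF c, of "e/2"] by simp
      then obtain N where "\<And>n. n \<ge> N \<Longrightarrow> c n < e/2" by (auto simp: eventually_sequentially)
      then show "\<exists>M. \<forall>m\<ge>M. \<forall>n\<ge>M. dist (w m) (w n) < e"
        using dist_w by (intro exI[of _ N]) (auto simp: dist_norm intro!: le_less_trans[OF dist_w] add_strict_mono[of _ "e/2" _ "e/2", simplified])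
    qed
    then obtain z where z: "w \<longlonglongrightarrow> z" by (metis Cauchy_convergent convergent_def)
    have bd: "norm (z - w n) \<le> c n" for n
    proof -
      have "(\<lambda>m. norm (w m - w n)) \<longlonglongrightarrow> norm (z - w n)" by (intro tendsto_intros z)
      moreover have "(\<lambda>m. c m + c n) \<longlonglongrightarrow> 0 + c n" by (intro tendsto_intros c)
      ultimately have "norm (z - w n) \<le> 0 + c n" by (rule LIMSEQ_le) (auto intro: dist_w)
      then show ?thesis by simp
    qed
    have "(f0 has_integral z) (cbox a b)"
    proof (rule has_integral_L1_limit_cbox)
      fix e :: real assume "e > 0"
      then have "eventually (\<lambda>n. c n < e) sequentially" using order_tendstoD(2)[OF c] by simp
      then obtain n where n: "c n < e" by (auto simp: eventually_sequentially)
      have "integral (cbox a b) (k0 n) < e" "norm (w n - z) < e"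
        using n kc[of a b n] bd[of n] by (simp_all add: norm_minus_commute)
      then show "\<exists>s k y c. (s has_integral y) (cbox a b) \<and> (k has_integral c) (cbox a b) \<and>
        c < e \<and> norm (y - z) < e \<and> (\<forall>t\<in>cbox a b. norm (f0 t - s t) \<le> k t)"
        using s0[of n a b] k0[of n a b] le0 unfolding w_def
        by (blast intro: integrable_integral)
    qed
    with bd show ?thesis unfolding w_def by blast
  qed
  show ?thesis unfolding has_integral'[of f]
  proof (intro allI impI)
    fix e :: real assume e: "e > 0"
    have "eventually (\<lambda>n. c n < e/3 \<and> norm (y n - x) < e/3) sequentially"
      using order_tendstoD(2)[OF c, of "e/3"] tendstoD[OF y, of "e/3"] e
      by (simp add: eventually_conj dist_norm)
    then obtain n where n: "c n < e/3" "norm (y n - x) < e/3" by (auto simp: eventually_sequentially)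
    from s[of n, unfolded has_integral'[of "s n"]] e obtain B where "B > 0" and
      B: "\<And>a b. ball 0 B \<subseteq> cbox a b \<Longrightarrow> \<exists>z. (s0 n has_integral z) (cbox a b) \<and> norm (z - y n) < e/3"
      unfolding s0_def using zero_less_divide_iff[of e 3] by (metis zero_less_numeral)
    show "\<exists>B>0. \<forall>a b. ball 0 B \<subseteq> cbox a b \<longrightarrow>
      (\<exists>z. ((\<lambda>x. if x \<in> S then f x else 0) has_integral z) (cbox a b) \<and> norm (z - x) < e)"
    proof (intro exI[of _ B] conjI allI impI \<open>B > 0\<close>)
      fix a b :: 'a assume "ball 0 B \<subseteq> cbox a b"
      with B have 1: "norm (integral (cbox a b) (s0 n) - y n) < e/3" by (blast dest: integral_unique)
      from box[of a b] obtain z where z: "(f0 has_integral z) (cbox a b)"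
        "norm (z - integral (cbox a b) (s0 n)) \<le> c n" by blast
      have "norm (z - x) < e"
        using n 1 z(2) norm_triangle_ineq[of "z - integral (cbox a b) (s0 n)" "integral (cbox a b) (s0 n) - y n"]
          norm_triangle_ineq[of "z - y n" "y n - x"] by simp
      with z(1) show "\<exists>z. ((\<lambda>x. if x \<in> S then f x else 0) has_integral z) (cbox a b) \<and> norm (z - x) < e"
        unfolding f0_def[abs_def] by blast
    qed
  qed
qed

section \<open>Simple functions, and the agreement of the Bochner with the gauge integral\<close>

lemma simple_bochner_integrable_imp_simple_function:
  "Bochner_Integration.simple_bochner_integrable M s \<Longrightarrow> simple_function M s"
  by (auto simp: simple_bochner_integrable.simps)

text \<open>Since \<open>s\<close> takes finitely many values, the difference is glued along the
  level sets of \<open>s\<close> from the functions \<open>f x - y\<close>, each a continuous image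
  of \<open>f\<close>. This avoids measurability of subtraction on the product space.\<close>

lemma borel_measurable_diff_simple_function:
  fixes f :: "'a \<Rightarrow> 'b::real_normed_vector"
  assumes f: "f \<in> borel_measurable M" and s: "simple_function M s"
  shows "(\<lambda>x. f x - s x) \<in> borel_measurable M"
proof -
  have "(\<lambda>x. (\<lambda>y x. f x - y) (s x) x) \<in> borel_measurable M"
  proof (rule measurable_compose_countable'[where f="\<lambda>y x. f x - y" and g=s and I="s ` space M"])
    show "(\<lambda>x. f x - y) \<in> borel_measurable M" for y
      by (rule measurable_compose[OF f borel_measurable_continuous_onI]) (intro continuous_intros)
    show "s \<in> measurable M (count_space (s ` space M))"
      using s by (auto simp: simple_function_def measurable_count_space_eq2)
    show "countable (s ` space M)" using s by (auto simp: simple_function_def countable_finite)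
  qed
  then show ?thesis .
qed

text \<open>For \<open>y \<noteq> 0\<close> the level set lies in the support of \<open>s\<close>,
  which has finite measure; for 0 it is the complement of the support.\<close>

lemma simple_bochner_integrable_level_set:
  fixes s :: "'a::euclidean_space \<Rightarrow> 'b::banach"
  assumes S: "S \<in> sets lebesgue" and s: "Bochner_Integration.simple_bochner_integrable (lebesgue_on S) s"
    and y: "y \<noteq> 0"
  shows "{x\<in>S. s x = y} \<in> lmeasurable"
proof -
  have sf: "simple_function (lebesgue_on S) s" and fin: "emeasure (lebesgue_on S) {x\<in>S. s x \<noteq> 0} \<noteq> \<infinity>"
    using s by (auto simp: simple_bochner_integrable.simps)
  have E: "{x\<in>S. s x = z} \<in> sets (lebesgue_on S)" for z
  proof -
    have "s -` {z} \<inter> space (lebesgue_on S) \<in> sets (lebesgue_on S)" 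
      using sf by (rule simple_functionD)
    moreover have "s -` {z} \<inter> space (lebesgue_on S) = {x\<in>S. s x = z}" by auto
    ultimately show ?thesis by simp
  qed
  then have E': "{x\<in>S. s x = y} \<in> sets lebesgue" using S by (simp add: sets_restrict_space_iff)
  have "emeasure (lebesgue_on S) {x\<in>S. s x = y} \<le> emeasure (lebesgue_on S) {x\<in>S. s x \<noteq> 0}"
  proof (rule emeasure_mono)
    have "{x\<in>S. s x \<noteq> 0} = S - {x\<in>S. s x = 0}" by auto
    then show "{x\<in>S. s x \<noteq> 0} \<in> sets (lebesgue_on S)"
      using E[of 0] by (metis sets.compl_sets space_lebesgue_on)
  qed (use y in auto)
  then have "emeasure (lebesgue_on S) {x\<in>S. s x = y} < \<infinity>" using fin by (simp add: less_top order_le_less_trans)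
  then show ?thesis
    using S E' by (auto simp: fmeasurable_def emeasure_restrict_space)
qed

text \<open>The value 0 is left out because its level set may have infinite measure, whence
  \<open>h 0 = 0\<close>. The map \<open>h\<close> may vary with the point: it is the identity for
  the canonical form of \<open>s\<close>, and \<open>H x\<close> for a family of operators.\<close>

lemma simple_bochner_integrable_sum_indicator:
  fixes s :: "'a \<Rightarrow> 'b::real_vector" and h :: "'b \<Rightarrow> 'c::real_vector"
  assumes s: "Bochner_Integration.simple_bochner_integrable M s" and x: "x \<in> space M"
    and h0: "h 0 = 0"
  shows "h (s x) = (\<Sum>y\<in>s ` space M - {0}. indicator {x\<in>space M. s x = y} x *\<^sub>R h y)"
proof -
  have "finite (s ` space M)" using s by (auto simp: simple_bochner_integrable.simps simple_function_def)
  moreover have "(\<Sum>y\<in>s ` space M - {0}. indicator {x\<in>space M. s x = y} x *\<^sub>R h y)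
      = (\<Sum>y\<in>s ` space M - {0}. if s x = y then h y else 0)"
    using x by (intro sum.cong) (auto simp: indicator_def)
  ultimately show ?thesis using x by (simp add: h0)
qed

lemma has_integral_simple_bochner_integral:
  fixes s :: "'a::euclidean_space \<Rightarrow> 'b::banach"
  assumes S: "S \<in> sets lebesgue" and s: "Bochner_Integration.simple_bochner_integrable (lebesgue_on S) s"
  shows "(s has_integral Bochner_Integration.simple_bochner_integral (lebesgue_on S) s) S"
proof -
  define E where "E y = {x\<in>S. s x = y}" for y
  have fin: "finite (s ` S)" using s by (auto simp: simple_bochner_integrable.simps simple_function_def)
  have *: "((\<lambda>x. indicator (E y) x *\<^sub>R y) has_integral measure (lebesgue_on S) (E y) *\<^sub>R y) S"
    if "y \<in> s ` S - {0}" for y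
  proof -
    have E: "E y \<in> lmeasurable"
      using simple_bochner_integrable_level_set[OF S s, of y] that by (simp add: E_def)
    then have m: "measure (lebesgue_on S) (E y) = measure lebesgue (E y)"
      using S by (subst measure_restrict_space) (auto simp: E_def)
    from E have "(indicat_real (E y) has_integral measure lebesgue (E y)) UNIV"
      by (simp add: lmeasurable_iff_has_integral)
    moreover have "indicat_real (E y) = (\<lambda>x. if x \<in> S then indicat_real (E y) x else 0)"
      by (auto simp: E_def indicator_def)
    ultimately have "(indicat_real (E y) has_integral measure lebesgue (E y)) S"
      by (metis has_integral_restrict_UNIV)
    then show ?thesis unfolding m by (rule has_integral_scaleR_left)
  qed
  have 1: "((\<lambda>x. \<Sum>y\<in>s`S-{0}. indicator (E y) x *\<^sub>R y) has_integral
      (\<Sum>y\<in>s`S-{0}. measure (lebesgue_on S) (E y) *\<^sub>R y)) S"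
    using fin by (intro has_integral_sum *) auto
  have 2: "(\<Sum>y\<in>s`S-{0}. indicator (E y) x *\<^sub>R y) = s x" if "x \<in> S" for x
    using simple_bochner_integrable_sum_indicator[OF s, of x "\<lambda>y. y", symmetric] that by (simp add: E_def)
  have 3: "(\<Sum>y\<in>s`S-{0}. measure (lebesgue_on S) (E y) *\<^sub>R y)
      = Bochner_Integration.simple_bochner_integral (lebesgue_on S) s"
    unfolding Bochner_Integration.simple_bochner_integral_def E_def using fin
    by (intro sum.mono_neutral_cong_left) auto
  show ?thesis using 1 unfolding 3 by (rule has_integral_eq[rotated]) (rule 2)
qed

lemma borel_measurable_norm_diff_simple_function:
  fixes f :: "'a \<Rightarrow> 'b::real_normed_vector"
  assumes f: "f \<in> borel_measurable M" and s: "simple_function M s"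
  shows "(\<lambda>x. norm (f x - s x)) \<in> borel_measurable M"
  by (rule measurable_compose[OF borel_measurable_diff_simple_function[OF assms] borel_measurable_continuous_onI])
    (intro continuous_intros)

text \<open>The error \<open>norm (f \<omega> - s i \<omega>)\<close> is real and nonnegative, so
  its Lebesgue integral is also a gauge integral. It serves as the dominating function in
  \<open>has_integral_L1_limit\<close>.\<close>

lemma has_banach_integral_has_integral:
  fixes f :: "'a::euclidean_space \<Rightarrow> 'b::banach"
  assumes S: "S \<in> sets lebesgue" and f: "has_banach_integral (lebesgue_on S) f x"
  shows "(f has_integral x) S"
proof -
  from f obtain s where fm: "f \<in> borel_measurable (lebesgue_on S)"
    and s: "\<And>i::nat. Bochner_Integration.simple_bochner_integrable (lebesgue_on S) (s i)"
    and d: "(\<lambda>i. \<integral>\<^sup>+\<omega>. ennreal (norm (f \<omega> - s i \<omega>)) \<partial>lebesgue_on S) \<longlonglongrightarrow> 0"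
    and x: "(\<lambda>i. Bochner_Integration.simple_bochner_integral (lebesgue_on S) (s i)) \<longlonglongrightarrow> x"
    unfolding has_banach_integral_def by blast
  \<comment> \<open>Early errors may have infinite integral; shifting the sequence by
    \<open>N\<close> makes all of them integrable.\<close>
  have "eventually (\<lambda>i. (\<integral>\<^sup>+\<omega>. ennreal (norm (f \<omega> - s i \<omega>)) \<partial>lebesgue_on S) < 1) sequentially"
    using order_tendstoD(2)[OF d, of 1] by simp
  then obtain N where N: "\<And>i. i \<ge> N \<Longrightarrow> (\<integral>\<^sup>+\<omega>. ennreal (norm (f \<omega> - s i \<omega>)) \<partial>lebesgue_on S) < 1"
    by (auto simp: eventually_sequentially)
  define k where "k i \<omega> = norm (f \<omega> - s (i + N) \<omega>)" for i \<omega>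
  have km: "k i \<in> borel_measurable (lebesgue_on S)" for i
    unfolding k_def using simple_bochner_integrable_imp_simple_function[OF s]
    by (intro borel_measurable_norm_diff_simple_function fm)
  have ki: "integrable (lebesgue_on S) (k i)" for i
    using N[of "i + N"] km
    by (intro integrableI_nonneg) (auto simp: k_def intro: order_less_trans)
  show ?thesis
  proof (rule has_integral_L1_limit[where s="\<lambda>i. s (i + N)" and k=k])
    show "(s (i + N) has_integral Bochner_Integration.simple_bochner_integral (lebesgue_on S) (s (i + N))) S" for i
      by (rule has_integral_simple_bochner_integral[OF S s])
    show "(k i has_integral integral\<^sup>L (lebesgue_on S) (k i)) S" for i
      by (rule has_integral_integral_lebesgue_on[OF ki S])
    show "(\<lambda>i. Bochner_Integration.simple_bochner_integral (lebesgue_on S) (s (i + N))) \<longlonglongrightarrow> x"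
      using x by (rule LIMSEQ_ignore_initial_segment)
    have "(\<lambda>i. ennreal (integral\<^sup>L (lebesgue_on S) (k i))) \<longlonglongrightarrow> 0"
      using LIMSEQ_ignore_initial_segment[OF d, of N] nn_integral_eq_integral[OF ki]
      by (simp add: k_def)
    then show "(\<lambda>i. integral\<^sup>L (lebesgue_on S) (k i)) \<longlonglongrightarrow> 0"
      by (subst (asm) ennreal_0[symmetric], subst (asm) tendsto_ennreal_iff)
        (auto simp: k_def intro!: Bochner_Integration.integral_nonneg always_eventually)
  qed (simp add: k_def)
qed

text \<open>The definite description in \<open>banach_integral\<close> denotes because every
  candidate value is also a gauge integral, and that is unique.\<close>

lemma banach_integral_lebesgue_on_eq:
  fixes f :: "'a::euclidean_space \<Rightarrow> 'b::banach"
  assumes S: "S \<in> sets lebesgue" and f: "has_banach_integral (lebesgue_on S) f x"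
  shows "banach_integral (lebesgue_on S) f = x"
proof -
  have "(THE x. has_banach_integral (lebesgue_on S) f x) = x"
    using f has_banach_integral_has_integral[OF S] has_integral_unique by (blast intro: the_equality)
  then show ?thesis using f by (auto simp: banach_integral_def banach_integrable_def)
qed

lemma banach_integrable_has_integral:
  fixes f :: "'a::euclidean_space \<Rightarrow> 'b::banach"
  assumes "S \<in> sets lebesgue" and "banach_integrable (lebesgue_on S) f"
  shows "(f has_integral banach_integral (lebesgue_on S) f) S"
  using assms banach_integral_lebesgue_on_eq has_banach_integral_has_integral
  unfolding banach_integrable_def by blast

lemma banach_integral_eq_integral:
  fixes f :: "'a::euclidean_space \<Rightarrow> 'b::banach"
  assumes "S \<in> sets lebesgue" and "banach_integrable (lebesgue_on S) f"
  shows "banach_integral (lebesgue_on S) f = integral S f"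
  using banach_integrable_has_integral[OF assms] by (simp add: integral_unique)

lemma banach_integrable_integrable_on:
  fixes f :: "'a::euclidean_space \<Rightarrow> 'b::banach"
  assumes "S \<in> sets lebesgue" and "banach_integrable (lebesgue_on S) f"
  shows "f integrable_on S"
  using banach_integrable_has_integral[OF assms] by (rule has_integral_integrable)

section \<open>Approximation in L1 as a criterion for Bochner integrability\<close>

lemma banach_integrable_simple_approx:
  fixes f :: "'a::euclidean_space \<Rightarrow> 'b::banach"
  assumes S: "S \<in> sets lebesgue" and f: "banach_integrable (lebesgue_on S) f" and e: "0 < e"
  obtains s where "Bochner_Integration.simple_bochner_integrable (lebesgue_on S) s"
    and "(\<lambda>x. norm (f x - s x)) integrable_on S" and "integral S (\<lambda>x. norm (f x - s x)) < e"
proof -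
  from f obtain s where fm: "f \<in> borel_measurable (lebesgue_on S)"
    and s: "\<And>i::nat. Bochner_Integration.simple_bochner_integrable (lebesgue_on S) (s i)"
    and d: "(\<lambda>i. \<integral>\<^sup>+\<omega>. ennreal (norm (f \<omega> - s i \<omega>)) \<partial>lebesgue_on S) \<longlonglongrightarrow> 0"
    unfolding has_banach_integral_def banach_integrable_def by blast
  have "eventually (\<lambda>i. (\<integral>\<^sup>+\<omega>. ennreal (norm (f \<omega> - s i \<omega>)) \<partial>lebesgue_on S) < ennreal e) sequentially"
    using order_tendstoD(2)[OF d, of "ennreal e"] e by simp
  then obtain i where i: "(\<integral>\<^sup>+\<omega>. ennreal (norm (f \<omega> - s i \<omega>)) \<partial>lebesgue_on S) < ennreal e"
    by (auto simp: eventually_sequentially)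
  define k where "k \<omega> = norm (f \<omega> - s i \<omega>)" for \<omega>
  have km: "k \<in> borel_measurable (lebesgue_on S)"
    unfolding k_def using simple_bochner_integrable_imp_simple_function[OF s]
    by (intro borel_measurable_norm_diff_simple_function fm)
  have ki: "integrable (lebesgue_on S) k"
    using i km by (intro integrableI_nonneg) (auto simp: k_def intro: order_less_trans)
  have "ennreal (integral\<^sup>L (lebesgue_on S) k) < ennreal e"
    using i nn_integral_eq_integral[OF ki] by (simp add: k_def)
  then have "integral\<^sup>L (lebesgue_on S) k < e" by (metis ennreal_leI not_less)
  moreover have "(k has_integral integral\<^sup>L (lebesgue_on S) k) S"
    by (rule has_integral_integral_lebesgue_on[OF ki S])
  ultimately show thesis using that[OF s[of i]]
    unfolding k_def[abs_def] by (metis (mono_tags) has_integral_integrable integral_unique)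
qed

text \<open>Off the null set \<open>N\<close> the function is a pointwise limit of measurable
  functions into a metric space; inside \<open>N\<close> every set is measurable, since Lebesgue
  measure is complete.\<close>

lemma borel_measurable_lebesgue_on_AE_limit:
  fixes f :: "'a::euclidean_space \<Rightarrow> 'b::metric_space"
  assumes S: "S \<in> sets lebesgue" and s: "\<And>n. s n \<in> borel_measurable (lebesgue_on S)"
    and lim: "AE x in lebesgue_on S. (\<lambda>n::nat. s n x) \<longlonglongrightarrow> f x"
  shows "f \<in> borel_measurable (lebesgue_on S)"
proof -
  let ?M = "lebesgue_on S"
  from lim obtain N where N: "N \<in> null_sets ?M" and
    conv: "{x\<in>space ?M. \<not> (\<lambda>n. s n x) \<longlonglongrightarrow> f x} \<subseteq> N"
    by (auto simp: eventually_ae_filter)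
  have Nn: "N \<in> null_sets lebesgue" using N S by (simp add: null_sets_restrict_space)
  have Ns: "N \<in> sets ?M" using N by blast
  \<comment> \<open>A metric space has no distinguished element, so an arbitrary one fills the null
    set.\<close>
  fix a :: 'b
  define g where "g x = (if x \<in> N then a else f x)" for x
  have [measurable]: "g \<in> borel_measurable ?M"
  proof (rule borel_measurable_LIMSEQ_metric)
    show "(\<lambda>x. if x \<in> N then a else s n x) \<in> borel_measurable ?M" for n
      using s Ns by (intro measurable_If_set) (auto simp: sets.Int_space_eq1)
    show "(\<lambda>n. if x \<in> N then a else s n x) \<longlonglongrightarrow> g x" if "x \<in> space ?M" for x
      using conv that by (auto simp: g_def)
  qed
  show ?thesis
  proof (rule borel_measurableI)
    fix A :: "'b set" assume "open A"
    then have "g -` A \<inter> space ?M - N \<in> sets ?M" using Ns by (intro sets.Diff measurable_sets[of g _ borel]) auto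
    moreover have "f -` A \<inter> N \<in> null_sets lebesgue"
      using Nn by (rule completion.complete2[rotated]) auto
    moreover have "N \<subseteq> S" using Ns sets.sets_into_space by fastforce
    ultimately have "(g -` A \<inter> space ?M - N) \<union> (f -` A \<inter> N) \<in> sets ?M"
      using S by (intro sets.Un) (auto simp: sets_restrict_space_iff)
    also have "(g -` A \<inter> space ?M - N) \<union> (f -` A \<inter> N) = f -` A \<inter> space ?M"
      using \<open>N \<subseteq> S\<close> by (auto simp: g_def)
    finally show "f -` A \<inter> space ?M \<in> sets ?M" .
  qed
qed

text \<open>Measurability of \<open>f\<close> is a conclusion here. The dominating functions have
  integrals tending to 0, so a subsequence of them tends to 0 almost everywhere, and
  \<open>f\<close> is an almost everywhere limit of simple functions. The dominating functions are
  nonnegative, so gauge integrability makes them Lebesgue integrable.\<close>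

lemma banach_integrableI_simple_approx:
  fixes f :: "'a::euclidean_space \<Rightarrow> 'b::banach"
  assumes S: "S \<in> sets lebesgue"
    and approx: "\<And>e. 0 < e \<Longrightarrow> \<exists>s k. Bochner_Integration.simple_bochner_integrable (lebesgue_on S) s \<and>
      k integrable_on S \<and> integral S k < e \<and> (\<forall>x\<in>S. norm (f x - s x) \<le> k x)"
  shows "banach_integrable (lebesgue_on S) f"
proof -
  let ?M = "lebesgue_on S"
  have "\<forall>n. \<exists>s k. Bochner_Integration.simple_bochner_integrable ?M s \<and> k integrable_on S \<and>
      integral S k < inverse (Suc n) \<and> (\<forall>x\<in>S. norm (f x - s x) \<le> k x)"
    using approx by simp
  then obtain s k where s: "\<And>n. Bochner_Integration.simple_bochner_integrable ?M (s n)"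
    and kS: "\<And>n. k n integrable_on S" and k_lt: "\<And>n. integral S (k n) < inverse (Suc n)"
    and le: "\<And>n x. x \<in> S \<Longrightarrow> norm (f x - s n x) \<le> k n x" by metis
  have k_nn: "x \<in> S \<Longrightarrow> 0 \<le> k n x" for n x using le norm_ge_zero order_trans by blast
  have int_nn: "0 \<le> integral S (k n)" for n by (rule integral_nonneg[OF kS k_nn])
  have ki: "integrable ?M (k n)" and kL: "integral\<^sup>L ?M (k n) = integral S (k n)" for n
  proof -
    have "k n absolutely_integrable_on S"
      using kS k_nn by (intro nonnegative_absolutely_integrable_1) auto
    then show "integrable ?M (k n)" "integral\<^sup>L ?M (k n) = integral S (k n)"
      using S by (auto simp: integrable_restrict_space set_integrable_def lebesgue_integral_eq_integral)
  qed
  have lim: "(\<lambda>n. integral S (k n)) \<longlonglongrightarrow> 0"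
    using int_nn k_lt by (intro tendsto_sandwich[OF _ _ tendsto_const LIMSEQ_inverse_real_of_nat])
      (auto intro!: always_eventually less_imp_le)
  have "(\<lambda>n. \<integral>x. norm (k n x) \<partial>?M) \<longlonglongrightarrow> 0"
  proof -
    have "(\<integral>x. norm (k n x) \<partial>?M) = integral\<^sup>L ?M (k n)" for n
      using k_nn by (intro Bochner_Integration.integral_cong) auto
    then show ?thesis using lim by (simp add: kL)
  qed
  from tendsto_L1_AE_subseq[OF ki this] obtain r :: "nat \<Rightarrow> nat" where
    r: "AE x in ?M. (\<lambda>n. k (r n) x) \<longlonglongrightarrow> 0" by blast
  have fm: "f \<in> borel_measurable ?M"
  proof (rule borel_measurable_lebesgue_on_AE_limit[OF S])
    show "s (r n) \<in> borel_measurable ?M" for n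
      using simple_bochner_integrable_imp_simple_function[OF s] by (rule borel_measurable_simple_function)
    show "AE x in ?M. (\<lambda>n. s (r n) x) \<longlonglongrightarrow> f x"
      using r AE_space
    proof eventually_elim
      case (elim x)
      then have "(\<lambda>n. f x - s (r n) x) \<longlonglongrightarrow> 0"
        by (intro Lim_null_comparison[OF _ elim(1)]) (auto intro!: always_eventually le)
      then show ?case using tendsto_diff[OF tendsto_const[of "f x"]] by fastforce
    qed
  qed
  let ?y = "\<lambda>n. Bochner_Integration.simple_bochner_integral ?M (s n)"
  have hi: "(s n has_integral ?y n) S" for n by (rule has_integral_simple_bochner_integral[OF S s])
  have bd: "norm (?y m - ?y n) \<le> integral S (k m) + integral S (k n)" for m n
  proof -
    have "norm (?y m - ?y n) = norm (integral S (\<lambda>x. s m x - s n x))"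
      using has_integral_diff[OF hi[of m] hi[of n]] by (simp add: integral_unique)
    also have "\<dots> \<le> integral S (\<lambda>x. k m x + k n x)"
    proof (rule integral_norm_bound_integral)
      show "norm (s m x - s n x) \<le> k m x + k n x" if "x \<in> S" for x
        using le[OF that, of m] le[OF that, of n] norm_triangle_ineq4[of "f x - s n x" "f x - s m x"] by simp
      show "(\<lambda>x. s m x - s n x) integrable_on S"
        using has_integral_diff[OF hi[of m] hi[of n]] by (rule has_integral_integrable)
    qed (intro integrable_add kS)
    finally show ?thesis by (simp add: integral_add kS)
  qed
  have "Cauchy ?y"
  proof (rule metric_CauchyI)
    fix e :: real assume "e > 0"
    then have "eventually (\<lambda>n. integral S (k n) < e/2) sequentially"
      using order_tendstoD(2)[OF lim, of "e/2"] by simp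
    then obtain N where N: "\<And>n. n \<ge> N \<Longrightarrow> integral S (k n) < e/2" by (auto simp: eventually_sequentially)
    have "dist (?y m) (?y n) < e" if "m \<ge> N" "n \<ge> N" for m n
      using bd[of m n] N[OF that(1)] N[OF that(2)] by (simp add: dist_norm)
    then show "\<exists>N. \<forall>m\<ge>N. \<forall>n\<ge>N. dist (?y m) (?y n) < e" by blast
  qed
  then obtain z where z: "?y \<longlonglongrightarrow> z" by (metis Cauchy_convergent convergent_def)
  have "(\<lambda>n. \<integral>\<^sup>+x. ennreal (norm (f x - s n x)) \<partial>?M) \<longlonglongrightarrow> 0"
  proof (rule tendsto_sandwich[OF _ _ tendsto_const])
    show "eventually (\<lambda>n. (\<integral>\<^sup>+x. ennreal (norm (f x - s n x)) \<partial>?M) \<le> ennreal (integral S (k n))) sequentially"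
    proof (intro always_eventually allI)
      fix n
      have "(\<integral>\<^sup>+x. ennreal (norm (f x - s n x)) \<partial>?M) \<le> (\<integral>\<^sup>+x. ennreal (k n x) \<partial>?M)"
        by (intro nn_integral_mono ennreal_leI le) auto
      also have "\<dots> = ennreal (integral S (k n))"
        using nn_integral_eq_integral[OF ki[of n] AE_I2] k_nn kL by simp
      finally show "(\<integral>\<^sup>+x. ennreal (norm (f x - s n x)) \<partial>?M) \<le> ennreal (integral S (k n))" .
    qed
    show "(\<lambda>n. ennreal (integral S (k n))) \<longlonglongrightarrow> 0"
      using tendsto_ennrealI[OF lim] by simp
  qed simp
  then show ?thesis unfolding banach_integrable_def has_banach_integral_def using fm s z by blast
qed

lemma banach_integrable_simple:
  fixes s :: "'a::euclidean_space \<Rightarrow> 'b::banach"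
  assumes S: "S \<in> sets lebesgue" and "Bochner_Integration.simple_bochner_integrable (lebesgue_on S) s"
  shows "banach_integrable (lebesgue_on S) s"
  using assms(2) by (intro banach_integrableI_simple_approx[OF S] exI[of _ s] exI[of _ "\<lambda>_. 0"]) (auto intro: integrable_0)

text \<open>The Bochner integrable functions are closed in L1: half of \<open>e\<close> goes to
  \<open>g\<close>, the other half to a simple function near \<open>g\<close>.\<close>

lemma banach_integrableI_approx:
  fixes f :: "'a::euclidean_space \<Rightarrow> 'b::banach"
  assumes S: "S \<in> sets lebesgue"
    and approx: "\<And>e. 0 < e \<Longrightarrow> \<exists>g k. banach_integrable (lebesgue_on S) g \<and>
      k integrable_on S \<and> integral S k < e \<and> (\<forall>x\<in>S. norm (f x - g x) \<le> k x)"
  shows "banach_integrable (lebesgue_on S) f"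
proof (rule banach_integrableI_simple_approx[OF S])
  fix e :: real assume "e > 0"
  then have e2: "e/2 > 0" by simp
  from approx[OF e2] obtain g k where g: "banach_integrable (lebesgue_on S) g"
    and k: "k integrable_on S" "integral S k < e/2" and le: "\<forall>x\<in>S. norm (f x - g x) \<le> k x" by blast
  from banach_integrable_simple_approx[OF S g e2] obtain s
    where s: "Bochner_Integration.simple_bochner_integrable (lebesgue_on S) s"
    and gs: "(\<lambda>x. norm (g x - s x)) integrable_on S" "integral S (\<lambda>x. norm (g x - s x)) < e/2" .
  have "(\<lambda>x. k x + norm (g x - s x)) integrable_on S" using k gs by (intro integrable_add)
  moreover have "integral S (\<lambda>x. k x + norm (g x - s x)) < e"
    using k gs by (simp add: integral_add)
  moreover have "norm (f x - s x) \<le> k x + norm (g x - s x)" if "x \<in> S" for x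
    using norm_triangle_ineq[of "f x - g x" "g x - s x"] bspec[OF le that] by simp
  ultimately show "\<exists>s k. Bochner_Integration.simple_bochner_integrable (lebesgue_on S) s \<and>
      k integrable_on S \<and> integral S k < e \<and> (\<forall>x\<in>S. norm (f x - s x) \<le> k x)"
    using s by blast
qed

section \<open>Closure properties of Bochner integrability\<close>

lemma banach_integrable_cong:
  fixes f g :: "'a::euclidean_space \<Rightarrow> 'b::banach"
  assumes S: "S \<in> sets lebesgue" and "banach_integrable (lebesgue_on S) f" "\<And>x. x \<in> S \<Longrightarrow> f x = g x"
  shows "banach_integrable (lebesgue_on S) g"
  using assms(2,3) by (intro banach_integrableI_approx[OF S] exI[of _ f] exI[of _ "\<lambda>_. 0"]) (auto intro: integrable_0)

lemma banach_integrable_norm: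
  fixes f :: "'a::euclidean_space \<Rightarrow> 'b::banach"
  assumes S: "S \<in> sets lebesgue" and f: "banach_integrable (lebesgue_on S) f"
  shows "(\<lambda>x. norm (f x)) integrable_on S"
proof -
  have fm: "f \<in> borel_measurable (lebesgue_on S)"
    using f unfolding banach_integrable_def has_banach_integral_def by blast
  obtain s where s: "Bochner_Integration.simple_bochner_integrable (lebesgue_on S) s"
    and d: "(\<lambda>x. norm (f x - s x)) integrable_on S"
    using banach_integrable_simple_approx[OF S f zero_less_one] by blast
  \<comment> \<open>The composition rule is binary; \<open>s\<close> fills the second argument as a
    dummy.\<close>
  have "Bochner_Integration.simple_bochner_integrable (lebesgue_on S) (\<lambda>x. norm (s x))"
    by (rule simple_bochner_integrable_compose2[OF _ s s, where p="\<lambda>x y. norm x"]) simp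
  then have "(\<lambda>x. norm (s x)) integrable_on S"
    using has_integral_simple_bochner_integral[OF S] by (blast intro: has_integral_integrable)
  with d have "(\<lambda>x. norm (f x - s x) + norm (s x)) integrable_on S" by (rule integrable_add)
  then show ?thesis
  proof (rule measurable_bounded_by_integrable_imp_integrable[rotated])
    show "norm (norm (f x)) \<le> norm (f x - s x) + norm (s x)" if "x \<in> S" for x
      using norm_triangle_ineq[of "f x - s x" "s x"] by simp
  qed (use fm S in auto)
qed

lemma banach_integrable_add:
  fixes f g :: "'a::euclidean_space \<Rightarrow> 'b::banach"
  assumes S: "S \<in> sets lebesgue"
    and f: "banach_integrable (lebesgue_on S) f" and g: "banach_integrable (lebesgue_on S) g"
  shows "banach_integrable (lebesgue_on S) (\<lambda>x. f x + g x)"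
proof (rule banach_integrableI_simple_approx[OF S])
  fix e :: real assume "e > 0"
  then have e2: "e/2 > 0" by simp
  from banach_integrable_simple_approx[OF S f e2] obtain s
    where s: "Bochner_Integration.simple_bochner_integrable (lebesgue_on S) s"
    and fs: "(\<lambda>x. norm (f x - s x)) integrable_on S" "integral S (\<lambda>x. norm (f x - s x)) < e/2" .
  from banach_integrable_simple_approx[OF S g e2] obtain r
    where r: "Bochner_Integration.simple_bochner_integrable (lebesgue_on S) r"
    and gr: "(\<lambda>x. norm (g x - r x)) integrable_on S" "integral S (\<lambda>x. norm (g x - r x)) < e/2" .
  have "Bochner_Integration.simple_bochner_integrable (lebesgue_on S) (\<lambda>x. s x + r x)"
    by (rule simple_bochner_integrable_compose2[OF _ s r]) simp
  moreover have "(\<lambda>x. norm (f x - s x) + norm (g x - r x)) integrable_on S" 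
    using fs gr by (intro integrable_add)
  moreover have "integral S (\<lambda>x. norm (f x - s x) + norm (g x - r x)) < e"
    using fs gr by (simp add: integral_add)
  moreover have "norm (f x + g x - (s x + r x)) \<le> norm (f x - s x) + norm (g x - r x)" for x
    by (rule norm_diff_triangle_ineq)
  ultimately show "\<exists>s k. Bochner_Integration.simple_bochner_integrable (lebesgue_on S) s \<and>
      k integrable_on S \<and> integral S k < e \<and> (\<forall>x\<in>S. norm (f x + g x - s x) \<le> k x)"
    by blast
qed

lemma banach_integrable_sum:
  fixes f :: "'i \<Rightarrow> 'a::euclidean_space \<Rightarrow> 'b::banach"
  assumes S: "S \<in> sets lebesgue" and "\<And>i. i \<in> I \<Longrightarrow> banach_integrable (lebesgue_on S) (f i)"
  shows "banach_integrable (lebesgue_on S) (\<lambda>x. \<Sum>i\<in>I. f i x)"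
proof -
  have 0: "banach_integrable (lebesgue_on S) (\<lambda>x. 0::'b)"
    by (rule banach_integrable_simple[OF S]) (auto simp: simple_bochner_integrable.simps)
  show ?thesis using assms(2)
    by (induction I rule: infinite_finite_induct) (auto simp: 0 intro!: banach_integrable_add[OF S])
qed

lemma banach_integrable_bounded_linear:
  fixes f :: "'a::euclidean_space \<Rightarrow> 'b::banach" and h :: "'b \<Rightarrow> 'c::banach"
  assumes S: "S \<in> sets lebesgue" and h: "bounded_linear h" and f: "banach_integrable (lebesgue_on S) f"
  shows "banach_integrable (lebesgue_on S) (\<lambda>x. h (f x))"
proof (rule banach_integrableI_simple_approx[OF S])
  interpret bounded_linear h by fact
  from pos_bounded obtain K where K: "K > 0" "\<And>x. norm (h x) \<le> norm x * K" by blast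
  fix e :: real assume "e > 0"
  then have e': "e/K > 0" using K by simp
  from banach_integrable_simple_approx[OF S f e'] obtain s
    where s: "Bochner_Integration.simple_bochner_integrable (lebesgue_on S) s"
    and fs: "(\<lambda>x. norm (f x - s x)) integrable_on S" "integral S (\<lambda>x. norm (f x - s x)) < e/K" .
  have "Bochner_Integration.simple_bochner_integrable (lebesgue_on S) (\<lambda>x. h (s x))"
    by (rule simple_bochner_integrable_compose2[OF _ s s, where p="\<lambda>x y. h x"]) (simp add: zero)
  moreover have "(\<lambda>x. norm (f x - s x) * K) integrable_on S" 
    using fs by (intro integrable_on_mult_left)
  moreover have "integral S (\<lambda>x. norm (f x - s x) * K) < e"
    using fs K by (simp add: pos_less_divide_eq)
  moreover have "norm (h (f x) - h (s x)) \<le> norm (f x - s x) * K" for x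
    using K(2)[of "f x - s x"] by (simp add: diff)
  ultimately show "\<exists>s k. Bochner_Integration.simple_bochner_integrable (lebesgue_on S) s \<and>
      k integrable_on S \<and> integral S k < e \<and> (\<forall>x\<in>S. norm (h (f x) - s x) \<le> k x)"
    by blast
qed

lemma banach_integrable_Int:
  fixes f :: "'a::euclidean_space \<Rightarrow> 'b::banach"
  assumes S: "S \<in> sets lebesgue" and R: "R \<in> sets lebesgue"
    and f: "banach_integrable (lebesgue_on S) f" 
  shows "banach_integrable (lebesgue_on (S \<inter> R)) f"
proof (rule banach_integrableI_simple_approx)
  show SR: "S \<inter> R \<in> sets lebesgue" using S R by blast
  fix e :: real assume e: "e > 0"
  from banach_integrable_simple_approx[OF S f e] obtain s
    where s: "Bochner_Integration.simple_bochner_integrable (lebesgue_on S) s"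
    and fs: "(\<lambda>x. norm (f x - s x)) integrable_on S" "integral S (\<lambda>x. norm (f x - s x)) < e" .
  have sf: "simple_function (lebesgue_on S) s" and fin: "emeasure (lebesgue_on S) {x\<in>S. s x \<noteq> 0} \<noteq> \<infinity>"
    using s by (auto simp: simple_bochner_integrable.simps)
  have "Bochner_Integration.simple_bochner_integrable (lebesgue_on (S \<inter> R)) s"
  proof
    show "simple_function (lebesgue_on (S \<inter> R)) s"
      unfolding simple_function_def
    proof safe
      show "finite (s ` space (lebesgue_on (S \<inter> R)))"
        using sf by (auto simp: simple_function_def intro: finite_subset[of _ "s ` S"])
      fix x
      have "s -` {s x} \<inter> S \<in> sets (lebesgue_on S)" using simple_functionD(2)[OF sf, of "{s x}"] by simp
      then have "s -` {s x} \<inter> S \<inter> R \<in> sets lebesgue" using S R by (auto simp: sets_restrict_space_iff)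
      then show "s -` {s x} \<inter> space (lebesgue_on (S \<inter> R)) \<in> sets (lebesgue_on (S \<inter> R))"
        using SR by (auto simp add: sets_restrict_space_iff Int_assoc)
    qed
    have "{x\<in>S. s x \<noteq> 0} = s -` (-{0}) \<inter> space (lebesgue_on S)" by auto
    then have *: "{x\<in>S. s x \<noteq> 0} \<in> sets (lebesgue_on S)"
      using simple_functionD(2)[OF sf, of "-{0}"] by simp
    have "emeasure (lebesgue_on (S \<inter> R)) {x\<in>space (lebesgue_on (S \<inter> R)). s x \<noteq> 0} = emeasure lebesgue ({x\<in>S. s x \<noteq> 0} \<inter> R)"
      using SR by (subst emeasure_restrict_space) (auto intro!: arg_cong[where f="emeasure lebesgue"])
    also have "\<dots> \<le> emeasure lebesgue {x\<in>S. s x \<noteq> 0}"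
      using * S by (intro emeasure_mono) (auto simp: sets_restrict_space_iff)
    also have "\<dots> = emeasure (lebesgue_on S) {x\<in>S. s x \<noteq> 0}"
      using S by (subst emeasure_restrict_space) auto
    finally show "emeasure (lebesgue_on (S \<inter> R)) {x\<in>space (lebesgue_on (S \<inter> R)). s x \<noteq> 0} \<noteq> \<infinity>"
      using fin by (auto simp: top_unique)
  qed
  moreover have *: "(\<lambda>x. norm (f x - s x)) integrable_on S \<inter> R"
  proof -
    have "(\<lambda>x. norm (f x - s x)) absolutely_integrable_on S"
      using fs(1) by (intro nonnegative_absolutely_integrable_1) auto
    then have "(\<lambda>x. norm (f x - s x)) absolutely_integrable_on S \<inter> R"
      by (rule set_integrable_subset) (use SR in auto)
    then show ?thesis by (rule set_lebesgue_integral_eq_integral)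
  qed
  moreover have "integral (S \<inter> R) (\<lambda>x. norm (f x - s x)) < e"
    using integral_subset_le[OF _ * fs(1)] fs(2) by force
  ultimately show "\<exists>s k. Bochner_Integration.simple_bochner_integrable (lebesgue_on (S \<inter> R)) s \<and>
      k integrable_on (S \<inter> R) \<and> integral (S \<inter> R) k < e \<and> (\<forall>x\<in>S \<inter> R. norm (f x - s x) \<le> k x)"
    by blast
qed

lemma banach_integrable_subset:
  fixes f :: "'a::euclidean_space \<Rightarrow> 'b::banach"
  assumes "S \<in> sets lebesgue" "R \<in> sets lebesgue" "R \<subseteq> S"
    and "banach_integrable (lebesgue_on S) f" 
  shows "banach_integrable (lebesgue_on R) f"
  using banach_integrable_Int[OF assms(1,2,4)] assms(3) by (simp add: inf.absorb2)

lemma banach_integrable_extend: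
  fixes f :: "'a::euclidean_space \<Rightarrow> 'b::banach"
  assumes S: "S \<in> sets lebesgue" and R: "R \<in> sets lebesgue" "R \<subseteq> S"
    and f: "banach_integrable (lebesgue_on R) f" 
  shows "banach_integrable (lebesgue_on S) (\<lambda>x. indicator R x *\<^sub>R f x)"
proof (rule banach_integrableI_simple_approx[OF S])
  fix e :: real assume e: "e > 0"
  from banach_integrable_simple_approx[OF R(1) f e] obtain s
    where s: "Bochner_Integration.simple_bochner_integrable (lebesgue_on R) s"
    and fs: "(\<lambda>x. norm (f x - s x)) integrable_on R" "integral R (\<lambda>x. norm (f x - s x)) < e" .
  have sf: "simple_function (lebesgue_on R) s" and fin: "emeasure (lebesgue_on R) {x\<in>R. s x \<noteq> 0} \<noteq> \<infinity>"
    using s by (auto simp: simple_bochner_integrable.simps)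
  define s' where "s' x = indicator R x *\<^sub>R s x" for x
  have s'_if: "s' = (\<lambda>x. if x \<in> R then s x else 0)" by (auto simp: s'_def indicator_def)
  have "Bochner_Integration.simple_bochner_integrable (lebesgue_on S) s'"
  proof
    show "simple_function (lebesgue_on S) s'"
      unfolding simple_function_def
    proof (intro conjI ballI)
      have "s' ` S \<subseteq> insert 0 (s ` R)" by (auto simp: s'_if)
      then show "finite (s' ` space (lebesgue_on S))"
        using sf by (auto simp: simple_function_def intro: finite_subset)
      fix y
      have "s -` {y} \<inter> R \<in> sets lebesgue"
        using simple_functionD(2)[OF sf, of "{y}"] R by (simp add: sets_restrict_space_iff)
      moreover have "s' -` {y} \<inter> S = (s -` {y} \<inter> R) \<union> (if y = 0 then S - R else {})"
        using R by (auto simp: s'_if split: if_splits)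
      ultimately show "s' -` {y} \<inter> space (lebesgue_on S) \<in> sets (lebesgue_on S)"
        using S R by (auto simp: sets_restrict_space_iff)
    qed
    have "{x\<in>S. s' x \<noteq> 0} = {x\<in>R. s x \<noteq> 0}" using R by (auto simp: s'_if)
    then have "emeasure (lebesgue_on S) {x\<in>S. s' x \<noteq> 0} = emeasure (lebesgue_on R) {x\<in>R. s x \<noteq> 0}"
      using S R by (simp add: emeasure_restrict_space subset_iff)
    then show "emeasure (lebesgue_on S) {x\<in>space (lebesgue_on S). s' x \<noteq> 0} \<noteq> \<infinity>"
      using fin by simp
  qed
  moreover have "((\<lambda>x. indicator R x * norm (f x - s x)) has_integral integral R (\<lambda>x. norm (f x - s x))) S"
  proof -
    have "(\<lambda>x. indicator R x * norm (f x - s x)) = (\<lambda>x. if x \<in> R then norm (f x - s x) else 0)"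
      by (auto simp: indicator_def)
    then show ?thesis using fs(1) R(2) by (simp add: has_integral_restrict integrable_integral)
  qed
  then have "(\<lambda>x. indicator R x * norm (f x - s x)) integrable_on S"
    "integral S (\<lambda>x. indicator R x * norm (f x - s x)) < e"
    using fs(2) by (auto simp: integral_unique intro: has_integral_integrable)
  moreover have "norm (indicator R x *\<^sub>R f x - s' x) \<le> indicator R x * norm (f x - s x)" for x
    by (auto simp: s'_def indicator_def)
  ultimately show "\<exists>s k. Bochner_Integration.simple_bochner_integrable (lebesgue_on S) s \<and>
      k integrable_on S \<and> integral S k < e \<and> (\<forall>x\<in>S. norm (indicator R x *\<^sub>R f x - s x) \<le> k x)"
    by blast
qed

lemma banach_integrable_indicator:
  fixes f :: "'a::euclidean_space \<Rightarrow> 'b::banach"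
  assumes S: "S \<in> sets lebesgue" and R: "R \<in> sets lebesgue"
    and f: "banach_integrable (lebesgue_on S) f" 
  shows "banach_integrable (lebesgue_on S) (\<lambda>x. indicator R x *\<^sub>R f x)"
proof (rule banach_integrable_cong[OF S])
  show "banach_integrable (lebesgue_on S) (\<lambda>x. indicator (S \<inter> R) x *\<^sub>R f x)"
    using S R by (intro banach_integrable_extend banach_integrable_Int f) auto
qed (auto simp: indicator_def)

text \<open>By uniform continuity \<open>f\<close> is close to its samples on a fine grid, and these
  samples form a simple function on a bounded interval.\<close>

lemma banach_integrable_continuous:
  fixes f :: "real \<Rightarrow> 'b::banach"
  assumes f: "continuous_on {a..b} f"
  shows "banach_integrable (lebesgue_on {a..b}) f"
proof (rule banach_integrableI_simple_approx)
  show "{a..b} \<in> sets lebesgue" by simp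
  fix e :: real assume e: "e > 0"
  \<comment> \<open>Adding 1 keeps the divisor positive and leaves room for the strict bound on the
    integral.\<close>
  define e' where "e' = e / (\<bar>b - a\<bar> + 1)"
  have e': "e' > 0" using e by (auto simp: e'_def)
  have "uniformly_continuous_on {a..b} f" using f by (simp add: compact_uniformly_continuous)
  then obtain d where d: "d > 0" "\<And>x y. x \<in> {a..b} \<Longrightarrow> y \<in> {a..b} \<Longrightarrow> dist x y < d \<Longrightarrow> dist (f x) (f y) < e'"
    unfolding uniformly_continuous_on_def using e' by metis
  define h where "h = d / 2"
  have h: "h > 0" using d by (simp add: h_def)
  \<comment> \<open>The sample is taken at the last grid point not beyond \<open>x\<close>, which
    therefore stays in \<open>{a..b}\<close>.\<close>
  define s where "s x = f (a + h * of_int \<lfloor>(x - a) / h\<rfloor>)" for x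
  have near: "a + h * of_int \<lfloor>(x - a) / h\<rfloor> \<in> {a..b}" "dist x (a + h * of_int \<lfloor>(x - a) / h\<rfloor>) < d" if "x \<in> {a..b}" for x
  proof -
    have "0 \<le> (x - a) / h" using that h by simp
    then have 0: "0 \<le> of_int \<lfloor>(x - a) / h\<rfloor> * h" using h by simp
    have 1: "of_int \<lfloor>(x - a) / h\<rfloor> * h \<le> x - a" 
      using h by (rule floor_divide_lower)
    have 2: "x - a < of_int \<lfloor>(x - a) / h\<rfloor> * h + h" 
      using floor_divide_upper[OF h, of "x - a"] by (simp add: algebra_simps)
    show "a + h * of_int \<lfloor>(x - a) / h\<rfloor> \<in> {a..b}" using 0 1 that by (simp add: mult.commute)
    show "dist x (a + h * of_int \<lfloor>(x - a) / h\<rfloor>) < d"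
      using 1 2 d by (simp add: mult.commute h_def dist_real_def abs_less_iff)
  qed
  have "Bochner_Integration.simple_bochner_integrable (lebesgue_on {a..b}) s"
  proof
    show "simple_function (lebesgue_on {a..b}) s"
    proof -
      have fl: "simple_function (lebesgue_on {a..b}) (\<lambda>x. \<lfloor>(x - a) / h\<rfloor>)"
        unfolding simple_function_def
      proof (intro conjI ballI)
        have "(\<lambda>x. \<lfloor>(x - a) / h\<rfloor>) ` {a..b} \<subseteq> {0..\<lfloor>(b - a) / h\<rfloor>}"
          using h by (auto intro!: floor_mono divide_right_mono)
        then show "finite ((\<lambda>x. \<lfloor>(x - a) / h\<rfloor>) ` space (lebesgue_on {a..b}))"
          by (auto intro: finite_subset)
        fix j
        have "\<lfloor>(x - a) / h\<rfloor> = j \<longleftrightarrow> a + h * of_int j \<le> x \<and> x < a + h * (of_int j + 1)" for x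
          using h by (simp add: floor_eq_iff field_simps)
        then have "(\<lambda>x. \<lfloor>(x - a) / h\<rfloor>) -` {j} \<inter> {a..b} = {a + h * of_int j ..< a + h * (of_int j + 1)} \<inter> {a..b}"
          by (intro set_eqI) simp
        then show "(\<lambda>x. \<lfloor>(x - a) / h\<rfloor>) -` {j} \<inter> space (lebesgue_on {a..b}) \<in> sets (lebesgue_on {a..b})"
          by (simp add: sets_restrict_space_iff)
      qed
      have "s = (\<lambda>j. f (a + h * of_int j)) \<circ> (\<lambda>x. \<lfloor>(x - a) / h\<rfloor>)" by (auto simp: s_def)
      then show ?thesis using simple_function_compose[OF fl, of "\<lambda>j. f (a + h * of_int j)"] by simp
    qed
    have "emeasure (lebesgue_on {a..b}) {y \<in> space (lebesgue_on {a..b}). s y \<noteq> 0}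
        \<le> emeasure (lebesgue_on {a..b}) (space (lebesgue_on {a..b}))"
      by (rule emeasure_space)
    also have "\<dots> < \<infinity>" by (cases "a \<le> b") (simp_all add: emeasure_restrict_space)
    finally show "emeasure (lebesgue_on {a..b}) {y \<in> space (lebesgue_on {a..b}). s y \<noteq> 0} \<noteq> \<infinity>" by simp
  qed
  moreover have "(\<lambda>_. e') integrable_on {a..b}" by (rule integrable_const_ivl)
  moreover have "integral {a..b} (\<lambda>_. e') < e"
  proof -
    have "measure lborel {a..b} \<le> \<bar>b - a\<bar>" by (cases "a \<le> b") auto
    then have "integral {a..b} (\<lambda>_. e') \<le> \<bar>b - a\<bar> * e'" using e' by (auto intro!: mult_right_mono)
    also have "\<dots> < (\<bar>b - a\<bar> + 1) * e'" using e' by simp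
    also have "\<dots> = e" by (simp add: e'_def)
    finally show ?thesis .
  qed
  moreover have "norm (f x - s x) \<le> e'" if "x \<in> {a..b}" for x
    using d(2)[OF that near[OF that]] by (simp add: s_def dist_norm)
  ultimately show "\<exists>s k. Bochner_Integration.simple_bochner_integrable (lebesgue_on {a..b}) s \<and>
      k integrable_on {a..b} \<and> integral {a..b} k < e \<and> (\<forall>x\<in>{a..b}. norm (f x - s x) \<le> k x)"
    by blast
qed

text \<open>The family is only strongly integrable, that is, for each fixed vector. Replacing
  \<open>f\<close> by a simple function leaves finitely many fixed vectors, one on each level set,
  and the uniform bound controls the error. It is applied to \<open>T (t - s)\<close> and to
  multiplication by a test function.\<close>

lemma banach_integrable_operator_family:
  fixes f :: "'a::euclidean_space \<Rightarrow> 'b::banach" and H :: "'a \<Rightarrow> 'b \<Rightarrow> 'c::banach"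
  assumes S: "S \<in> sets lebesgue" and f: "banach_integrable (lebesgue_on S) f"
    and H: "\<And>y. banach_integrable (lebesgue_on S) (\<lambda>x. H x y)"
    and lin: "\<And>x. x \<in> S \<Longrightarrow> linear (H x)"
    and bound: "\<And>x y. x \<in> S \<Longrightarrow> norm (H x y) \<le> C * norm y"
  shows "banach_integrable (lebesgue_on S) (\<lambda>x. H x (f x))"
proof (rule banach_integrableI_approx[OF S])
  fix e :: real assume e: "e > 0"
  \<comment> \<open>The bound \<open>C\<close> may fail to be positive, and the error is divided by
    it.\<close>
  define C' where "C' = \<bar>C\<bar> + 1"
  have C': "C' > 0" by (simp add: C'_def)
  have bound': "norm (H x y) \<le> C' * norm y" if "x \<in> S" for x y
  proof -
    have "C \<le> C'" by (simp add: C'_def)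
    then show ?thesis using bound[OF that, of y] mult_right_mono[OF _ norm_ge_zero] order_trans by blast
  qed
  have "e/C' > 0" using e C' by simp
  from banach_integrable_simple_approx[OF S f this] obtain s
    where s: "Bochner_Integration.simple_bochner_integrable (lebesgue_on S) s"
    and fs: "(\<lambda>x. norm (f x - s x)) integrable_on S" "integral S (\<lambda>x. norm (f x - s x)) < e/C'" .
  have sf: "simple_function (lebesgue_on S) s"
    using s by (auto simp: simple_bochner_integrable.simps)
  define E where "E y = {x\<in>S. s x = y}" for y
  have "banach_integrable (lebesgue_on S) (\<lambda>x. \<Sum>y\<in>s ` S - {0}. indicator (E y) x *\<^sub>R H x y)"
    using simple_bochner_integrable_level_set[OF S s]
    by (intro banach_integrable_sum banach_integrable_indicator S H) (auto simp: E_def)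
  then have "banach_integrable (lebesgue_on S) (\<lambda>x. H x (s x))"
  proof (rule banach_integrable_cong[OF S])
    show "(\<Sum>y\<in>s ` S - {0}. indicator (E y) x *\<^sub>R H x y) = H x (s x)" if "x \<in> S" for x
      using simple_bochner_integrable_sum_indicator[OF s, of x "H x"] that linear_0[OF lin[OF that]]
      by (simp add: E_def)
  qed
  moreover have "(\<lambda>x. C' * norm (f x - s x)) integrable_on S"
    using integrable_on_cmult_left[OF fs(1), of C'] by simp
  moreover have "integral S (\<lambda>x. C' * norm (f x - s x)) < e"
    using fs(2) C' by (simp add: pos_less_divide_eq mult.commute)
  moreover have "norm (H x (f x) - H x (s x)) \<le> C' * norm (f x - s x)" if "x \<in> S" for x
    using bound'[OF that, of "f x - s x"] by (simp add: linear_diff[OF lin[OF that]])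
  ultimately show "\<exists>g k. banach_integrable (lebesgue_on S) g \<and>
      k integrable_on S \<and> integral S k < e \<and> (\<forall>x\<in>S. norm (H x (f x) - g x) \<le> k x)"
    by (intro exI[of _ "\<lambda>x. H x (s x)"] exI[of _ "\<lambda>x. C' * norm (f x - s x)"]) blast
qed

section \<open>Strongly continuous semigroups\<close>

text \<open>The closed sets \<open>C n\<close> cover the complete space, so by Baire one of them
  contains a ball around some \<open>z\<close>. Writing \<open>x\<close> as
  \<open>(z + x) - z\<close> moves the ball to the origin at the cost of doubling \<open>n\<close>;
  rescaling \<open>x\<close> to norm \<open>r / 2\<close> then gives the constant
  \<open>4 * n / r\<close>.\<close>

lemma uniform_boundedness:
  fixes F :: "'i \<Rightarrow> 'a::banach \<Rightarrow> 'b::real_normed_vector"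
  assumes lin: "\<And>i. i \<in> I \<Longrightarrow> bounded_linear (F i)"
    and pointwise: "\<And>x. \<exists>K. \<forall>i\<in>I. norm (F i x) \<le> K"
  shows "\<exists>M\<ge>0. \<forall>i\<in>I. \<forall>x. norm (F i x) \<le> M * norm x"
proof -
  define C where "C n = {x. \<forall>i\<in>I. norm (F i x) \<le> real n}" for n
  have "closed (C n)" for n
  proof -
    have "C n = (\<Inter>i\<in>I. {x. norm (F i x) \<le> real n})" by (auto simp: C_def)
    also have "closed \<dots>"
      using lin by (intro closed_INT ballI closed_Collect_le continuous_intros)
        (auto intro!: continuous_on_norm linear_continuous_on)
    finally show ?thesis .
  qed
  moreover have "(\<Union>n. C n) = UNIV"
  proof -
    have "x \<in> (\<Union>n. C n)" for x
    proof -
      obtain K where K: "\<forall>i\<in>I. norm (F i x) \<le> K" using pointwise by blast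
      obtain n where "K \<le> real n" using real_arch_simple by blast
      with K show ?thesis by (auto simp: C_def intro: order_trans)
    qed
    then show ?thesis by blast
  qed
  moreover have "Met_TC.mcomplete TYPE('a)"
    by (auto simp: Met_TC.mcomplete_def Cauchy_convergent_iff convergent_def)
  ultimately have "\<exists>n. euclidean interior_of (C n) \<noteq> {}"
  proof (rule_tac ccontr)
    assume cl: "\<And>n. closed (C n)" and UN: "(\<Union>n. C n) = UNIV" and "Met_TC.mcomplete TYPE('a)"
      and "\<not> (\<exists>n. euclidean interior_of (C n) \<noteq> {})"
    then have "Met_TC.mtopology interior_of \<Union>(range C) = {}"
      by (intro Met_TC.metric_Baire_category_alt) auto
    then show False using UN interior_of_topspace[of euclidean] by simp
  qed
  then obtain n where "euclidean interior_of (C n) \<noteq> {}" by blast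
  then obtain S z where S: "open S" "z \<in> S" "S \<subseteq> C n" by (auto simp: interior_of_def)
  then obtain r where r: "r > 0" "ball z r \<subseteq> C n" by (meson open_contains_ball order_trans)
  have zC: "norm (F i z) \<le> n" if "i \<in> I" for i using S that by (auto simp: C_def)
  have small: "norm (F i x) \<le> 2 * n" if "i \<in> I" "norm x < r" for i x
  proof -
    have "z + x \<in> C n" using r that by (auto simp: subset_iff dist_norm)
    then have "norm (F i (z + x)) \<le> n" using that by (auto simp: C_def)
    moreover have "F i x = F i (z + x) - F i z"
      using lin[OF that(1)] by (simp add: linear_add bounded_linear.linear)
    ultimately show ?thesis using zC[OF that(1)] norm_triangle_ineq4[of "F i (z + x)" "F i z"] by simp
  qed
  have "norm (F i x) \<le> (4 * n / r) * norm x" if "i \<in> I" for i x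
  proof (cases "x = 0")
    case True
    then show ?thesis using lin[OF that] by (simp add: linear_0 bounded_linear.linear)
  next
    case False
    define c where "c = r / (2 * norm x)"
    have c: "c > 0" using r False by (simp add: c_def)
    have "norm (c *\<^sub>R x) < r" using r False by (simp add: c_def)
    from small[OF that this] have "c * norm (F i x) \<le> 2 * n"
      using lin[OF that] c by (simp add: linear_scale bounded_linear.linear)
    then show ?thesis using c r False by (simp add: c_def field_simps)
  qed
  then show ?thesis using r by (intro exI[of _ "4 * n / r"]) auto
qed

text \<open>Signed quotients allow derivatives along the semigroup, one-sided ones included, to be
  computed as plain limits by means of joint continuity.\<close>

lemma has_vector_derivative_within_iff_Lim:
  "(f has_vector_derivative f') (at x within S) \<longleftrightarrow>
    ((\<lambda>y. (1 / (y - x)) *\<^sub>R (f y - f x)) \<longlongrightarrow> f') (at x within S)"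
proof -
  have "(f has_vector_derivative f') (at x within S) \<longleftrightarrow>
     ((\<lambda>y. (1 / norm (y - x)) *\<^sub>R (f y - (f x + (y - x) *\<^sub>R f'))) \<longlongrightarrow> 0) (at x within S)"
    by (simp add: has_vector_derivative_def has_derivative_within bounded_linear_scaleR_left)
  also have "\<dots> \<longleftrightarrow> ((\<lambda>y. norm ((1 / norm (y - x)) *\<^sub>R (f y - (f x + (y - x) *\<^sub>R f')))) \<longlongrightarrow> 0) (at x within S)"
    by (rule tendsto_norm_zero_iff[symmetric])
  also have "\<dots> \<longleftrightarrow> ((\<lambda>y. norm ((1 / (y - x)) *\<^sub>R (f y - f x) - f')) \<longlongrightarrow> 0) (at x within S)"
  proof (intro filterlim_cong refl)
    have "norm ((1 / norm (y - x)) *\<^sub>R (f y - (f x + (y - x) *\<^sub>R f'))) = norm ((1 / (y - x)) *\<^sub>R (f y - f x) - f')"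
      if "y \<noteq> x" for y
    proof -
      have "(1 / (y - x)) *\<^sub>R (f y - f x) - f' = (1 / (y - x)) *\<^sub>R (f y - (f x + (y - x) *\<^sub>R f'))"
        using that by (simp add: scaleR_diff_right scaleR_add_right diff_diff_eq)
      then show ?thesis by simp
    qed
    then show "\<forall>\<^sub>F y in at x within S. norm ((1 / norm (y - x)) *\<^sub>R (f y - (f x + (y - x) *\<^sub>R f')))
        = norm ((1 / (y - x)) *\<^sub>R (f y - f x) - f')"
      by (auto simp: eventually_at_filter)
  qed
  also have "\<dots> \<longleftrightarrow> ((\<lambda>y. (1 / (y - x)) *\<^sub>R (f y - f x)) \<longlongrightarrow> f') (at x within S)"
    by (simp add: tendsto_norm_zero_iff LIM_zero_iff)
  finally show ?thesis .
qed

text \<open>Phrased in the increment \<open>h\<close> to match the quotients that define a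
  generator.\<close>

lemma integral_right_difference_quotient:
  fixes f :: "real \<Rightarrow> 'a::banach"
  assumes f: "continuous_on {a..} f" and "a \<le> t"
  shows "((\<lambda>h. (1 / h) *\<^sub>R (integral {a..t + h} f - integral {a..t} f)) \<longlongrightarrow> f t) (at_right 0)"
proof -
  have "((\<lambda>u. integral {a..u} f) has_vector_derivative f t) (at t within {a..t + 1})"
    using assms by (intro integral_has_vector_derivative) (auto intro: continuous_on_subset)
  then have "((\<lambda>u. integral {a..u} f) has_vector_derivative f t) (at t within {t..t + 1})"
    by (rule has_vector_derivative_within_subset) (use assms in auto)
  then have "((\<lambda>u. (1 / (u - t)) *\<^sub>R (integral {a..u} f - integral {a..t} f)) \<longlongrightarrow> f t) (at_right t)"
    by (simp add: has_vector_derivative_within_iff_Lim at_within_Icc_at_right)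
  then show ?thesis by (simp add: filterlim_at_right_to_0[of _ _ t] add.commute)
qed

text \<open>Limits, derivatives and integrals involve real scalars, so the scalar field and its
  multiplication are dropped; the same theory then serves the space and the product space.\<close>

locale semigroup_generator =
  fixes D :: "'a::banach set" and B :: "'a \<Rightarrow> 'a" and T :: "real \<Rightarrow> 'a \<Rightarrow> 'a"
  assumes bounded_linear_T: "\<And>t. t \<ge> 0 \<Longrightarrow> bounded_linear (T t)"
    and T_0: "\<And>x. T 0 x = x"
    and T_add: "\<And>s t x. s \<ge> 0 \<Longrightarrow> t \<ge> 0 \<Longrightarrow> T (s + t) x = T s (T t x)"
    and continuous_orbit: "\<And>x. continuous_on {0..} (\<lambda>t. T t x)"
    and D_eq: "D = {x. \<exists>y. ((\<lambda>h. (1 / h) *\<^sub>R (T h x - x)) \<longlongrightarrow> y) (at_right 0)}"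
    and B_lim: "\<And>x. x \<in> D \<Longrightarrow> ((\<lambda>h. (1 / h) *\<^sub>R (T h x - x)) \<longlongrightarrow> B x) (at_right 0)"
begin

section \<open>Linearity of the generator and joint continuity of the semigroup\<close>

lemma generatorI:
  assumes "((\<lambda>h. (1 / h) *\<^sub>R (T h x - x)) \<longlongrightarrow> y) (at_right 0)"
  shows "x \<in> D" "B x = y"
proof -
  show "x \<in> D" using assms by (auto simp: D_eq)
  then show "B x = y" using tendsto_unique[OF _ B_lim assms] by (simp add: trivial_limit_at_right_real)
qed

lemma T_linear: "t \<ge> 0 \<Longrightarrow> linear (T t)"
  using bounded_linear_T bounded_linear.linear by blast

lemmas T_diff = linear_diff[OF T_linear] and T_plus = linear_add[OF T_linear]
  and T_scaleR = linear_scale[OF T_linear] and T_zero = linear_0[OF T_linear]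

lemma D_0: "0 \<in> D" and B_0: "B 0 = 0"
proof -
  have "((\<lambda>h. (1 / h) *\<^sub>R (T h 0 - 0)) \<longlongrightarrow> 0) (at_right 0)"
    by (rule tendsto_eventually) (auto simp: eventually_at_right_less T_zero eventually_at_filter)
  then show "0 \<in> D" "B 0 = 0" by (rule generatorI)+
qed

lemma assumes "x \<in> D" "y \<in> D" shows D_add: "x + y \<in> D" and B_add: "B (x + y) = B x + B y"
proof -
  have "((\<lambda>h. (1 / h) *\<^sub>R (T h x - x) + (1 / h) *\<^sub>R (T h y - y)) \<longlongrightarrow> B x + B y) (at_right 0)"
    by (intro tendsto_add B_lim assms)
  moreover have "\<forall>\<^sub>F h in at_right 0. (1 / h) *\<^sub>R (T h x - x) + (1 / h) *\<^sub>R (T h y - y) = (1 / h) *\<^sub>R (T h (x + y) - (x + y))"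
    by (auto simp: eventually_at_filter T_plus algebra_simps)
  ultimately have "((\<lambda>h. (1 / h) *\<^sub>R (T h (x + y) - (x + y))) \<longlongrightarrow> B x + B y) (at_right 0)"
    by (rule Lim_transform_eventually)
  then show "x + y \<in> D" "B (x + y) = B x + B y" by (rule generatorI)+
qed

lemma assumes "x \<in> D" shows D_scaleR: "c *\<^sub>R x \<in> D" and B_scaleR: "B (c *\<^sub>R x) = c *\<^sub>R B x"
proof -
  have "((\<lambda>h. c *\<^sub>R ((1 / h) *\<^sub>R (T h x - x))) \<longlongrightarrow> c *\<^sub>R B x) (at_right 0)"
    by (intro tendsto_scaleR tendsto_const B_lim assms)
  moreover have "\<forall>\<^sub>F h in at_right 0. c *\<^sub>R ((1 / h) *\<^sub>R (T h x - x)) = (1 / h) *\<^sub>R (T h (c *\<^sub>R x) - c *\<^sub>R x)"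
    by (auto simp: eventually_at_filter T_scaleR algebra_simps)
  ultimately have "((\<lambda>h. (1 / h) *\<^sub>R (T h (c *\<^sub>R x) - c *\<^sub>R x)) \<longlongrightarrow> c *\<^sub>R B x) (at_right 0)"
    by (rule Lim_transform_eventually)
  then show "c *\<^sub>R x \<in> D" "B (c *\<^sub>R x) = c *\<^sub>R B x" by (rule generatorI)+
qed

lemma assumes "x \<in> D" "y \<in> D" shows D_diff: "x - y \<in> D" and B_diff: "B (x - y) = B x - B y"
  using D_add[OF assms(1) D_scaleR[OF assms(2), of "-1"]] B_add[OF assms(1) D_scaleR[OF assms(2), of "-1"]]
  by (simp_all add: B_scaleR[OF assms(2), of "-1", simplified])

lemma D_sum: "(\<And>i. i \<in> I \<Longrightarrow> f i \<in> D) \<Longrightarrow> (\<Sum>i\<in>I. f i) \<in> D"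
  and B_sum: "(\<And>i. i \<in> I \<Longrightarrow> f i \<in> D) \<Longrightarrow> B (\<Sum>i\<in>I. f i) = (\<Sum>i\<in>I. B (f i))"
proof -
  have "(\<Sum>i\<in>I. f i) \<in> D \<and> B (\<Sum>i\<in>I. f i) = (\<Sum>i\<in>I. B (f i))" if "\<And>i. i \<in> I \<Longrightarrow> f i \<in> D"
    using that by (induction I rule: infinite_finite_induct) (auto simp: D_0 B_0 D_add B_add)
  then show "(\<And>i. i \<in> I \<Longrightarrow> f i \<in> D) \<Longrightarrow> (\<Sum>i\<in>I. f i) \<in> D"
    "(\<And>i. i \<in> I \<Longrightarrow> f i \<in> D) \<Longrightarrow> B (\<Sum>i\<in>I. f i) = (\<Sum>i\<in>I. B (f i))" by blast+
qed

text \<open>Each orbit is compact over \<open>{0..N}\<close>, hence bounded there; the uniform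
  boundedness principle makes the bound uniform in \<open>x\<close>.\<close>

lemma T_bounded: obtains M where "M \<ge> 0" "\<And>t x. 0 \<le> t \<Longrightarrow> t \<le> N \<Longrightarrow> norm (T t x) \<le> M * norm x"
proof -
  have "\<exists>M\<ge>0. \<forall>t\<in>{0..N}. \<forall>x. norm (T t x) \<le> M * norm x"
  proof (rule uniform_boundedness)
    fix x
    have "compact ((\<lambda>t. T t x) ` {0..N})"
      by (intro compact_continuous_image continuous_on_subset[OF continuous_orbit]) auto
    then show "\<exists>K. \<forall>t\<in>{0..N}. norm (T t x) \<le> K"
      using compact_imp_bounded by (fastforce simp: bounded_iff)
  qed (simp add: bounded_linear_T)
  then show thesis using that by auto
qed

text \<open>Split off \<open>v0\<close>: the bound for times up to \<open>u0 + 1\<close> controls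
  \<open>T (u s) (v s - v0)\<close>, and what remains is continuity of a single orbit.\<close>

lemma tendsto_T:
  assumes u: "(u \<longlongrightarrow> u0) F" and u_nn: "eventually (\<lambda>s. u s \<ge> 0) F" "u0 \<ge> 0" and v: "(v \<longlongrightarrow> v0) F"
  shows "((\<lambda>s. T (u s) (v s)) \<longlongrightarrow> T u0 v0) F"
proof -
  obtain M where M: "M \<ge> 0" "\<And>t x. 0 \<le> t \<Longrightarrow> t \<le> u0 + 1 \<Longrightarrow> norm (T t x) \<le> M * norm x"
    using T_bounded by blast
  have u_le: "eventually (\<lambda>s. u s \<le> u0 + 1) F"
    using order_tendstoD(2)[OF u, of "u0 + 1"] by (auto elim: eventually_mono)
  have "((\<lambda>s. T (u s) (v s - v0)) \<longlongrightarrow> 0) F"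
  proof (rule Lim_null_comparison)
    show "\<forall>\<^sub>F s in F. norm (T (u s) (v s - v0)) \<le> M * norm (v s - v0)"
      using u_nn(1) u_le by eventually_elim (auto intro: M)
    have "((\<lambda>s. M * norm (v s - v0)) \<longlongrightarrow> M * norm (v0 - v0)) F" by (intro tendsto_intros v)
    then show "((\<lambda>s. M * norm (v s - v0)) \<longlongrightarrow> 0) F" by simp
  qed
  moreover have "((\<lambda>s. T (u s) v0) \<longlongrightarrow> T u0 v0) F"
    using continuous_on_tendsto_compose[OF continuous_orbit u] u_nn by simp
  ultimately have "((\<lambda>s. T (u s) (v s - v0) + T (u s) v0) \<longlongrightarrow> 0 + T u0 v0) F" by (rule tendsto_add)
  moreover have "\<forall>\<^sub>F s in F. T (u s) (v s - v0) + T (u s) v0 = T (u s) (v s)"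
    using u_nn(1) by eventually_elim (simp add: T_diff)
  ultimately show ?thesis by (auto intro: Lim_transform_eventually)
qed

lemma continuous_on_T:
  assumes u: "continuous_on S u" and v: "continuous_on S v" and nn: "\<And>s. s \<in> S \<Longrightarrow> u s \<ge> 0"
  shows "continuous_on S (\<lambda>s. T (u s) (v s))"
  unfolding continuous_on_def
proof
  fix s assume s: "s \<in> S"
  have "eventually (\<lambda>s. u s \<ge> 0) (at s within S)" using nn by (auto simp: eventually_at_filter)
  then show "((\<lambda>s. T (u s) (v s)) \<longlongrightarrow> T (u s) (v s)) (at s within S)"
    using u v s nn by (intro tendsto_T) (auto simp: continuous_on_def)
qed

text \<open>The once integrated semigroup. Its operators are bounded and map into \<open>D\<close>
  for nonnegative times, so identities involving \<open>B\<close> can be restated through them and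
  survive limits.\<close>

definition orbit_integral :: "real \<Rightarrow> 'a \<Rightarrow> 'a"
  where "orbit_integral t x = integral {0..t} (\<lambda>s. T s x)"

lemma orbit_integrable: "0 \<le> a \<Longrightarrow> (\<lambda>s. T s x) integrable_on {a..b}"
  by (rule integrable_continuous_real[OF continuous_on_subset[OF continuous_orbit]]) auto

lemma bounded_linear_orbit_integral: "bounded_linear (orbit_integral t)"
proof -
  obtain M where M: "M \<ge> 0" "\<And>s x. 0 \<le> s \<Longrightarrow> s \<le> t \<Longrightarrow> norm (T s x) \<le> M * norm x"
    using T_bounded by blast
  show ?thesis
  proof (rule bounded_linear_intro)
    fix x y c
    have "orbit_integral t (x + y) = integral {0..t} (\<lambda>s. T s x + T s y)"
      unfolding orbit_integral_def by (intro integral_cong) (auto simp: T_plus)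
    then show "orbit_integral t (x + y) = orbit_integral t x + orbit_integral t y"
      by (simp add: orbit_integral_def integral_add orbit_integrable)
    have "orbit_integral t (c *\<^sub>R x) = integral {0..t} (\<lambda>s. c *\<^sub>R T s x)"
      unfolding orbit_integral_def by (intro integral_cong) (auto simp: T_scaleR)
    then show "orbit_integral t (c *\<^sub>R x) = c *\<^sub>R orbit_integral t x"
      by (simp add: orbit_integral_def)
    have "norm (orbit_integral t x) \<le> integral {0..t} (\<lambda>_. M * norm x)"
      unfolding orbit_integral_def
      by (rule integral_norm_bound_integral) (auto intro: M orbit_integrable integrable_const_ivl)
    then show "norm (orbit_integral t x) \<le> norm x * (measure lborel {0..t} * M)" by (simp add: mult.commute mult.left_commute)
  qed
qed

lemma continuous_orbit_integral: "continuous_on {0..} (\<lambda>t. orbit_integral t x)"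
  unfolding continuous_on_eq_continuous_within
proof
  fix t :: real assume "t \<in> {0..}"
  then have t: "t \<ge> 0" by simp
  have "((\<lambda>u. integral {0..u} (\<lambda>s. T s x)) has_vector_derivative T t x) (at t within {0..t + 1})"
    using t by (intro integral_has_vector_derivative continuous_on_subset[OF continuous_orbit]) auto
  then have "continuous (at t within {0..t + 1}) (\<lambda>t. orbit_integral t x)"
    unfolding orbit_integral_def by (rule has_vector_derivative_continuous)
  moreover have "at t within {0..t + 1} = at t within {0..}"
    by (rule at_within_nhd[of _ "{..<t + 1}"]) auto
  ultimately show "continuous (at t within {0..}) (\<lambda>t. orbit_integral t x)" by simp
qed

text \<open>Applying \<open>T h\<close> shifts the interval of integration to
  \<open>{h..t + h}\<close>. After subtraction one short integral remains at each end, and their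
  quotients tend to \<open>T t x\<close> and \<open>x\<close>.\<close>

lemma assumes t: "t \<ge> 0"
  shows orbit_integral_in_D: "orbit_integral t x \<in> D"
    and B_orbit_integral: "B (orbit_integral t x) = T t x - x"
proof -
  have eq: "T h (orbit_integral t x) - orbit_integral t x
      = (orbit_integral (t + h) x - orbit_integral t x) - (orbit_integral (0 + h) x - orbit_integral 0 x)" if h: "h > 0" for h
  proof -
    have "(\<lambda>s. T s x) integrable_on {0..t}" by (rule orbit_integrable) simp
    from integral_linear[OF this bounded_linear_T[of h]]
    have "T h (orbit_integral t x) = integral {0..t} (\<lambda>s. T h (T s x))" using h
      by (simp add: orbit_integral_def comp_def)
    also have "\<dots> = integral {0..t} (\<lambda>s. T (s + h) x)"
      using h T_add[of h] by (intro integral_cong) (auto simp: add.commute)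
    also have "\<dots> = integral {h..t + h} (\<lambda>s. T s x)"
      using integral_shift_real_ivl[of h h "t + h" "\<lambda>s. T s x"] by simp
    finally have 1: "T h (orbit_integral t x) = integral {h..t + h} (\<lambda>s. T s x)" .
    have "orbit_integral h x + integral {h..t + h} (\<lambda>s. T s x) = orbit_integral (t + h) x"
      unfolding orbit_integral_def
      by (rule Henstock_Kurzweil_Integration.integral_combine) (use h t orbit_integrable in auto)
    with 1 show ?thesis by (simp add: orbit_integral_def algebra_simps)
  qed
  have "((\<lambda>h. (1 / h) *\<^sub>R (orbit_integral (t + h) x - orbit_integral t x)
        - (1 / h) *\<^sub>R (orbit_integral (0 + h) x - orbit_integral 0 x)) \<longlongrightarrow> T t x - T 0 x) (at_right 0)"
    unfolding orbit_integral_def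
    using t by (intro tendsto_diff integral_right_difference_quotient continuous_orbit) auto
  moreover have "\<forall>\<^sub>F h in at_right 0. (1 / h) *\<^sub>R (orbit_integral (t + h) x - orbit_integral t x)
        - (1 / h) *\<^sub>R (orbit_integral (0 + h) x - orbit_integral 0 x)
      = (1 / h) *\<^sub>R (T h (orbit_integral t x) - orbit_integral t x)"
    using eventually_at_right_less[of 0] by eventually_elim (simp only: eq scaleR_diff_right)
  ultimately have "((\<lambda>h. (1 / h) *\<^sub>R (T h (orbit_integral t x) - orbit_integral t x)) \<longlongrightarrow> T t x - x) (at_right 0)"
    by (auto intro: Lim_transform_eventually simp: T_0)
  then show "orbit_integral t x \<in> D" "B (orbit_integral t x) = T t x - x" by (rule generatorI)+
qed

lemma orbit_integral_T_commute:
  assumes "h \<ge> 0" "t \<ge> 0"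
  shows "orbit_integral t (T h x) = T h (orbit_integral t x)"
proof -
  have "(\<lambda>s. T s x) integrable_on {0..t}" by (rule orbit_integrable) simp
  from integral_linear[OF this bounded_linear_T[of h]]
  have "T h (orbit_integral t x) = integral {0..t} (\<lambda>s. T h (T s x))" using assms
    by (simp add: orbit_integral_def comp_def)
  also have "\<dots> = integral {0..t} (\<lambda>s. T s (T h x))"
    using assms by (intro integral_cong) (auto simp flip: T_add simp: add.commute)
  finally show ?thesis by (simp add: orbit_integral_def)
qed

text \<open>The bounded operator \<open>orbit_integral t\<close> commutes with \<open>T h\<close>
  and so passes through the limit that defines \<open>B x\<close>. The result is the limit defining
  \<open>B (orbit_integral t x)\<close>, which is already known.\<close>

lemma orbit_integral_B:
  assumes x: "x \<in> D" and t: "t \<ge> 0"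
  shows "orbit_integral t (B x) = T t x - x"
proof -
  interpret V: bounded_linear "orbit_integral t" by (rule bounded_linear_orbit_integral)
  have "((\<lambda>h. orbit_integral t ((1 / h) *\<^sub>R (T h x - x))) \<longlongrightarrow> orbit_integral t (B x)) (at_right 0)"
    by (rule V.tendsto[OF B_lim[OF x]])
  moreover have "\<forall>\<^sub>F h in at_right 0. orbit_integral t ((1 / h) *\<^sub>R (T h x - x))
      = (1 / h) *\<^sub>R (T h (orbit_integral t x) - orbit_integral t x)"
    using t by (auto simp: eventually_at_filter V.scaleR V.diff orbit_integral_T_commute)
  ultimately have "((\<lambda>h. (1 / h) *\<^sub>R (T h (orbit_integral t x) - orbit_integral t x)) \<longlongrightarrow> orbit_integral t (B x)) (at_right 0)"
    by (rule Lim_transform_eventually)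
  then show ?thesis using generatorI(2) B_orbit_integral[OF t] by metis
qed

text \<open>The identity \<open>T t x - x = orbit_integral t (B x)\<close> contains only bounded
  operators once \<open>B x\<close> is read as a vector, so it persists in the limit. Dividing by
  small times recovers \<open>y\<close>.\<close>

lemma generator_closed:
  assumes xD: "\<And>n::nat. x n \<in> D" and x: "x \<longlonglongrightarrow> x0" and Bx: "(\<lambda>n. B (x n)) \<longlonglongrightarrow> y"
  shows "x0 \<in> D" "B x0 = y"
proof -
  have eq: "T t x0 - x0 = orbit_integral t y" if t: "t \<ge> 0" for t
  proof -
    have "(\<lambda>n. orbit_integral t (B (x n))) \<longlonglongrightarrow> orbit_integral t y"
      by (rule bounded_linear.tendsto[OF bounded_linear_orbit_integral Bx])
    moreover have "(\<lambda>n. T t (x n) - x n) \<longlonglongrightarrow> T t x0 - x0"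
      by (intro tendsto_diff bounded_linear.tendsto[OF bounded_linear_T[OF t]] x)
    ultimately show ?thesis using orbit_integral_B[OF xD t] LIMSEQ_unique by fastforce
  qed
  have "((\<lambda>h. (1 / h) *\<^sub>R (orbit_integral (0 + h) y - orbit_integral 0 y)) \<longlongrightarrow> T 0 y) (at_right 0)"
    unfolding orbit_integral_def by (intro integral_right_difference_quotient continuous_orbit) auto
  moreover have "\<forall>\<^sub>F h in at_right 0. (1 / h) *\<^sub>R (orbit_integral (0 + h) y - orbit_integral 0 y)
      = (1 / h) *\<^sub>R (T h x0 - x0)"
    by (auto simp: eventually_at_filter eq orbit_integral_def)
  ultimately have "((\<lambda>h. (1 / h) *\<^sub>R (T h x0 - x0)) \<longlongrightarrow> y) (at_right 0)"
    by (auto intro: Lim_transform_eventually simp: T_0)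
  then show "x0 \<in> D" "B x0 = y" by (rule generatorI)+
qed

text \<open>Riemann sums of \<open>F\<close> lie in \<open>D\<close>, and \<open>B\<close> maps them
  to Riemann sums of \<open>B (F s)\<close>. A tagged division fine for both gauges brings both sums
  close to their integrals at once, and closedness of \<open>B\<close> concludes.\<close>

lemma
  assumes F: "(F has_integral x) {a..b::real}" and FD: "\<And>s. s \<in> {a..b} \<Longrightarrow> F s \<in> D"
    and BF: "((\<lambda>s. B (F s)) has_integral y) {a..b}"
  shows has_integral_in_D: "x \<in> D" and B_has_integral: "B x = y"
proof -
  have "\<exists>z. z \<in> D \<and> norm (z - x) < inverse (Suc n) \<and> norm (B z - y) < inverse (Suc n)" for n
  proof -
    have e: "inverse (real (Suc n)) > 0" by simp
    from has_integralD[of F x a b, OF _ e] F obtain \<gamma>1 where g1: "gauge \<gamma>1"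
      and s1: "\<And>\<D>. \<D> tagged_division_of (cbox a b) \<Longrightarrow> \<gamma>1 fine \<D> \<Longrightarrow>
        norm ((\<Sum>(x, K)\<in>\<D>. measure lborel K *\<^sub>R F x) - x) < inverse (Suc n)" by (metis box_real(2))
    from has_integralD[of "\<lambda>s. B (F s)" y a b, OF _ e] BF obtain \<gamma>2 where g2: "gauge \<gamma>2"
      and s2: "\<And>\<D>. \<D> tagged_division_of (cbox a b) \<Longrightarrow> \<gamma>2 fine \<D> \<Longrightarrow>
        norm ((\<Sum>(x, K)\<in>\<D>. measure lborel K *\<^sub>R B (F x)) - y) < inverse (Suc n)" by (metis box_real(2))
    obtain \<D> where D: "\<D> tagged_division_of (cbox a b)" and fine: "(\<lambda>x. \<gamma>1 x \<inter> \<gamma>2 x) fine \<D>"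
      using fine_division_exists[OF gauge_Int[OF g1 g2]] by blast
    define z where "z = (\<Sum>(x, K)\<in>\<D>. measure lborel K *\<^sub>R F x)"
    have tags: "x \<in> {a..b}" if "(x, K) \<in> \<D>" for x K
      using tag_in_interval[OF D that] by simp
    have "z \<in> D" unfolding z_def by (intro D_sum) (auto intro!: D_scaleR FD dest: tags)
    moreover have "B z = (\<Sum>(x, K)\<in>\<D>. measure lborel K *\<^sub>R B (F x))"
    proof -
      have "B z = (\<Sum>p\<in>\<D>. B (case p of (x, K) \<Rightarrow> measure lborel K *\<^sub>R F x))"
        unfolding z_def by (intro B_sum) (auto intro!: D_scaleR FD dest: tags)
      also have "\<dots> = (\<Sum>(x, K)\<in>\<D>. measure lborel K *\<^sub>R B (F x))"
        by (intro sum.cong) (auto intro!: B_scaleR FD dest: tags)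
      finally show ?thesis .
    qed
    ultimately show ?thesis using s1[OF D] s2[OF D] fine unfolding z_def by (auto simp: fine_Int)
  qed
  then obtain z where z: "\<And>n. z n \<in> D" "\<And>n. norm (z n - x) < inverse (Suc n)"
    "\<And>n. norm (B (z n) - y) < inverse (Suc n)" by metis
  have "z \<longlonglongrightarrow> x"
    by (rule LIM_zero_cancel, rule Lim_null_comparison[OF _ LIMSEQ_inverse_real_of_nat])
      (simp add: less_imp_le z del: of_nat_Suc)
  moreover have "(\<lambda>n. B (z n)) \<longlonglongrightarrow> y"
    by (rule LIM_zero_cancel, rule Lim_null_comparison[OF _ LIMSEQ_inverse_real_of_nat])
      (simp add: less_imp_le z del: of_nat_Suc)
  ultimately show "x \<in> D" "B x = y" using generator_closed z(1) by blast+
qed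

section \<open>Uniqueness of mild solutions\<close>

lemma homogeneous_mild_zero:
  fixes v :: "real \<Rightarrow> 'a"
  assumes v: "continuous_on {0..} v" and uD: "\<And>t. t \<ge> 0 \<Longrightarrow> integral {0..t} v \<in> D"
    and Bu: "\<And>t. t \<ge> 0 \<Longrightarrow> B (integral {0..t} v) = v t" and t: "t \<ge> 0"
  shows "v t = 0"
proof -
  define u where "u t = integral {0..t} v" for t :: real
  define w where "w s = T (t - s) (u s)" for s :: real
  have "(w has_derivative (\<lambda>h. 0)) (at s within {0..t})" if s: "s \<in> {0..t}" for s
  proof -
    have usD: "u s \<in> D" and Bus: "B (u s) = v s" using s uD Bu by (auto simp: u_def)
    have "(u has_vector_derivative v s) (at s within {0..t})"
      unfolding u_def using s by (intro integral_has_vector_derivative continuous_on_subset[OF v]) auto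
    \<comment> \<open>The difference quotient of \<open>w\<close> is a sum of two. In the first,
      \<open>T (t - y)\<close> acts on the quotient of \<open>u\<close>. In the second the vector
      \<open>u s\<close> is fixed, and \<open>orbit_integral_B\<close> replaces the increments of
      its orbit by those of the integrated orbit of \<open>v s\<close>. The limits are
      \<open>T (t - s) (v s)\<close> and its negative.\<close>
    then have 1: "((\<lambda>y. T (t - y) ((1 / (y - s)) *\<^sub>R (u y - u s))) \<longlongrightarrow> T (t - s) (v s)) (at s within {0..t})"
      unfolding has_vector_derivative_within_iff_Lim
      using s by (intro tendsto_T tendsto_intros) (auto simp: eventually_at_filter)
    have "((\<lambda>r. integral {0..r} (\<lambda>q. T q (v s))) has_vector_derivative T (t - s) (v s)) (at (t - s) within {0..t})"
      using s by (intro integral_has_vector_derivative continuous_on_subset[OF continuous_orbit]) auto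
    moreover have "(-) t ` {0..t} = {0..t}" by simp
    moreover have "((\<lambda>y. t - y) has_vector_derivative -1) (at s within {0..t})"
      by (auto intro!: derivative_eq_intros)
    ultimately have "((\<lambda>r. integral {0..r} (\<lambda>q. T q (v s))) \<circ> (\<lambda>y. t - y) has_vector_derivative
        -1 *\<^sub>R T (t - s) (v s)) (at s within {0..t})"
      by (intro vector_diff_chain_within) auto
    then have "((\<lambda>y. (1 / (y - s)) *\<^sub>R (orbit_integral (t - y) (v s) - orbit_integral (t - s) (v s)))
        \<longlongrightarrow> - T (t - s) (v s)) (at s within {0..t})"
      by (simp add: has_vector_derivative_within_iff_Lim orbit_integral_def)
    from tendsto_add[OF 1 this]
    have "((\<lambda>y. T (t - y) ((1 / (y - s)) *\<^sub>R (u y - u s))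
        + (1 / (y - s)) *\<^sub>R (orbit_integral (t - y) (v s) - orbit_integral (t - s) (v s))) \<longlongrightarrow> 0) (at s within {0..t})"
      by simp
    moreover have "\<forall>\<^sub>F y in at s within {0..t}. T (t - y) ((1 / (y - s)) *\<^sub>R (u y - u s))
        + (1 / (y - s)) *\<^sub>R (orbit_integral (t - y) (v s) - orbit_integral (t - s) (v s))
        = (1 / (y - s)) *\<^sub>R (w y - w s)"
      using s by (auto simp: eventually_at_filter w_def T_scaleR T_diff orbit_integral_B[OF usD, unfolded Bus]
          simp flip: scaleR_add_right)
    ultimately have "(w has_vector_derivative 0) (at s within {0..t})"
      unfolding has_vector_derivative_within_iff_Lim by (rule Lim_transform_eventually)
    then show ?thesis by (simp add: has_vector_derivative_def)
  qed
  then obtain c where c: "\<And>s. s \<in> {0..t} \<Longrightarrow> w s = c"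
    using has_derivative_zero_constant[of "{0..t}" w] by (metis convex_real_interval(5))
  have "w 0 = 0" using t by (simp add: w_def u_def T_zero)
  moreover have "w t = u t" by (simp add: w_def T_0)
  ultimately have "u t = 0" using c t by (metis atLeastAtMost_iff order_refl)
  then show ?thesis using Bu[OF t] B_0 by (simp add: u_def)
qed

lemma mild_solution_unique:
  assumes U: "mild_solution D B F x U" and V: "mild_solution D B F x V" and t: "t \<ge> 0"
  shows "U t = V t"
proof -
  have cont: "continuous_on {0..} U" "continuous_on {0..} V"
    using U V by (auto simp: mild_solution_def)
  have int: "integral {0..t} (\<lambda>s. U s - V s) = integral {0..t} U - integral {0..t} V" for t
    by (intro integral_diff integrable_continuous_real continuous_on_subset[OF cont(1)] continuous_on_subset[OF cont(2)]) auto
  have "U t - V t = 0"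
  proof (rule homogeneous_mild_zero[OF _ _ _ t, of "\<lambda>t. U t - V t"])
    show "continuous_on {0..} (\<lambda>t. U t - V t)" by (intro continuous_intros cont)
    fix t :: real assume t: "t \<ge> 0"
    have D: "integral {0..t} U \<in> D" "integral {0..t} V \<in> D"
      and eq: "U t = x + B (integral {0..t} U) + banach_integral (lebesgue_on {0..t}) F"
        "V t = x + B (integral {0..t} V) + banach_integral (lebesgue_on {0..t}) F"
      using U V t by (auto simp: mild_solution_def)
    show "integral {0..t} (\<lambda>t. U t - V t) \<in> D" using D by (simp add: int D_diff)
    show "B (integral {0..t} (\<lambda>t. U t - V t)) = U t - V t"
      using D unfolding int eq by (simp add: B_diff)
  qed
  then show ?thesis by simp
qed

end

lemma generates_semigroup_imp_semigroup_generator: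
  assumes "generates_semigroup sX D B T"
  shows "semigroup_generator D B T"
proof -
  have T: "C0_semigroup sX T" and D: "D = {x. \<exists>y. ((\<lambda>h. (1 / h) *\<^sub>R (T h x - x)) \<longlongrightarrow> y) (at_right 0)}"
    and B: "\<forall>x\<in>D. ((\<lambda>h. (1 / h) *\<^sub>R (T h x - x)) \<longlongrightarrow> B x) (at_right 0)"
    using assms unfolding generates_semigroup_def by blast+
  show ?thesis
  proof (rule semigroup_generator.intro)
    show "D = {x. \<exists>y. ((\<lambda>h. (1 / h) *\<^sub>R (T h x - x)) \<longlongrightarrow> y) (at_right 0)}" by (rule D)
    show "((\<lambda>h. (1 / h) *\<^sub>R (T h x - x)) \<longlongrightarrow> B x) (at_right 0)" if "x \<in> D" for x
      using B that by blast
    show "bounded_linear (T t)" if "0 \<le> t" for t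
      using T that by (simp add: C0_semigroup_def bounded_operator_def)
  qed (use T in \<open>auto simp: C0_semigroup_def bounded_operator_def\<close>)
qed

section \<open>The variation of constants formula\<close>

lemma integral_restrict_subset:
  fixes f :: "'a::euclidean_space \<Rightarrow> 'b::banach"
  shows "S \<subseteq> T \<Longrightarrow> integral T (\<lambda>x. if x \<in> S then f x else 0) = integral S f"
  by (simp add: integral_def integrable_on_def)

context semigroup_generator
begin

text \<open>A gauge integral, so that shifts and reflections of the time variable are at hand; for
  Bochner integrable \<open>F\<close> it is the integral in the variation of constants
  formula.\<close>

definition conv :: "(real \<Rightarrow> 'a) \<Rightarrow> real \<Rightarrow> 'a"
  where "conv F t = integral {0..t} (\<lambda>s. T (t - s) (F s))"

lemma conv_integrable:
  assumes F: "banach_integrable (lebesgue_on {0..t}) F"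
  shows "banach_integrable (lebesgue_on {0..t}) (\<lambda>s. T (t - s) (F s))"
proof -
  obtain M where M: "M \<ge> 0" "\<And>s x. 0 \<le> s \<Longrightarrow> s \<le> t \<Longrightarrow> norm (T s x) \<le> M * norm x"
    using T_bounded by blast
  show ?thesis
  proof (rule banach_integrable_operator_family[OF _ F, where C=M and H="\<lambda>s. T (t - s)"])
    show "banach_integrable (lebesgue_on {0..t}) (\<lambda>s. T (t - s) y)" for y
      by (intro banach_integrable_continuous continuous_on_T continuous_intros) auto
  qed (auto simp: T_linear intro: M)
qed

text \<open>The mild equation with initial value 0, solved for \<open>B\<close>. On a bounded
  interval constants are integrable, as passing to complements requires, and one bound serves for
  all \<open>T t\<close>.\<close>

definition duhamel_on :: "real \<Rightarrow> (real \<Rightarrow> 'a) \<Rightarrow> bool"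
  where "duhamel_on N F \<longleftrightarrow> banach_integrable (lebesgue_on {0..N}) F \<and> continuous_on {0..N} (conv F) \<and>
    (\<forall>t\<in>{0..N}. integral {0..t} (conv F) \<in> D \<and> B (integral {0..t} (conv F)) = conv F t - integral {0..t} F)"

lemma duhamel_on_integrable: "duhamel_on N F \<Longrightarrow> t \<le> N \<Longrightarrow> banach_integrable (lebesgue_on {0..t}) F"
  by (auto simp: duhamel_on_def intro: banach_integrable_subset[of "{0..N}"])

lemma duhamel_on_cong:
  assumes F: "duhamel_on N F" and eq: "\<And>s. s \<in> {0..N} \<Longrightarrow> F s = G s"
  shows "duhamel_on N G"
proof -
  have conv: "conv G t = conv F t" if "t \<in> {0..N}" for t
    unfolding conv_def using that eq by (intro integral_cong) auto
  have int: "integral {0..t} (conv G) = integral {0..t} (conv F)" "integral {0..t} G = integral {0..t} F"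
    if "t \<in> {0..N}" for t
    using that conv eq by (auto intro!: integral_cong)
  have "banach_integrable (lebesgue_on {0..N}) G"
    using F eq by (intro banach_integrable_cong[where f=F and g=G]) (auto simp: duhamel_on_def)
  moreover have "continuous_on {0..N} (conv G)"
    using F conv by (auto simp: duhamel_on_def intro: continuous_on_eq)
  ultimately show ?thesis using F by (simp add: duhamel_on_def int conv)
qed

lemma duhamel_on_add:
  assumes F: "duhamel_on N F" and G: "duhamel_on N G"
  shows "duhamel_on N (\<lambda>s. F s + G s)"
proof -
  have conv: "conv (\<lambda>s. F s + G s) t = conv F t + conv G t" if t: "t \<in> {0..N}" for t
  proof -
    have "(\<lambda>s. T (t - s) (F s)) integrable_on {0..t}" "(\<lambda>s. T (t - s) (G s)) integrable_on {0..t}"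
      using t by (auto intro!: banach_integrable_integrable_on conv_integrable duhamel_on_integrable F G)
    moreover have "conv (\<lambda>s. F s + G s) t = integral {0..t} (\<lambda>s. T (t - s) (F s) + T (t - s) (G s))"
      unfolding conv_def by (intro integral_cong) (auto simp: T_plus)
    ultimately show ?thesis by (simp add: conv_def integral_add)
  qed
  have cont: "continuous_on {0..N} (conv F)" "continuous_on {0..N} (conv G)"
    using F G by (auto simp: duhamel_on_def)
  have "integral {0..t} (conv (\<lambda>s. F s + G s)) = integral {0..t} (conv F) + integral {0..t} (conv G)"
    "integral {0..t} (\<lambda>s. F s + G s) = integral {0..t} F + integral {0..t} G" if t: "t \<in> {0..N}" for t
  proof -
    have "conv F integrable_on {0..t}" "conv G integrable_on {0..t}"
      using t by (auto intro!: integrable_continuous_real continuous_on_subset[OF cont(1)] continuous_on_subset[OF cont(2)])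
    moreover have "integral {0..t} (conv (\<lambda>s. F s + G s)) = integral {0..t} (\<lambda>s. conv F s + conv G s)"
      using t conv by (intro integral_cong) auto
    ultimately show "integral {0..t} (conv (\<lambda>s. F s + G s)) = integral {0..t} (conv F) + integral {0..t} (conv G)"
      by (simp add: integral_add)
    have "F integrable_on {0..t}" "G integrable_on {0..t}"
      using t by (auto intro!: banach_integrable_integrable_on duhamel_on_integrable F G)
    then show "integral {0..t} (\<lambda>s. F s + G s) = integral {0..t} F + integral {0..t} G" by (rule integral_add)
  qed
  moreover have "continuous_on {0..N} (conv (\<lambda>s. F s + G s))"
    using continuous_on_add[OF cont] by (rule continuous_on_eq) (simp add: conv)
  moreover have "banach_integrable (lebesgue_on {0..N}) (\<lambda>s. F s + G s)"
    using F G by (intro banach_integrable_add) (auto simp: duhamel_on_def)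
  ultimately show ?thesis using F G by (simp add: duhamel_on_def conv D_add B_add)
qed

text \<open>With \<open>M\<close> bounding the semigroup on \<open>{0..N}\<close>, the convolutions
  differ uniformly by at most \<open>M\<close> times the L1 error. Hence continuity passes to the
  limit, the integrals of \<open>conv (G n)\<close> and of \<open>G n\<close> converge, and
  \<open>generator_closed\<close> yields the equation.\<close>

lemma duhamel_on_L1_limit:
  assumes F: "banach_integrable (lebesgue_on {0..N}) F"
    and approx: "\<And>e. 0 < e \<Longrightarrow> \<exists>G k. duhamel_on N G \<and> k integrable_on {0..N} \<and> integral {0..N} k < e \<and>
      (\<forall>s\<in>{0..N}. norm (F s - G s) \<le> k s)"
  shows "duhamel_on N F"
proof -
  have "\<forall>n. \<exists>G k. duhamel_on N G \<and> k integrable_on {0..N} \<and> integral {0..N} k < inverse (Suc n) \<and>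
      (\<forall>s\<in>{0..N}. norm (F s - G s) \<le> k s)"
    using approx by simp
  then obtain G k where G: "\<And>n. duhamel_on N (G n)" and k: "\<And>n. k n integrable_on {0..N}"
    and k_lt: "\<And>n::nat. integral {0..N} (k n) < inverse (Suc n)"
    and le: "\<And>n s. s \<in> {0..N} \<Longrightarrow> norm (F s - G n s) \<le> k n s" by metis
  define c where "c n = integral {0..N} (k n)" for n
  have k_nn: "0 \<le> k n s" if "s \<in> {0..N}" for n s
    using le[OF that] norm_ge_zero order_trans by blast
  have k_sub: "k n integrable_on {0..t}" if "t \<in> {0..N}" for n t
    using k by (rule integrable_on_subinterval) (use that in auto)
  have kt: "integral {0..t} (k n) \<le> c n" if "t \<in> {0..N}" for n t
    unfolding c_def using that k_sub[OF that] k k_nn by (intro integral_subset_le) auto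
  have c_nn: "0 \<le> c n" for n unfolding c_def by (rule integral_nonneg[OF k k_nn])
  have c: "c \<longlonglongrightarrow> 0"
    using c_nn k_lt by (intro tendsto_sandwich[OF _ _ tendsto_const LIMSEQ_inverse_real_of_nat])
      (auto intro!: always_eventually less_imp_le simp: c_def)
  have Ft: "banach_integrable (lebesgue_on {0..t}) F" if "t \<in> {0..N}" for t
    using F that by (auto intro: banach_integrable_subset[of "{0..N}"])
  have Gt: "banach_integrable (lebesgue_on {0..t}) (G n)" if "t \<in> {0..N}" for n t
    using duhamel_on_integrable[OF G] that by auto
  obtain M where M: "M \<ge> 0" "\<And>s x. 0 \<le> s \<Longrightarrow> s \<le> N \<Longrightarrow> norm (T s x) \<le> M * norm x"
    using T_bounded by blast
  have dist_conv: "norm (conv F t - conv (G n) t) \<le> M * c n" if t: "t \<in> {0..N}" for n t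
  proof -
    have int: "(\<lambda>s. T (t - s) (F s)) integrable_on {0..t}" "(\<lambda>s. T (t - s) (G n s)) integrable_on {0..t}"
      by (auto intro!: banach_integrable_integrable_on conv_integrable Ft Gt t)
    have "norm (conv F t - conv (G n) t) = norm (integral {0..t} (\<lambda>s. T (t - s) (F s) - T (t - s) (G n s)))"
      by (simp add: conv_def integral_diff int)
    also have "\<dots> \<le> integral {0..t} (\<lambda>s. M * k n s)"
    proof (rule integral_norm_bound_integral)
      fix s assume s: "s \<in> {0..t}"
      have "norm (T (t - s) (F s) - T (t - s) (G n s)) = norm (T (t - s) (F s - G n s))"
        using s by (simp add: T_diff)
      also have "\<dots> \<le> M * norm (F s - G n s)" using s t by (intro M) auto
      also have "\<dots> \<le> M * k n s" using s t by (intro mult_left_mono le M) auto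
      finally show "norm (T (t - s) (F s) - T (t - s) (G n s)) \<le> M * k n s" .
    next
      show "(\<lambda>s. M * k n s) integrable_on {0..t}"
        using integrable_on_cmult_left[OF k_sub[OF t], of M] by simp
    qed (intro integrable_diff int)
    also have "\<dots> \<le> M * c n" using kt[OF t] M(1) by (simp add: mult_left_mono)
    finally show ?thesis .
  qed
  have Mc: "(\<lambda>n. M * c n) \<longlonglongrightarrow> 0" using tendsto_mult[OF tendsto_const[of M] c] by simp
  have ul: "uniform_limit {0..N} (\<lambda>n. conv (G n)) (conv F) sequentially"
  proof (rule uniform_limitI)
    fix e :: real assume "e > 0"
    then have "eventually (\<lambda>n. M * c n < e) sequentially" using order_tendstoD(2)[OF Mc] by blast
    then show "\<forall>\<^sub>F n in sequentially. \<forall>t\<in>{0..N}. dist (conv (G n) t) (conv F t) < e"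
    proof eventually_elim
      case (elim n)
      show ?case
      proof
        fix t assume "t \<in> {0..N}"
        from dist_conv[OF this, of n] elim show "dist (conv (G n) t) (conv F t) < e"
          by (simp add: dist_norm norm_minus_commute)
      qed
    qed
  qed
  have contG: "continuous_on {0..N} (conv (G n))" for n using G by (auto simp: duhamel_on_def)
  then have contF: "continuous_on {0..N} (conv F)"
    by (intro uniform_limit_theorem[OF _ ul]) auto
  have "integral {0..t} (conv F) \<in> D \<and> B (integral {0..t} (conv F)) = conv F t - integral {0..t} F"
    if t: "t \<in> {0..N}" for t
  proof -
    have convF: "conv F integrable_on {0..t}"
      using t by (auto intro!: integrable_continuous_real continuous_on_subset[OF contF])
    have convG: "conv (G n) integrable_on {0..t}" for n
      using t by (auto intro!: integrable_continuous_real continuous_on_subset[OF contG])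
    have FI: "F integrable_on {0..t}" and GI: "G n integrable_on {0..t}" for n
      using Ft[OF t] Gt[OF t] by (auto intro: banach_integrable_integrable_on)
    have l1: "(\<lambda>n. integral {0..t} (conv (G n))) \<longlonglongrightarrow> integral {0..t} (conv F)"
    proof (rule LIM_zero_cancel, rule Lim_null_comparison)
      have "norm (integral {0..t} (conv (G n)) - integral {0..t} (conv F)) \<le> t * (M * c n)" for n
      proof -
        have "norm (integral {0..t} (conv (G n)) - integral {0..t} (conv F))
            = norm (integral {0..t} (\<lambda>s. conv (G n) s - conv F s))"
          by (simp add: integral_diff convF convG)
        also have "\<dots> \<le> integral {0..t} (\<lambda>_. M * c n)"
          using dist_conv[of _ n] t
          by (intro integral_norm_bound_integral integrable_diff convF convG integrable_const_ivl)
            (auto simp: norm_minus_commute)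
        finally show ?thesis using t by (simp add: mult.left_commute)
      qed
      then show "\<forall>\<^sub>F n in sequentially. norm (integral {0..t} (conv (G n)) - integral {0..t} (conv F)) \<le> t * (M * c n)"
        by simp
      show "(\<lambda>n. t * (M * c n)) \<longlonglongrightarrow> 0" using tendsto_mult[OF tendsto_const[of t] Mc] by simp
    qed
    have l2: "(\<lambda>n. integral {0..t} (G n)) \<longlonglongrightarrow> integral {0..t} F"
    proof (rule LIM_zero_cancel, rule Lim_null_comparison[OF _ c])
      have "norm (integral {0..t} (G n) - integral {0..t} F) \<le> c n" for n
      proof -
        have "norm (integral {0..t} (G n) - integral {0..t} F) = norm (integral {0..t} (\<lambda>s. G n s - F s))"
          by (simp add: integral_diff FI GI)
        also have "\<dots> \<le> integral {0..t} (k n)"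
          using le[of _ n] t by (intro integral_norm_bound_integral integrable_diff FI GI k_sub t)
            (auto simp: norm_minus_commute)
        finally show ?thesis using kt[OF t, of n] by simp
      qed
      then show "\<forall>\<^sub>F n in sequentially. norm (integral {0..t} (G n) - integral {0..t} F) \<le> c n" by simp
    qed
    have l3: "(\<lambda>n. conv (G n) t) \<longlonglongrightarrow> conv F t"
      by (rule LIM_zero_cancel, rule Lim_null_comparison[OF _ Mc])
        (use dist_conv[OF t] in \<open>auto simp: norm_minus_commute\<close>)
    have GD: "integral {0..t} (conv (G n)) \<in> D" and BG: "B (integral {0..t} (conv (G n))) = conv (G n) t - integral {0..t} (G n)" for n
      using G[of n] t by (auto simp: duhamel_on_def)
    have "(\<lambda>n. B (integral {0..t} (conv (G n)))) \<longlonglongrightarrow> conv F t - integral {0..t} F"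
      unfolding BG by (intro tendsto_diff l2 l3)
    from generator_closed[OF GD l1 this] show ?thesis by blast
  qed
  with F contF show ?thesis by (simp add: duhamel_on_def)
qed

text \<open>Here \<open>q t\<close> is the time elapsed since the jump at \<open>a\<close>, and the
  convolution is the orbit of \<open>y\<close> integrated up to that time. Taking \<open>B\<close>
  inside the integral over \<open>r\<close> and using
  \<open>B (orbit_integral r y) = T r y - y\<close> produces the two required terms.\<close>

lemma duhamel_on_step_nonneg:
  assumes a: "a \<ge> 0"
  shows "duhamel_on N (\<lambda>s. indicator {a..} s *\<^sub>R y)"
proof -
  define q where "q t = max 0 (t - a)" for t :: real
  have q_nn: "q t \<ge> 0" for t by (simp add: q_def)
  have conv: "conv (\<lambda>s. indicator {a..} s *\<^sub>R y) t = orbit_integral (q t) y" for t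
  proof (cases "t < a")
    case True
    have "conv (\<lambda>s. indicator {a..} s *\<^sub>R y) t = integral {0..t} (\<lambda>s. 0)"
      unfolding conv_def using True by (intro integral_cong) (auto simp: T_zero)
    then show ?thesis using True by (simp add: orbit_integral_def q_def)
  next
    case False
    have "conv (\<lambda>s. indicator {a..} s *\<^sub>R y) t = integral {0..t} (\<lambda>s. if s \<in> {a..t} then T (t - s) y else 0)"
      unfolding conv_def by (intro integral_cong) (auto simp: T_zero)
    also have "\<dots> = integral {a..t} (\<lambda>s. T (t - s) y)"
      using a by (intro integral_restrict_subset) auto
    \<comment> \<open>A shift by \<open>t\<close> followed by a reflection turns
      \<open>t - s\<close> into the variable of integration.\<close>
    also have "\<dots> = integral {a - t..0} (\<lambda>u. T (- u) y)"
      using integral_shift_real_ivl[of "a - t" "-t" 0 "\<lambda>u. T (- u) y"] by simp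
    also have "\<dots> = integral {0..t - a} (\<lambda>s. T s y)"
      using Henstock_Kurzweil_Integration.integral_reflect_real[of "t - a" 0 "\<lambda>s. T s y"] by simp
    finally show ?thesis using False by (simp add: orbit_integral_def q_def)
  qed
  have cont: "continuous_on S (\<lambda>t. orbit_integral (q t) y)" for S
    by (rule continuous_on_compose2[OF continuous_orbit_integral[of y]])
      (auto simp: q_def intro!: continuous_intros)
  have int_conv: "integral {0..t} (\<lambda>s. orbit_integral (q s) y) = integral {0..q t} (\<lambda>r. orbit_integral r y)" if t: "t \<ge> 0" for t
  proof (cases "t < a")
    case True
    have "integral {0..t} (\<lambda>s. orbit_integral (q s) y) = integral {0..t} (\<lambda>s. 0)"
      using True by (intro integral_cong) (auto simp: orbit_integral_def q_def)
    then show ?thesis using True by (simp add: q_def)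
  next
    case False
    have "integral {0..t} (\<lambda>s. orbit_integral (q s) y) = integral {0..t} (\<lambda>s. if s \<in> {a..t} then orbit_integral (s - a) y else 0)"
      by (intro integral_cong) (auto simp: orbit_integral_def q_def max_def)
    also have "\<dots> = integral {a..t} (\<lambda>s. orbit_integral (s - a) y)"
      using a by (intro integral_restrict_subset) auto
    also have "\<dots> = integral {0..t - a} (\<lambda>r. orbit_integral r y)"
      using integral_shift_real_ivl[of 0 "-a" "t - a" "\<lambda>r. orbit_integral r y"] by simp
    finally show ?thesis using False by (simp add: q_def)
  qed
  have int_F: "integral {0..t} (\<lambda>s. indicator {a..} s *\<^sub>R y) = q t *\<^sub>R y" for t
  proof (cases "t < a")
    case True
    have "integral {0..t} (\<lambda>s. indicator {a..} s *\<^sub>R y) = integral {0..t} (\<lambda>s. 0)"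
      using True by (intro integral_cong) auto
    then show ?thesis using True by (simp add: q_def)
  next
    case False
    have "integral {0..t} (\<lambda>s. indicator {a..} s *\<^sub>R y) = integral {0..t} (\<lambda>s. if s \<in> {a..t} then y else 0)"
      by (intro integral_cong) auto
    also have "\<dots> = integral {a..t} (\<lambda>s. y)"
      using a by (intro integral_restrict_subset) auto
    finally show ?thesis using False by (simp add: q_def)
  qed
  have "integral {0..q t} (\<lambda>r. orbit_integral r y) \<in> D \<and>
      B (integral {0..q t} (\<lambda>r. orbit_integral r y)) = orbit_integral (q t) y - q t *\<^sub>R y" for t
  proof -
    have 1: "((\<lambda>r. orbit_integral r y) has_integral integral {0..q t} (\<lambda>r. orbit_integral r y)) {0..q t}"
      by (intro integrable_integral integrable_continuous_real continuous_on_subset[OF continuous_orbit_integral]) auto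
    have "((\<lambda>r. T r y - y) has_integral orbit_integral (q t) y - q t *\<^sub>R y) {0..q t}"
      using has_integral_const_real[of y 0 "q t"] q_nn[of t] unfolding orbit_integral_def
      by (intro has_integral_diff integrable_integral orbit_integrable) auto
    then have 2: "((\<lambda>r. B (orbit_integral r y)) has_integral orbit_integral (q t) y - q t *\<^sub>R y) {0..q t}"
      by (rule has_integral_eq[rotated]) (simp add: B_orbit_integral)
    show ?thesis using has_integral_in_D[OF 1 _ 2] B_has_integral[OF 1 _ 2] orbit_integral_in_D by simp
  qed
  moreover have "banach_integrable (lebesgue_on {0..N}) (\<lambda>s. indicator {a..} s *\<^sub>R y)"
    by (intro banach_integrable_indicator banach_integrable_continuous continuous_intros) auto
  ultimately show ?thesis using cont by (simp add: duhamel_on_def conv[abs_def] int_conv int_F)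
qed

section \<open>From step functions to all of L1\<close>

lemma duhamel_on_step: "duhamel_on N (\<lambda>s. indicator {a..} s *\<^sub>R y)"
proof (cases "a \<ge> 0")
  case False
  show ?thesis using duhamel_on_step_nonneg[of 0 N y]
    by (rule duhamel_on_cong) (use False in auto)
qed (rule duhamel_on_step_nonneg)

lemma duhamel_on_const: "duhamel_on N (\<lambda>s. y)"
  using duhamel_on_step[of N 0 y] by (rule duhamel_on_cong) auto

lemma duhamel_on_sum: "(\<And>i. i \<in> I \<Longrightarrow> duhamel_on N (F i)) \<Longrightarrow> duhamel_on N (\<lambda>s. \<Sum>i\<in>I. F i s)"
  by (induction I rule: infinite_finite_induct) (auto simp: duhamel_on_const duhamel_on_add)

text \<open>The rays \<open>{..<a}\<close> form an intersection stable generator of the Borel sets,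
  and the indicator of such a ray is a constant minus a step.\<close>

lemma duhamel_on_indicator_borel:
  assumes "E \<in> sets borel"
  shows "duhamel_on N (\<lambda>s. indicator E s *\<^sub>R y)"
proof -
  have borel: "sets borel = sigma_sets UNIV (range (lessThan :: real \<Rightarrow> _))"
    by (subst borel_Iio) simp
  have "{..<a} \<inter> {..<b} = {..<min a b}" for a b :: real by auto
  then have "Int_stable (range (lessThan :: real \<Rightarrow> _))"
    by (auto simp: Int_stable_def)
  moreover have "range (lessThan :: real \<Rightarrow> _) \<subseteq> Pow UNIV" by simp
  moreover have "E \<in> sigma_sets UNIV (range lessThan)" using assms borel by simp
  \<comment> \<open>All vectors at once, because the complement for \<open>y\<close> is the constant
    \<open>y\<close> plus the original set for \<open>- y\<close>.\<close>
  ultimately have "\<forall>y. duhamel_on N (\<lambda>s. indicator E s *\<^sub>R y)"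
  proof (induction rule: sigma_sets_induct_disjoint)
    case (basic A)
    then obtain a where A: "A = {..<a}" by blast
    show ?case
    proof
      fix y
      show "duhamel_on N (\<lambda>s. indicator A s *\<^sub>R y)"
        using duhamel_on_add[OF duhamel_on_const[of N y] duhamel_on_step[of N a "- y"]]
        by (rule duhamel_on_cong) (auto simp: A indicator_def)
    qed
  next
    case empty
    show ?case using duhamel_on_const[of N 0] by simp
  next
    case (compl A)
    show ?case
    proof
      fix y
      from compl have "duhamel_on N (\<lambda>s. indicator A s *\<^sub>R (- y))" by blast
      from duhamel_on_add[OF duhamel_on_const[of N y] this]
      show "duhamel_on N (\<lambda>s. indicator (UNIV - A) s *\<^sub>R y)"
        by (rule duhamel_on_cong) (auto simp: indicator_def)
    qed
  next
    case (union A)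
    have A: "A i \<in> sets borel" for i using union.hyps borel by blast
    show ?case
    proof
      fix y
      \<comment> \<open>The part of the union missed by the first \<open>n\<close> sets. It shrinks
        to the empty set, so by dominated convergence on the bounded interval its L1 contribution
        tends to 0.\<close>
      define R where "R n = (\<Union>i. A i) - (\<Union>i<n. A i)" for n
      have R: "R n \<in> sets borel" for n unfolding R_def using A by auto
      show "duhamel_on N (\<lambda>s. indicator (\<Union>i. A i) s *\<^sub>R y)"
      proof (rule duhamel_on_L1_limit)
        show "banach_integrable (lebesgue_on {0..N}) (\<lambda>s. indicator (\<Union>i. A i) s *\<^sub>R y)"
          using A by (intro banach_integrable_indicator banach_integrable_continuous continuous_intros) auto
        fix e :: real assume e: "e > 0"
        define k where "k n s = indicator (R n) s * norm y" for n and s :: real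
        have ki: "k n integrable_on {0..N}" for n
        proof -
          have "R n \<inter> {0..N} \<in> lmeasurable"
            using fmeasurable_Int_fmeasurable[of "{0..N}" lebesgue "R n"] R[of n]
            by (simp add: Int_commute lmeasurable_interval)
          then have "indicat_real (R n) integrable_on {0..N}" by (simp add: integrable_on_indicator)
          then show ?thesis unfolding k_def by (rule integrable_on_mult_left)
        qed
        have "(\<lambda>n. integral {0..N} (k n)) \<longlonglongrightarrow> integral {0..N} (\<lambda>s. 0)"
        proof (rule dominated_convergence(2)[where h="\<lambda>_. norm y"])
          show "(\<lambda>n. k n s) \<longlonglongrightarrow> 0" for s
          proof (rule tendsto_eventually)
            show "\<forall>\<^sub>F n in sequentially. k n s = 0"
            proof (cases "s \<in> (\<Union>i. A i)")
              case True
              then obtain i where "s \<in> A i" by blast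
              then have k0: "k n s = 0" if "n > i" for n using that by (auto simp: k_def R_def indicator_def)
              show ?thesis using eventually_gt_at_top[of i] by (rule eventually_mono) (rule k0)
            qed (simp add: k_def R_def)
          qed
        qed (auto simp: ki k_def indicator_def integrable_const_ivl)
        then have "(\<lambda>n. integral {0..N} (k n)) \<longlonglongrightarrow> 0" by simp
        then obtain n where n: "integral {0..N} (k n) < e"
          using order_tendstoD(2)[OF _ e] eventually_happens'[OF sequentially_bot] by blast
        have "duhamel_on N (\<lambda>s. \<Sum>i<n. indicator (A i) s *\<^sub>R y)"
          using union.IH by (intro duhamel_on_sum) blast
        moreover have "norm (indicator (\<Union>i. A i) s *\<^sub>R y - (\<Sum>i<n. indicator (A i) s *\<^sub>R y)) \<le> k n s" for s
        proof -
          have "(\<Sum>i<n. indicator (A i) s *\<^sub>R y) = indicat_real (\<Union>i<n. A i) s *\<^sub>R y"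
            using union.hyps(1)
            by (subst indicator_UN_disjoint) (auto simp: scaleR_sum_left intro: disjoint_family_on_mono)
          moreover have "indicat_real (\<Union>i. A i) s = indicator (\<Union>i<n. A i) s + indicator (R n) s"
            by (auto simp: R_def indicator_def)
          ultimately show ?thesis by (simp add: k_def scaleR_add_left)
        qed
        ultimately show "\<exists>G k. duhamel_on N G \<and> k integrable_on {0..N} \<and> integral {0..N} k < e \<and>
            (\<forall>s\<in>{0..N}. norm (indicator (\<Union>i. A i) s *\<^sub>R y - G s) \<le> k s)"
          using n ki[of n] by blast
      qed
    qed
  qed
  then show ?thesis ..
qed

text \<open>A Lebesgue set exceeds a Borel set \<open>S\<close> by a subset of a null set, so the
  error function is supported on that null set and has integral 0.\<close>

lemma duhamel_on_indicator:
  assumes E: "E \<in> sets lebesgue"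
  shows "duhamel_on N (\<lambda>s. indicator E s *\<^sub>R y)"
proof (rule duhamel_on_L1_limit)
  show "banach_integrable (lebesgue_on {0..N}) (\<lambda>s. indicator E s *\<^sub>R y)"
    using E by (intro banach_integrable_indicator banach_integrable_continuous continuous_intros) auto
  fix e :: real assume e: "e > 0"
  from E obtain S Z Z' where EZ: "E = S \<union> Z" "Z \<subseteq> Z'" and Z': "Z' \<in> null_sets lborel" and S: "S \<in> sets lborel"
    by (rule sets_completionE)
  define k where "k s = (if s \<in> Z' then norm y else 0)" for s
  have "negligible Z'" using Z' by (simp add: negligible_iff_null_sets null_sets_completionI)
  then have "(k has_integral 0) {0..N}"
    by (rule has_integral_negligible) (simp add: k_def)
  then have "k integrable_on {0..N}" "integral {0..N} k < e" using e by (auto simp: integral_unique)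
  moreover have "duhamel_on N (\<lambda>s. indicator S s *\<^sub>R y)" using S by (intro duhamel_on_indicator_borel) simp
  moreover have "norm (indicator E s *\<^sub>R y - indicator S s *\<^sub>R y) \<le> k s" for s
    using EZ by (auto simp: k_def indicator_def)
  ultimately show "\<exists>G k. duhamel_on N G \<and> k integrable_on {0..N} \<and> integral {0..N} k < e \<and>
      (\<forall>s\<in>{0..N}. norm (indicator E s *\<^sub>R y - G s) \<le> k s)" by blast
qed

lemma duhamel_on_banach_integrable:
  assumes F: "banach_integrable (lebesgue_on {0..N}) F"
  shows "duhamel_on N F"
proof (rule duhamel_on_L1_limit[OF F])
  fix e :: real assume e: "e > 0"
  have N: "{0..N} \<in> sets lebesgue" by simp
  from banach_integrable_simple_approx[OF N F e] obtain s
    where s: "Bochner_Integration.simple_bochner_integrable (lebesgue_on {0..N}) s"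
    and fs: "(\<lambda>x. norm (F x - s x)) integrable_on {0..N}" "integral {0..N} (\<lambda>x. norm (F x - s x)) < e" .
  define E where "E y = {x\<in>{0..N}. s x = y}" for y
  have "duhamel_on N (\<lambda>x. \<Sum>y\<in>s ` {0..N} - {0}. indicator (E y) x *\<^sub>R y)"
    using simple_bochner_integrable_level_set[OF N s]
    by (intro duhamel_on_sum duhamel_on_indicator) (auto simp: E_def)
  then have "duhamel_on N s"
    by (rule duhamel_on_cong)
      (use simple_bochner_integrable_sum_indicator[OF s, of _ "\<lambda>y. y", symmetric] in \<open>simp add: E_def\<close>)
  then show "\<exists>G k. duhamel_on N G \<and> k integrable_on {0..N} \<and> integral {0..N} k < e \<and>
      (\<forall>s\<in>{0..N}. norm (F s - G s) \<le> k s)"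
    using fs by blast
qed

text \<open>Since \<open>conv F\<close> does not depend on \<open>N\<close>, the statements on
  bounded intervals fit together; continuity at \<open>t\<close> is read off on
  \<open>{0..t + 1}\<close>. The initial value contributes an orbit, on whose integral
  \<open>B\<close> is known.\<close>

lemma mild_solution_duhamel:
  assumes F: "L1_halfline F"
    and U: "\<And>t. t \<ge> 0 \<Longrightarrow> U t = T t x + banach_integral (lebesgue_on {0..t}) (\<lambda>s. T (t - s) (F s))"
  shows "mild_solution D B F x U"
proof -
  have Ft: "banach_integrable (lebesgue_on {0..t}) F" for t
    using F unfolding L1_halfline_def by (rule banach_integrable_subset[rotated 3]) auto
  note duhamel = duhamel_on_banach_integrable[OF Ft, unfolded duhamel_on_def]
  have U': "U t = T t x + conv F t" if "t \<ge> 0" for t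
    unfolding conv_def U[OF that] by (subst banach_integral_eq_integral[OF _ conv_integrable[OF Ft]]) auto
  have contN: "continuous_on {0..N} (conv F)" for N using duhamel by blast
  have cont: "continuous_on {0..} (conv F)"
    unfolding continuous_on_eq_continuous_within
  proof
    fix t :: real assume "t \<in> {0..}"
    then have "continuous (at t within {0..t + 1}) (conv F)"
      using contN[of "t + 1"] by (simp add: continuous_on_eq_continuous_within)
    moreover have "at t within {0..t + 1} = at t within {0..}"
      by (rule at_within_nhd[of _ "{..<t + 1}"]) auto
    ultimately show "continuous (at t within {0..}) (conv F)" by simp
  qed
  have contU: "continuous_on {0..} U"
    using continuous_on_add[OF continuous_orbit[of x] cont] by (rule continuous_on_eq) (simp add: U')
  have "integral {0..t} U \<in> D \<and> U t = x + B (integral {0..t} U) + banach_integral (lebesgue_on {0..t}) F"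
    if t: "t \<ge> 0" for t
  proof -
    have d: "integral {0..t} (conv F) \<in> D" "B (integral {0..t} (conv F)) = conv F t - integral {0..t} F"
      using duhamel[of t] t by auto
    have "integral {0..t} U = integral {0..t} (\<lambda>s. T s x + conv F s)"
      using U' by (intro integral_cong) auto
    also have "\<dots> = orbit_integral t x + integral {0..t} (conv F)"
      unfolding orbit_integral_def by (intro integral_add orbit_integrable integrable_continuous_real contN) auto
    finally have eq: "integral {0..t} U = orbit_integral t x + integral {0..t} (conv F)" .
    have "banach_integral (lebesgue_on {0..t}) F = integral {0..t} F"
      by (rule banach_integral_eq_integral[OF _ Ft]) simp
    then show ?thesis
      using d orbit_integral_in_D[OF t] by (simp add: eq D_add B_add B_orbit_integral[OF t] U'[OF t])
  qed
  with F contU show ?thesis by (simp add: mild_solution_def)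
qed

text \<open>This makes semigroups computable: a candidate for an orbit is identified by verifying
  the homogeneous mild equation.\<close>

lemma homogeneous_mild_eq_orbit:
  assumes z: "continuous_on {0..} z" and zD: "\<And>t. t \<ge> 0 \<Longrightarrow> integral {0..t} z \<in> D"
    and Bz: "\<And>t. t \<ge> 0 \<Longrightarrow> z t = x + B (integral {0..t} z)" and t: "t \<ge> 0"
  shows "z t = T t x"
proof -
  have int: "integral {0..t} (\<lambda>s. z s - T s x) = integral {0..t} z - orbit_integral t x" for t
    unfolding orbit_integral_def
    by (intro integral_diff orbit_integrable integrable_continuous_real continuous_on_subset[OF z]) auto
  have "z t - T t x = 0"
  proof (rule homogeneous_mild_zero[OF _ _ _ t, of "\<lambda>t. z t - T t x"])
    show "continuous_on {0..} (\<lambda>t. z t - T t x)" by (intro continuous_on_diff z continuous_orbit)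
    fix t :: real assume t: "t \<ge> 0"
    show "integral {0..t} (\<lambda>t. z t - T t x) \<in> D"
      unfolding int by (intro D_diff zD orbit_integral_in_D t)
    show "B (integral {0..t} (\<lambda>t. z t - T t x)) = z t - T t x"
      using B_diff[OF zD[OF t] orbit_integral_in_D[OF t, of x]] Bz[OF t]
      by (simp add: int B_orbit_integral[OF t])
  qed
  then show ?thesis by simp
qed

text \<open>The mild solution \<open>U'\<close> with initial value \<open>B x + F 0\<close> and inhomogeneity \<open>F'\<close> is the derivative of
  the solution: \<open>x + \<integral> U'\<close> solves the original problem classically, hence mildly.\<close>

lemma classical_solution_if_absolutely_continuous:
  assumes F: "L1_halfline F" and F': "L1_halfline F'"
    and FF': "\<And>t. t \<ge> 0 \<Longrightarrow> F t = F 0 + integral {0..t} F'"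
    and x: "x \<in> D" and U: "mild_solution D B F x U"
  shows "classical_solution D B F x U"
proof -
  define U' where "U' t = T t (B x + F 0) + banach_integral (lebesgue_on {0..t}) (\<lambda>s. T (t - s) (F' s))" for t
  have mild': "mild_solution D B F' (B x + F 0) U'"
    by (rule mild_solution_duhamel[OF F']) (simp add: U'_def)
  define Z where "Z t = x + integral {0..t} U'" for t
  have Ft: "banach_integrable (lebesgue_on {0..t}) F" "banach_integrable (lebesgue_on {0..t}) F'" for t
    using F F' unfolding L1_halfline_def by (auto intro: banach_integrable_subset[rotated 3])
  have contU': "continuous_on {0..} U'" using mild' by (simp add: mild_solution_def)
  have ZD: "Z t \<in> D" and BZ: "B (Z t) = U' t - F t" if t: "t \<ge> 0" for t
  proof -
    have d: "integral {0..t} U' \<in> D" "U' t = (B x + F 0) + B (integral {0..t} U') + integral {0..t} F'"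
      using mild' t banach_integral_eq_integral[OF _ Ft(2)[of t]] by (auto simp: mild_solution_def)
    show "Z t \<in> D" unfolding Z_def using x d by (intro D_add)
    \<comment> \<open>This is where the initial value \<open>B x + F 0\<close> fits: in the mild
      equation of \<open>U'\<close> the terms \<open>F 0\<close> and
      \<open>integral {0..t} F'\<close> add up to \<open>F t\<close>, and \<open>B x\<close> and
      \<open>B (integral {0..t} U')\<close> to \<open>B (Z t)\<close>.\<close>
    show "B (Z t) = U' t - F t" using d FF'[OF t] by (simp add: Z_def B_add[OF x d(1)])
  qed
  have Z': "(Z has_vector_derivative U' t) (at t within {0..})" if t: "t \<ge> 0" for t
  proof -
    have "((\<lambda>u. integral {0..u} U') has_vector_derivative U' t) (at t within {0..t + 1})"
      using t by (intro integral_has_vector_derivative continuous_on_subset[OF contU']) auto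
    then have "(Z has_vector_derivative U' t) (at t within {0..t + 1})"
      unfolding Z_def by (auto intro!: derivative_eq_intros)
    moreover have "at t within {0..t + 1} = at t within {0..}"
      by (rule at_within_nhd[of _ "{..<t + 1}"]) auto
    ultimately show ?thesis by simp
  qed
  have contZ: "continuous_on {0..} Z"
    using Z' has_vector_derivative_continuous by (fastforce simp: continuous_on_eq_continuous_within)
  have "mild_solution D B F x Z"
    unfolding mild_solution_def
  proof (intro conjI allI impI F contZ)
    fix t :: real assume t: "t \<ge> 0"
    have 1: "(Z has_integral integral {0..t} Z) {0..t}"
      by (intro integrable_integral integrable_continuous_real continuous_on_subset[OF contZ]) auto
    have "((\<lambda>s. U' s - F s) has_integral integral {0..t} U' - integral {0..t} F) {0..t}"
      using Ft(1)[of t]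
      by (intro has_integral_diff integrable_integral integrable_continuous_real
          continuous_on_subset[OF contU'] banach_integrable_integrable_on) auto
    then have 2: "((\<lambda>s. B (Z s)) has_integral integral {0..t} U' - integral {0..t} F) {0..t}"
      by (rule has_integral_eq[rotated]) (simp add: BZ)
    show "integral {0..t} Z \<in> D" using has_integral_in_D[OF 1 _ 2] ZD by simp
    show "Z t = x + B (integral {0..t} Z) + banach_integral (lebesgue_on {0..t}) F"
      using B_has_integral[OF 1 _ 2] ZD banach_integral_eq_integral[OF _ Ft(1)[of t]] by (simp add: Z_def)
  qed
  from mild_solution_unique[OF U this] have eq: "U t = Z t" if "t \<ge> 0" for t using that .
  have "(U has_vector_derivative U' t) (at t within {0..}) \<and> U t \<in> D \<and> U' t = B (U t) + F t" if t: "t \<ge> 0" for t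
  proof (intro conjI)
    show "(U has_vector_derivative U' t) (at t within {0..})"
      using Z'[OF t] by (rule has_vector_derivative_transform[rotated 2]) (use t eq in auto)
  qed (use eq[OF t] ZD[OF t] BZ[OF t] in auto)
  moreover have "U 0 = x" using eq[of 0] by (simp add: Z_def)
  ultimately show ?thesis unfolding classical_solution_def using contU' by blast
qed

end

section \<open>Weakly differentiable functions are absolutely continuous\<close>

text \<open>A class stable under differentiation settles all iterated derivatives in one induction.
  The polynomial factor makes the flat functions stable; affine substitutions and products then give
  bumps, and antiderivatives give smooth steps.\<close>

inductive_set smooth_funs :: "(real \<Rightarrow> real) set" where
  exp_inverse: "(\<lambda>x. if x > 0 then poly p (1 / x) * exp (- (1 / x)) else 0) \<in> smooth_funs"
| const: "(\<lambda>x. c) \<in> smooth_funs"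
| add: "f \<in> smooth_funs \<Longrightarrow> g \<in> smooth_funs \<Longrightarrow> (\<lambda>x. f x + g x) \<in> smooth_funs"
| mult: "f \<in> smooth_funs \<Longrightarrow> g \<in> smooth_funs \<Longrightarrow> (\<lambda>x. f x * g x) \<in> smooth_funs"
| affine: "f \<in> smooth_funs \<Longrightarrow> (\<lambda>x. f (a * x + b)) \<in> smooth_funs"
| antiderivative: "g \<in> smooth_funs \<Longrightarrow> (\<And>x. (G has_real_derivative g x) (at x)) \<Longrightarrow> G \<in> smooth_funs"

text \<open>Substituting the reciprocal variable turns this into the decay of a polynomial times
  \<open>exp (- x)\<close> at infinity.\<close>

lemma tendsto_poly_exp_inverse:
  fixes p :: "real poly"
  shows "((\<lambda>x. poly p (1 / x) * exp (- (1 / x))) \<longlongrightarrow> 0) (at_right 0)"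
proof -
  have "((\<lambda>x. \<Sum>i\<le>degree p. coeff p i * (x ^ i / exp x)) \<longlongrightarrow> (\<Sum>i\<le>degree p. coeff p i * 0)) at_top"
    by (intro tendsto_sum tendsto_mult tendsto_const tendsto_power_div_exp_0)
  moreover have "(\<lambda>x. \<Sum>i\<le>degree p. coeff p i * (x ^ i / exp x)) = (\<lambda>x. poly p x * exp (- x))"
    by (simp add: poly_altdef sum_distrib_right exp_minus divide_inverse mult.assoc)
  ultimately have "((\<lambda>x. poly p x * exp (- x)) \<longlongrightarrow> 0) at_top" by simp
  then show ?thesis by (simp add: filterlim_at_right_to_top inverse_eq_divide)
qed

text \<open>The chain rule brings out the factor \<open>1 / x^2\<close>, encoded by the polynomial
  \<open>[:0, 0, 1:]\<close>; differentiating the exponential gives \<open>p\<close>, and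
  differentiating the polynomial gives \<open>- pderiv p\<close>.\<close>

lemma has_real_derivative_exp_inverse:
  fixes p :: "real poly"
  shows "((\<lambda>x. if x > 0 then poly p (1 / x) * exp (- (1 / x)) else 0) has_real_derivative
    (if x > 0 then poly ([:0, 0, 1:] * (p - pderiv p)) (1 / x) * exp (- (1 / x)) else 0)) (at x)"
    (is "(?f has_real_derivative ?f' x) (at x)")
proof -
  consider "x > 0" | "x < 0" | "x = 0" by linarith
  then show ?thesis
  proof cases
    case 1
    have "((\<lambda>x. poly p (1 / x) * exp (- (1 / x))) has_real_derivative ?f' x) (at x)"
      using 1 by (auto intro!: derivative_eq_intros DERIV_chain2[OF poly_DERIV] simp: field_simps power2_eq_square)
    then show ?thesis
      by (rule has_field_derivative_transform_within_open[of _ _ _ "{0<..}"]) (use 1 in auto)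
  next
    case 2
    have "((\<lambda>x. 0) has_real_derivative ?f' x) (at x)" using 2 by simp
    then show ?thesis
      by (rule has_field_derivative_transform_within_open[of _ _ _ "{..<0}"]) (use 2 in auto)
  next
    case 3
    have "((\<lambda>y. (?f y - ?f 0) / (y - 0)) \<longlongrightarrow> 0) (at_left 0)"
      by (rule tendsto_eventually) (auto simp: eventually_at_filter)
    \<comment> \<open>Dividing by \<open>y\<close> multiplies by \<open>1 / y\<close>, so the
      quotient is of the same form with \<open>pCons 0 p\<close> in place of
      \<open>p\<close>.\<close>
    moreover have "((\<lambda>y. (?f y - ?f 0) / (y - 0)) \<longlongrightarrow> 0) (at_right 0)"
    proof (rule Lim_transform_eventually[OF tendsto_poly_exp_inverse[of "pCons 0 p"]])
      show "\<forall>\<^sub>F y in at_right 0. poly (pCons 0 p) (1 / y) * exp (- (1 / y)) = (?f y - ?f 0) / (y - 0)"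
        by (auto simp: eventually_at_filter)
    qed
    ultimately have "((\<lambda>y. (?f y - ?f 0) / (y - 0)) \<longlongrightarrow> 0) (at 0)" by (rule filterlim_split_at_real)
    then show ?thesis using 3 by (simp add: has_field_derivative_iff)
  qed
qed

lemma smooth_funs_derivative:
  "f \<in> smooth_funs \<Longrightarrow> \<exists>f'\<in>smooth_funs. \<forall>x. (f has_real_derivative f' x) (at x)"
proof (induction rule: smooth_funs.induct)
  case (exp_inverse p)
  show ?case
    by (rule bexI[OF _ smooth_funs.exp_inverse[of "[:0, 0, 1:] * (p - pderiv p)"]])
      (intro allI has_real_derivative_exp_inverse)
next
  case (const c)
  show ?case by (rule bexI[OF _ smooth_funs.const[of 0]]) simp
next
  case (add f g)
  then obtain f' g' where d: "f' \<in> smooth_funs" "g' \<in> smooth_funs"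
    "\<forall>x. (f has_real_derivative f' x) (at x)" "\<forall>x. (g has_real_derivative g' x) (at x)" by blast
  show ?case
    by (rule bexI[OF _ smooth_funs.add[OF d(1,2)]]) (use d(3,4) in \<open>auto intro: DERIV_add\<close>)
next
  case (mult f g)
  then obtain f' g' where d: "f' \<in> smooth_funs" "g' \<in> smooth_funs"
    "\<forall>x. (f has_real_derivative f' x) (at x)" "\<forall>x. (g has_real_derivative g' x) (at x)" by blast
  show ?case
    by (rule bexI[OF _ smooth_funs.add[OF smooth_funs.mult[OF d(1) mult(2)] smooth_funs.mult[OF d(2) mult(1)]]])
      (use d(3,4) in \<open>auto intro: DERIV_mult\<close>)
next
  case (affine f a b)
  then obtain f' where f': "f' \<in> smooth_funs" "\<forall>x. (f has_real_derivative f' x) (at x)" by blast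
  have "((\<lambda>x. f (a * x + b)) has_real_derivative f' (a * x + b) * a) (at x)" for x
    by (rule DERIV_chain2[of f]) (use f' in \<open>auto intro!: derivative_eq_intros\<close>)
  then show ?case
    by (intro bexI[OF _ smooth_funs.mult[OF smooth_funs.affine[OF f'(1), of a b] smooth_funs.const[of a]]]) blast
next
  case (antiderivative g G)
  then show ?case by blast
qed

lemma smooth_funs_deriv: "f \<in> smooth_funs \<Longrightarrow> deriv f \<in> smooth_funs"
  and smooth_funs_differentiable: "f \<in> smooth_funs \<Longrightarrow> f field_differentiable at x"
proof -
  assume "f \<in> smooth_funs"
  from smooth_funs_derivative[OF this] obtain f' where f': "f' \<in> smooth_funs"
    "\<And>x. (f has_real_derivative f' x) (at x)" by blast
  have "deriv f = f'" by (rule ext) (rule DERIV_imp_deriv[OF f'(2)])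
  with f'(1) show "deriv f \<in> smooth_funs" by simp
  show "f field_differentiable at x" using f'(2) by (auto simp: field_differentiable_def)
qed

lemma test_function_smooth_funs:
  assumes f: "f \<in> smooth_funs" and supp: "0 < a" "\<And>t. t \<notin> {a..b} \<Longrightarrow> f t = 0"
  shows "test_function f"
proof -
  have "(deriv ^^ n) f \<in> smooth_funs" for n
    by (induction n) (auto simp: f smooth_funs_deriv)
  then show ?thesis unfolding test_function_def using supp smooth_funs_differentiable by blast
qed

lemma smooth_funs_continuous: "f \<in> smooth_funs \<Longrightarrow> continuous_on S f"
  using smooth_funs_differentiable field_differentiable_imp_continuous_at continuous_at_imp_continuous_on by blast

text \<open>\<open>S\<close> is an antiderivative of a bump supported in \<open>{a..a + d}\<close>,
  shifted to vanish at \<open>a\<close> and divided by its total rise \<open>c\<close>.\<close>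

lemma smooth_step_exists:
  assumes d: "(0::real) < d"
  obtains S S' where "S \<in> smooth_funs" "S' \<in> smooth_funs" "\<And>x. (S has_real_derivative S' x) (at x)"
    "\<And>x. 0 \<le> S' x" "\<And>x. x \<notin> {a..a + d} \<Longrightarrow> S' x = 0"
    "\<And>x. x \<le> a \<Longrightarrow> S x = 0" "\<And>x. x \<ge> a + d \<Longrightarrow> S x = 1" "\<And>x. 0 \<le> S x \<and> S x \<le> 1"
proof -
  define h :: "real \<Rightarrow> real" where "h x = (if x > 0 then poly 1 (1 / x) * exp (- (1 / x)) else 0)" for x
  have h: "h \<in> smooth_funs" unfolding h_def by (rule smooth_funs.exp_inverse)
  have h_nn: "h x \<ge> 0" and h_pos: "x > 0 \<Longrightarrow> h x > 0" and h_0: "x \<le> 0 \<Longrightarrow> h x = 0" for x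
    by (auto simp: h_def)
  \<comment> \<open>One factor vanishes left of \<open>a\<close>, the other right of
    \<open>a + d\<close>. The arguments are spelled out to have the shape of the rule
    \<open>affine\<close>.\<close>
  define r where "r x = h (1 * x + (- a)) * h (- 1 * x + (a + d))" for x
  have r: "r \<in> smooth_funs" unfolding r_def
    by (rule smooth_funs.mult[OF smooth_funs.affine[OF h] smooth_funs.affine[OF h]])
  have r_nn: "r x \<ge> 0" for x by (simp add: r_def h_nn)
  have r_out: "r x = 0" if "x \<notin> {a<..<a + d}" for x
    using that by (auto simp: r_def h_0)
  have "isCont r x" for x
    using smooth_funs_differentiable[OF r] field_differentiable_imp_continuous_at by blast
  then obtain G where "\<And>x. (G has_vector_derivative r x) (at x)"
    using einterval_antiderivative[of "-\<infinity>" "\<infinity>" r] by auto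
  then have G: "\<And>x. (G has_real_derivative r x) (at x)"
    by (simp add: has_real_derivative_iff_has_vector_derivative)
  have mono: "G x \<le> G y" if "x \<le> y" for x y
    by (rule DERIV_nonneg_imp_nondecreasing[OF that]) (use G r_nn in blast)
  have const: "G x = G y" if "x \<le> y" "\<And>z. x < z \<Longrightarrow> z < y \<Longrightarrow> r z = 0" for x y
  proof (cases "x = y")
    case False
    then have "x < y" using that by simp
    then show ?thesis
      using DERIV_isconst_end[of x y G] G that(2) by (metis DERIV_isCont continuous_at_imp_continuous_on)
  qed simp
  have "G a < G (a + d)"
  proof (rule DERIV_pos_imp_increasing_open[of a "a + d" G])
    fix x assume "a < x" "x < a + d"
    then show "\<exists>y. (G has_real_derivative y) (at x) \<and> 0 < y"
      using G[of x] by (intro exI[of _ "r x"]) (simp add: r_def h_pos)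
  qed (use d G in \<open>auto intro!: continuous_at_imp_continuous_on intro: DERIV_isCont\<close>)
  define c where "c = G (a + d) - G a"
  with \<open>G a < G (a + d)\<close> have c: "c > 0" by simp
  define S where "S x = (1 / c) * (G x + (- G a))" for x
  define S' where "S' x = (1 / c) * r x" for x
  show thesis
  proof (rule that[of S S'])
    have "G \<in> smooth_funs" using r G by (rule smooth_funs.antiderivative)
    from smooth_funs.mult[OF smooth_funs.const smooth_funs.add[OF this smooth_funs.const]]
    show "S \<in> smooth_funs" unfolding S_def .
    show "S' \<in> smooth_funs" unfolding S'_def by (rule smooth_funs.mult[OF smooth_funs.const r])
    show "(S has_real_derivative S' x) (at x)" for x
      unfolding S_def S'_def using c by (auto intro!: derivative_eq_intros G)
    show "0 \<le> S' x" for x using c r_nn by (simp add: S'_def)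
    show "S' x = 0" if "x \<notin> {a..a + d}" for x using that r_out[of x] by (auto simp: S'_def)
    show S0: "S x = 0" if "x \<le> a" for x
      using const[OF that] r_out by (simp add: S_def)
    show S1: "S x = 1" if "x \<ge> a + d" for x
      using const[OF that] r_out c c_def by (simp add: S_def)
    have S_mono: "S x \<le> S y" if "x \<le> y" for x y
      using mono[OF that] c by (simp add: S_def divide_right_mono)
    show "0 \<le> S x \<and> S x \<le> 1" for x
      using S_mono[of "min x a" x] S_mono[of x "max x (a + d)"] S0[of "min x a"] S1[of "max x (a + d)"] by simp
  qed
qed

text \<open>\<open>S'\<close> is a probability density on \<open>{u..v}\<close> that vanishes
  outside \<open>{a..b}\<close>, since it integrates to \<open>S v - S u = 1\<close>. The integral
  is thus a weighted average of values within \<open>e\<close> of \<open>z\<close>.\<close>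

lemma norm_mollified_diff_le:
  fixes \<psi> :: "real \<Rightarrow> 'b::banach"
  assumes S: "\<And>x. (S has_real_derivative S' x) (at x)" and S'_cont: "continuous_on {u..v} S'"
    and S'_nn: "\<And>x. 0 \<le> S' x" and S'_out: "\<And>x. x \<notin> {a..b} \<Longrightarrow> S' x = 0"
    and S01: "S u = 0" "S v = 1" and uv: "u \<le> v"
    and \<psi>: "continuous_on {u..v} \<psi>" and near: "\<And>x. x \<in> {a..b} \<Longrightarrow> norm (\<psi> x - z) \<le> e"
  shows "norm (integral {u..v} (\<lambda>x. S' x *\<^sub>R \<psi> x) - z) \<le> e"
proof -
  have "(S' has_integral S v - S u) {u..v}"
    using uv S by (intro fundamental_theorem_of_calculus)
      (auto simp: has_real_derivative_iff_has_vector_derivative intro: has_vector_derivative_at_within)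
  then have S': "(S' has_integral 1) {u..v}" by (simp add: S01)
  then have z: "((\<lambda>x. S' x *\<^sub>R z) has_integral z) {u..v}"
    using has_integral_scaleR_left[of S' 1 "{u..v}" z] by simp
  have \<psi>': "(\<lambda>x. S' x *\<^sub>R \<psi> x) integrable_on {u..v}"
    by (intro integrable_continuous_real continuous_intros S'_cont \<psi>)
  have e: "((\<lambda>x. S' x * e) has_integral e) {u..v}"
    using has_integral_mult_left[OF S', of e] by simp
  have "norm (integral {u..v} (\<lambda>x. S' x *\<^sub>R \<psi> x) - z) = norm (integral {u..v} (\<lambda>x. S' x *\<^sub>R \<psi> x - S' x *\<^sub>R z))"
    using z \<psi>' by (subst integral_diff) (auto simp: integral_unique intro: has_integral_integrable)
  also have "\<dots> \<le> integral {u..v} (\<lambda>x. S' x * e)"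
  proof (rule integral_norm_bound_integral)
    show "norm (S' x *\<^sub>R \<psi> x - S' x *\<^sub>R z) \<le> S' x * e" for x
    proof (cases "x \<in> {a..b}")
      case True
      then show ?thesis using near[OF True] S'_nn[of x] by (simp flip: scaleR_diff_right add: mult_left_mono)
    qed (simp add: S'_out)
  qed (use z \<psi>' e in \<open>auto intro!: integrable_diff intro: has_integral_integrable\<close>)
  also have "\<dots> = e" using e by (rule integral_unique)
  finally show ?thesis .
qed

section \<open>The fundamental theorem for weak derivatives\<close>

lemma banach_integral_halfline_compact_support:
  fixes f :: "real \<Rightarrow> 'b::banach"
  assumes f: "banach_integrable (lebesgue_on {0..N}) f" and out: "\<And>t. t > N \<Longrightarrow> f t = 0"
  shows "banach_integral (lebesgue_on {0..}) f = integral {0..N} f"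
proof -
  have eq: "(\<lambda>t. indicator {0..N} t *\<^sub>R f t) t = f t" if "t \<in> {0..}" for t
    using that out by (auto simp: indicator_def)
  have "banach_integrable (lebesgue_on {0..}) (\<lambda>t. indicator {0..N} t *\<^sub>R f t)"
    using f by (intro banach_integrable_extend) auto
  then have "banach_integrable (lebesgue_on {0..}) f"
    by (rule banach_integrable_cong[rotated]) (use eq in auto)
  then have "banach_integral (lebesgue_on {0..}) f = integral {0..} f"
    by (intro banach_integral_eq_integral) auto
  also have "\<dots> = integral {0..} (\<lambda>t. if t \<in> {0..N} then f t else 0)"
    using out by (intro integral_cong) auto
  also have "\<dots> = integral {0..N} f" by (rule integral_restrict_subset) auto
  finally show ?thesis .
qed

text \<open>The weak derivative is tested against smooth approximations of the indicator function of \<open>[a, b]\<close>.\<close>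

lemma W11_increment_pos:
  fixes \<psi> \<phi> :: "real \<Rightarrow> 'b::banach"
  assumes \<psi>: "continuous_on {0..} \<psi>" and \<phi>: "L1_halfline \<phi>"
    and weak: "\<And>\<eta>. test_function \<eta> \<Longrightarrow> banach_integral (lebesgue_on {0..}) (\<lambda>t. deriv \<eta> t *\<^sub>R \<psi> t) =
             - banach_integral (lebesgue_on {0..}) (\<lambda>t. \<eta> t *\<^sub>R \<phi> t)"
    and ab: "0 < a" "a < b"
  shows "\<psi> b - \<psi> a = integral {a..b} \<phi>"
proof -
  define N where "N = b + 1"
  have \<phi>t: "banach_integrable (lebesgue_on {0..t}) \<phi>" for t
    using \<phi> unfolding L1_halfline_def by (rule banach_integrable_subset[rotated 3]) auto
  have \<phi>n: "(\<lambda>t. norm (\<phi> t)) integrable_on {0..t}" for t by (rule banach_integrable_norm[OF _ \<phi>t]) auto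
  define J where "J t = integral {0..t} (\<lambda>t. norm (\<phi> t))" for t
  have J_cont: "continuous_on {0..N} J" unfolding J_def by (rule indefinite_integral_continuous_1[OF \<phi>n])
  \<comment> \<open>The factor 4 collects two errors at each end point: averaging
    \<open>\<psi>\<close>, and the mass of \<open>\<phi>\<close> in the layer where the test
    function is neither 0 nor 1.\<close>
  have bound: "norm (\<psi> b - \<psi> a - integral {a..b} \<phi>) \<le> 4 * e" if e: "e > 0" for e
  proof -
    \<comment> \<open>One width serves two purposes: on the layer to the right of \<open>t\<close>,
      \<open>\<psi>\<close> is almost constant and \<open>\<phi>\<close> has little mass, as
      measured by \<open>J\<close>.\<close>
    have nearby: "\<exists>d>0. \<forall>s\<in>{t..t + d}. norm (\<psi> s - \<psi> t) \<le> e \<and> \<bar>J s - J t\<bar> \<le> e" if t: "0 < t" "t \<le> b" for t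
    proof -
      have "continuous (at t within {0..N}) (\<lambda>s. (\<psi> s, J s))"
        using t continuous_on_subset[OF \<psi>, of "{0..N}"] J_cont
        by (intro continuous_Pair) (auto simp: continuous_on_eq_continuous_within N_def)
      then obtain d where d: "d > 0" "\<And>s. s \<in> {0..N} \<Longrightarrow> dist s t < d \<Longrightarrow> dist (\<psi> s, J s) (\<psi> t, J t) < e"
        using e by (auto simp: continuous_within_eps_delta)
      show ?thesis
      proof (intro exI[of _ "min (d/2) 1"] conjI ballI)
        fix s assume s: "s \<in> {t..t + min (d/2) 1}"
        then have "dist (\<psi> s, J s) (\<psi> t, J t) < e"
          using t d(1) by (intro d(2)) (auto simp: N_def dist_real_def)
        then show "norm (\<psi> s - \<psi> t) \<le> e" "\<bar>J s - J t\<bar> \<le> e"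
          using dist_fst_le[of "(\<psi> s, J s)" "(\<psi> t, J t)"] dist_snd_le[of "(\<psi> s, J s)" "(\<psi> t, J t)"]
          by (auto simp: dist_norm)
      qed (use d in auto)
    qed
    obtain d1 where d1: "d1 > 0" "\<And>s. s \<in> {a..a + d1} \<Longrightarrow> norm (\<psi> s - \<psi> a) \<le> e \<and> \<bar>J s - J a\<bar> \<le> e"
      using nearby[of a] ab by (metis less_imp_le)
    obtain d2 where d2: "d2 > 0" "\<And>s. s \<in> {b..b + d2} \<Longrightarrow> norm (\<psi> s - \<psi> b) \<le> e \<and> \<bar>J s - J b\<bar> \<le> e"
      using nearby[of b] ab by (metis less_trans order_refl)
    \<comment> \<open>The bound \<open>(b - a) / 2\<close> separates the two layers, and
      \<open>1/2\<close> keeps the second one inside \<open>{0..N}\<close>. Both layers lie to the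
      right of their end points, so the support keeps its distance from 0.\<close>
    define d where "d = min (min d1 d2) (min ((b - a) / 2) (1/2))"
    have d: "0 < d" "d \<le> d1" "d \<le> d2" "a + d < b" "b + d < N"
      using d1 d2 ab by (auto simp: d_def N_def min_def field_simps)
    obtain S S' where S: "S \<in> smooth_funs" "S' \<in> smooth_funs" "\<And>x. (S has_real_derivative S' x) (at x)"
      "\<And>x. 0 \<le> S' x" "\<And>x. x \<notin> {a..a + d} \<Longrightarrow> S' x = 0"
      "\<And>x. x \<le> a \<Longrightarrow> S x = 0" "\<And>x. x \<ge> a + d \<Longrightarrow> S x = 1" "\<And>x. 0 \<le> S x \<and> S x \<le> 1"
      using smooth_step_exists[OF d(1), of a] by metis
    obtain R R' where R: "R \<in> smooth_funs" "R' \<in> smooth_funs" "\<And>x. (R has_real_derivative R' x) (at x)"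
      "\<And>x. 0 \<le> R' x" "\<And>x. x \<notin> {b..b + d} \<Longrightarrow> R' x = 0"
      "\<And>x. x \<le> b \<Longrightarrow> R x = 0" "\<And>x. x \<ge> b + d \<Longrightarrow> R x = 1" "\<And>x. 0 \<le> R x \<and> R x \<le> 1"
      using smooth_step_exists[OF d(1), of b] by metis
    define \<eta> where "\<eta> x = S x + (- 1) * R x" for x
    have \<eta>: "\<eta> \<in> smooth_funs" unfolding \<eta>_def
      by (rule smooth_funs.add[OF S(1) smooth_funs.mult[OF smooth_funs.const R(1)]])
    have \<eta>_out: "\<eta> t = 0" if "t \<notin> {a..b + d}" for t
    proof (cases "t < a")
      case True
      then show ?thesis using S(6)[of t] R(6)[of t] ab by (simp add: \<eta>_def)
    next
      case False
      then show ?thesis using that S(7)[of t] R(7)[of t] ab d by (simp add: \<eta>_def)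
    qed
    have test: "test_function \<eta>" using \<eta> ab(1) \<eta>_out by (rule test_function_smooth_funs)
    have "(\<eta> has_real_derivative S' x - R' x) (at x)" for x
      unfolding \<eta>_def by (auto intro!: derivative_eq_intros S R)
    then have deriv_\<eta>: "deriv \<eta> = (\<lambda>x. S' x - R' x)" by (auto simp: DERIV_imp_deriv)
    have \<psi>N: "continuous_on {0..N} \<psi>" using \<psi> by (rule continuous_on_subset) auto
    note cont = smooth_funs_continuous[OF S(2)] smooth_funs_continuous[OF R(2)] smooth_funs_continuous[OF \<eta>]
    have "banach_integral (lebesgue_on {0..}) (\<lambda>t. deriv \<eta> t *\<^sub>R \<psi> t) = integral {0..N} (\<lambda>t. deriv \<eta> t *\<^sub>R \<psi> t)"
      unfolding deriv_\<eta>
      using d ab by (intro banach_integral_halfline_compact_support banach_integrable_continuous continuous_intros cont \<psi>N)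
        (auto simp: S(5) R(5))
    also have "\<dots> = integral {0..N} (\<lambda>t. S' t *\<^sub>R \<psi> t) - integral {0..N} (\<lambda>t. R' t *\<^sub>R \<psi> t)"
      unfolding deriv_\<eta> scaleR_diff_left
      by (intro integral_diff integrable_continuous_real continuous_intros cont \<psi>N)
    finally have left: "banach_integral (lebesgue_on {0..}) (\<lambda>t. deriv \<eta> t *\<^sub>R \<psi> t)
      = integral {0..N} (\<lambda>t. S' t *\<^sub>R \<psi> t) - integral {0..N} (\<lambda>t. R' t *\<^sub>R \<psi> t)" .
    have lS: "norm (integral {0..N} (\<lambda>t. S' t *\<^sub>R \<psi> t) - \<psi> a) \<le> e"
      by (rule norm_mollified_diff_le[OF S(3) cont(1) S(4,5) _ _ _ \<psi>N])
        (use S(6)[of 0] S(7)[of N] ab d d1 in auto)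
    have lR: "norm (integral {0..N} (\<lambda>t. R' t *\<^sub>R \<psi> t) - \<psi> b) \<le> e"
      by (rule norm_mollified_diff_le[OF R(3) cont(2) R(4,5) _ _ _ \<psi>N])
        (use R(6)[of 0] R(7)[of N] ab d d2 in auto)
    have \<eta>\<phi>: "banach_integrable (lebesgue_on {0..N}) (\<lambda>t. \<eta> t *\<^sub>R \<phi> t)"
    proof (rule banach_integrable_operator_family[OF _ \<phi>t, where C=1 and H="\<lambda>t y. \<eta> t *\<^sub>R y"])
      show "banach_integrable (lebesgue_on {0..N}) (\<lambda>t. \<eta> t *\<^sub>R y)" for y :: 'b
        by (intro banach_integrable_continuous continuous_intros cont)
      show "norm (\<eta> t *\<^sub>R y) \<le> 1 * norm y" for t and y :: 'b
        using S(8)[of t] R(8)[of t] by (auto simp: \<eta>_def intro!: mult_left_le_one_le)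
    qed (auto simp: linear_iff scaleR_add_right)
    have right: "banach_integral (lebesgue_on {0..}) (\<lambda>t. \<eta> t *\<^sub>R \<phi> t) = integral {0..N} (\<lambda>t. \<eta> t *\<^sub>R \<phi> t)"
      using d ab by (intro banach_integral_halfline_compact_support \<eta>\<phi>) (auto simp: \<eta>_out)
    have rb: "norm (integral {0..N} (\<lambda>t. \<eta> t *\<^sub>R \<phi> t) - integral {a..b} \<phi>) \<le> 2 * e"
    proof -
      \<comment> \<open>The test function differs from the indicator of \<open>{a..b}\<close> only
        on the two layers, and there by at most 1.\<close>
      define k where "k t = (if t \<in> {a..a + d} then norm (\<phi> t) else 0) + (if t \<in> {b..b + d} then norm (\<phi> t) else 0)" for t
      have \<phi>_ab: "((\<lambda>t. if t \<in> {a..b} then \<phi> t else 0) has_integral integral {a..b} \<phi>) {0..N}"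
        using ab banach_integrable_integrable_on[OF _ \<phi>t[of b]]
        by (subst has_integral_restrict) (auto simp: N_def intro!: integrable_integral intro: integrable_on_subinterval)
      have k_ab: "((\<lambda>t. if t \<in> {c..c + d} then norm (\<phi> t) else 0) has_integral J (c + d) - J c) {0..N}"
        if c: "0 < c" "c \<le> b" for c
      proof -
        have "J c + integral {c..c + d} (\<lambda>t. norm (\<phi> t)) = J (c + d)"
          unfolding J_def by (rule Henstock_Kurzweil_Integration.integral_combine) (use c d \<phi>n in auto)
        then have "J (c + d) - J c = integral {c..c + d} (\<lambda>t. norm (\<phi> t))" by simp
        then have "((\<lambda>t. norm (\<phi> t)) has_integral J (c + d) - J c) {c..c + d}"
          using integrable_integral[OF integrable_on_subinterval[OF \<phi>n[of "c + d"], of c "c + d"]] c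
          by simp
        then show ?thesis using c d by (subst has_integral_restrict) auto
      qed
      have k: "(k has_integral (J (a + d) - J a) + (J (b + d) - J b)) {0..N}"
        unfolding k_def using ab by (intro has_integral_add k_ab) auto
      have "norm (integral {0..N} (\<lambda>t. \<eta> t *\<^sub>R \<phi> t) - integral {a..b} \<phi>)
          = norm (integral {0..N} (\<lambda>t. \<eta> t *\<^sub>R \<phi> t - (if t \<in> {a..b} then \<phi> t else 0)))"
        using \<phi>_ab banach_integrable_integrable_on[OF _ \<eta>\<phi>]
        by (subst integral_diff) (auto simp: integral_unique intro: has_integral_integrable)
      also have "\<dots> \<le> integral {0..N} k"
      proof (rule integral_norm_bound_integral)
        show "norm (\<eta> t *\<^sub>R \<phi> t - (if t \<in> {a..b} then \<phi> t else 0)) \<le> k t" for t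
        proof -
          consider "t < a" | "t \<in> {a..a + d}" | "t \<in> {a + d<..b}" | "t \<in> {b<..b + d}" | "t > b + d"
            using ab d by fastforce
          then show ?thesis
          proof cases
            case 1
            then show ?thesis using \<eta>_out[of t] by (simp add: k_def)
          next
            case 2
            then have eq: "\<eta> t *\<^sub>R \<phi> t - (if t \<in> {a..b} then \<phi> t else 0) = (S t - 1) *\<^sub>R \<phi> t"
              using d R(6)[of t] by (simp add: \<eta>_def scaleR_diff_left)
            moreover have "\<bar>S t - 1\<bar> * norm (\<phi> t) \<le> norm (\<phi> t)"
              using S(8)[of t] by (intro mult_left_le_one_le) auto
            ultimately show ?thesis unfolding eq using 2 d by (simp add: k_def)
          next
            case 3
            then show ?thesis using d ab S(7)[of t] R(6)[of t] by (simp add: \<eta>_def k_def)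
          next
            case 4
            then have eq: "\<eta> t *\<^sub>R \<phi> t - (if t \<in> {a..b} then \<phi> t else 0) = (1 - R t) *\<^sub>R \<phi> t"
              using d S(7)[of t] by (simp add: \<eta>_def)
            moreover have "\<bar>1 - R t\<bar> * norm (\<phi> t) \<le> norm (\<phi> t)"
              using R(8)[of t] by (intro mult_left_le_one_le) auto
            ultimately show ?thesis unfolding eq using 4 d by (simp add: k_def)
          next
            case 5
            then show ?thesis using \<eta>_out[of t] d by (simp add: k_def)
          qed
        qed
        show "(\<lambda>t. \<eta> t *\<^sub>R \<phi> t - (if t \<in> {a..b} then \<phi> t else 0)) integrable_on {0..N}"
          using \<phi>_ab banach_integrable_integrable_on[OF _ \<eta>\<phi>]
          by (intro integrable_diff) (auto intro: has_integral_integrable)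
        show "k integrable_on {0..N}" using k by (rule has_integral_integrable)
      qed
      also have "\<dots> = (J (a + d) - J a) + (J (b + d) - J b)" using k by (rule integral_unique)
      also have "\<dots> \<le> 2 * e"
        using d1(2)[of "a + d"] d2(2)[of "b + d"] d by auto
      finally show ?thesis .
    qed
    have "integral {0..N} (\<lambda>t. S' t *\<^sub>R \<psi> t) - integral {0..N} (\<lambda>t. R' t *\<^sub>R \<psi> t)
        = - integral {0..N} (\<lambda>t. \<eta> t *\<^sub>R \<phi> t)"
      using weak[OF test] left right by simp
    then have "\<psi> b - \<psi> a - integral {a..b} \<phi> = (integral {0..N} (\<lambda>t. \<eta> t *\<^sub>R \<phi> t) - integral {a..b} \<phi>)
        + ((integral {0..N} (\<lambda>t. S' t *\<^sub>R \<psi> t) - \<psi> a) - (integral {0..N} (\<lambda>t. R' t *\<^sub>R \<psi> t) - \<psi> b))"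
      by (simp add: algebra_simps)
    also have "norm \<dots> \<le> 2 * e + (e + e)"
      by (rule order_trans[OF norm_triangle_ineq add_mono[OF rb order_trans[OF norm_triangle_ineq4 add_mono[OF lS lR]]]])
    finally show ?thesis by simp
  qed
  have "norm (\<psi> b - \<psi> a - integral {a..b} \<phi>) \<le> e" if "e > 0" for e
    using bound[of "e / 4"] that by simp
  then have "norm (\<psi> b - \<psi> a - integral {a..b} \<phi>) \<le> 0" by (rule field_le_epsilon) simp
  then show ?thesis by simp
qed

text \<open>Test functions vanish near 0, so the increment formula covers only positive times and
  shows that \<open>\<psi> s - integral {0..s} \<phi>\<close> is constant there. Continuity at 0 of
  both terms extends this to the end point.\<close>

lemma W11_halfline_absolutely_continuous:
  assumes "W11_halfline \<psi>"
  obtains \<phi> where "L1_halfline \<phi>" "\<And>t. t \<ge> 0 \<Longrightarrow> \<psi> t = \<psi> 0 + integral {0..t} \<phi>"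
proof -
  from assms obtain \<phi> where \<psi>: "continuous_on {0..} \<psi>" and \<phi>: "L1_halfline \<phi>"
    and weak: "\<And>\<eta>. test_function \<eta> \<Longrightarrow> banach_integral (lebesgue_on {0..}) (\<lambda>t. deriv \<eta> t *\<^sub>R \<psi> t) =
             - banach_integral (lebesgue_on {0..}) (\<lambda>t. \<eta> t *\<^sub>R \<phi> t)"
    unfolding W11_halfline_def by blast
  have \<phi>t: "\<phi> integrable_on {0..t}" for t
  proof (rule banach_integrable_integrable_on)
    show "banach_integrable (lebesgue_on {0..t}) \<phi>"
      using \<phi> unfolding L1_halfline_def by (rule banach_integrable_subset[rotated 3]) auto
  qed simp
  have "\<psi> t = \<psi> 0 + integral {0..t} \<phi>" if "t \<ge> 0" for t
  proof (cases "t = 0")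
    case False
    then have t: "t > 0" using that by simp
    have eq: "\<psi> t - integral {0..t} \<phi> = \<psi> s - integral {0..s} \<phi>" if s: "0 < s" "s < t" for s
    proof -
      have "integral {0..s} \<phi> + integral {s..t} \<phi> = integral {0..t} \<phi>"
        by (rule Henstock_Kurzweil_Integration.integral_combine) (use s \<phi>t in auto)
      with W11_increment_pos[OF \<psi> \<phi> weak s] show ?thesis by (simp add: algebra_simps)
    qed
    have "continuous_on {0..t} (\<lambda>s. \<psi> s - integral {0..s} \<phi>)"
      by (intro continuous_on_diff continuous_on_subset[OF \<psi>] indefinite_integral_continuous_1 \<phi>t) auto
    then have "((\<lambda>s. \<psi> s - integral {0..s} \<phi>) \<longlongrightarrow> \<psi> 0 - integral {0..0} \<phi>) (at_right 0)"
      using t by (auto simp: continuous_on_def at_within_Icc_at_right dest!: bspec[of _ _ 0])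
    moreover have "((\<lambda>s. \<psi> s - integral {0..s} \<phi>) \<longlongrightarrow> \<psi> t - integral {0..t} \<phi>) (at_right 0)"
    proof (rule tendsto_eventually)
      show "\<forall>\<^sub>F s in at_right 0. \<psi> s - integral {0..s} \<phi> = \<psi> t - integral {0..t} \<phi>"
        using eventually_at_right_real[OF t] by eventually_elim (use eq in auto)
    qed
    ultimately have "\<psi> 0 - integral {0..0} \<phi> = \<psi> t - integral {0..t} \<phi>"
      by (rule tendsto_unique[OF trivial_limit_at_right_real])
    then show ?thesis by (simp add: algebra_simps)
  qed simp
  with \<phi> show thesis by (rule that)
qed

section \<open>The abstract boundary problem\<close>

text \<open>The reals act through \<open>of_real\<close> in the scalar field, so linearity over the
  field includes real linearity on the domain.\<close>

lemma linear_operator_real: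
  assumes X: "banach_space_over sX" and Y: "banach_space_over sY" and B: "linear_operator sX sY D B"
  shows "x \<in> D \<Longrightarrow> y \<in> D \<Longrightarrow> x + y \<in> D" "x \<in> D \<Longrightarrow> y \<in> D \<Longrightarrow> B (x + y) = B x + B y"
    "x \<in> D \<Longrightarrow> c *\<^sub>R x \<in> D" "x \<in> D \<Longrightarrow> B (c *\<^sub>R x) = c *\<^sub>R B x"
proof -
  have "module sX" using X by (simp add: banach_space_over_def module_iff_vector_space)
  moreover have "module.subspace sX D" using B by (simp add: linear_operator_def)
  ultimately have D: "x \<in> D \<Longrightarrow> y \<in> D \<Longrightarrow> x + y \<in> D" "x \<in> D \<Longrightarrow> sX k x \<in> D" for x y k
    by (auto simp: module.subspace_def)
  have r: "sX (of_real c) x = c *\<^sub>R x" "sY (of_real c) y = c *\<^sub>R y" for c x y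
    using X Y by (auto simp: banach_space_over_def)
  show "x \<in> D \<Longrightarrow> y \<in> D \<Longrightarrow> x + y \<in> D" by (rule D)
  show "x \<in> D \<Longrightarrow> y \<in> D \<Longrightarrow> B (x + y) = B x + B y" using B by (simp add: linear_operator_def)
  show "x \<in> D \<Longrightarrow> c *\<^sub>R x \<in> D" using D(2)[of x "of_real c"] by (simp add: r)
  assume "x \<in> D"
  then have "B (sX (of_real c) x) = sY (of_real c) (B x)" using B by (simp add: linear_operator_def)
  then show "B (c *\<^sub>R x) = c *\<^sub>R B x" by (simp add: r)
qed

text \<open>The resolvent at 0 satisfies \<open>A (R x) = - x\<close>. Any \<open>u\<close> with
  \<open>L u = g\<close> is corrected to \<open>u + R (A u)\<close>: the correction cancels
  \<open>A u\<close> and, lying in the kernel of \<open>L\<close>, keeps the boundary value.\<close>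

lemma dirichlet_operator_solves:
  assumes X: "banach_space_over sX" and Y: "banach_space_over sY"
    and A: "linear_operator sX sX DA A" and L: "linear_operator sX sY DA L" and surj: "L ` DA = UNIV"
    and res: "0 \<in> resolvent_set sX (kernel_on DA L) A"
  shows "dirichlet_operator DA A L g \<in> DA" "A (dirichlet_operator DA A L g) = 0"
    "L (dirichlet_operator DA A L g) = g"
proof -
  from res obtain R where R: "\<And>x. R x \<in> kernel_on DA L" "\<And>x. sX 0 (R x) - A (R x) = x"
    unfolding resolvent_set_def by blast
  have "sX 0 x = 0" for x
  proof -
    have "sX (of_real 0) x = 0 *\<^sub>R x" using X unfolding banach_space_over_def by blast
    then show ?thesis by simp
  qed
  with R(2) have AR: "A (R x) = - x" for x by (metis diff_0 minus_minus)
  have "g \<in> L ` DA" using surj by simp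
  then obtain u where u: "u \<in> DA" "L u = g" by blast
  have w: "R (A u) \<in> DA" "L (R (A u)) = 0" using R(1)[of "A u"] by (auto simp: kernel_on_def)
  have "u + R (A u) \<in> kernel_on DA A" "L (u + R (A u)) = g"
    using u w AR[of "A u"] linear_operator_real(1,2)[OF X X A u(1) w(1)] linear_operator_real(2)[OF X Y L u(1) w(1)]
    by (auto simp: kernel_on_def)
  then have g: "g \<in> L ` kernel_on DA A" by blast
  from inv_into_into[OF g] f_inv_into_f[OF g]
  show "dirichlet_operator DA A L g \<in> DA" "A (dirichlet_operator DA A L g) = 0"
    "L (dirichlet_operator DA A L g) = g"
    by (auto simp: dirichlet_operator_def kernel_on_def)
qed

text \<open>Since \<open>A (D0 g) = 0\<close> and \<open>L (D0 g) = g\<close>, subtracting the stationary solution \<open>(D0 g, g)\<close> reduces the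
  abstract boundary problem to the one with homogeneous boundary condition, which \<open>T\<close> solves.\<close>

lemma block_semigroup_dirichlet:
  fixes sX :: "'k::real_normed_field \<Rightarrow> 'a::banach \<Rightarrow> 'a" and sY :: "'k \<Rightarrow> 'b::banach \<Rightarrow> 'b"
  assumes X: "banach_space_over sX" and Y: "banach_space_over sY"
    and A: "linear_operator sX sX DA A" and L: "linear_operator sX sY DA L" and surj: "L ` DA = UNIV"
    and T: "semigroup_generator (kernel_on DA L) A T"
    and \<T>: "semigroup_generator (block_domain DA L) (block_operator A) \<T>"
    and res: "0 \<in> resolvent_set sX (kernel_on DA L) A" and t: "t \<ge> 0"
  shows "\<T> t (f, g) = (T t f + dirichlet_operator DA A L g - T t (dirichlet_operator DA A L g), g)"
proof -
  interpret T: semigroup_generator "kernel_on DA L" A T by (rule T)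
  interpret \<T>: semigroup_generator "block_domain DA L" "block_operator A" \<T> by (rule \<T>)
  define d where "d = dirichlet_operator DA A L g"
  have d: "d \<in> DA" "A d = 0" "L d = g"
    using dirichlet_operator_solves[OF X Y A L surj res, of g] by (auto simp: d_def)
  \<comment> \<open>The initial value splits as \<open>(f, g) = (w, 0) + (d, g)\<close>, where the
    first summand has vanishing boundary part.\<close>
  define w where "w = f - d"
  define z where "z t = (T t w, 0) + (d, g)" for t
  have z_int: "integral {0..t} z = (T.orbit_integral t w + t *\<^sub>R d, t *\<^sub>R g)" if t: "t \<ge> 0" for t
  proof -
    have I: "(\<lambda>s. T s w) integrable_on {0..t}" by (rule T.orbit_integrable) simp
    have bl: "bounded_linear (\<lambda>x::'a. (x, 0::'b))"
      by (intro bounded_linear_Pair bounded_linear_ident bounded_linear_zero)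
    have "((\<lambda>s. (T s w, 0::'b)) has_integral (T.orbit_integral t w, 0)) {0..t}"
      using has_integral_linear[OF integrable_integral[OF I] bl] by (simp add: comp_def T.orbit_integral_def)
    moreover have "((\<lambda>s. (d, g)) has_integral t *\<^sub>R (d, g)) {0..t}"
      using has_integral_const_real[of "(d, g)" 0 t] t by simp
    ultimately have "(z has_integral (T.orbit_integral t w, 0) + t *\<^sub>R (d, g)) {0..t}"
      unfolding z_def by (rule has_integral_add)
    then show ?thesis by (simp add: integral_unique)
  qed
  have "\<T> t (f, g) = z t"
  proof (rule \<T>.homogeneous_mild_eq_orbit[symmetric, OF _ _ _ t])
    show "continuous_on {0..} z"
      unfolding z_def by (intro continuous_intros T.continuous_orbit)
    fix t :: real assume t: "t \<ge> 0"
    have V: "T.orbit_integral t w \<in> DA" "L (T.orbit_integral t w) = 0"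
      using T.orbit_integral_in_D[OF t, of w] by (auto simp: kernel_on_def)
    have td: "t *\<^sub>R d \<in> DA" "L (t *\<^sub>R d) = t *\<^sub>R g" "A (t *\<^sub>R d) = 0"
      using linear_operator_real[OF X X A, of d] linear_operator_real[OF X Y L, of d] d by auto
    have u: "T.orbit_integral t w + t *\<^sub>R d \<in> DA" "L (T.orbit_integral t w + t *\<^sub>R d) = t *\<^sub>R g"
      "A (T.orbit_integral t w + t *\<^sub>R d) = T t w - w"
      using linear_operator_real(1,2)[OF X X A V(1) td(1)] linear_operator_real(2)[OF X Y L V(1) td(1)] V td
        T.B_orbit_integral[OF t, of w] by auto
    show "integral {0..t} z \<in> block_domain DA L" using u by (simp add: z_int[OF t] block_domain_def)
    show "z t = (f, g) + block_operator A (integral {0..t} z)"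
      using u by (simp add: z_int[OF t] block_operator_def z_def w_def)
  qed
  also have "\<dots> = (T t f + d - T t d, g)" using t by (simp add: z_def w_def T.T_diff)
  finally show ?thesis by (simp add: d_def)
qed

theorem proposition3p9:
  fixes sX :: "'k::real_normed_field \<Rightarrow> 'x::banach \<Rightarrow> 'x"
    and sY :: "'k \<Rightarrow> 'y::banach \<Rightarrow> 'y"
    and DA :: "'x set" and A :: "'x \<Rightarrow> 'x" and L :: "'x \<Rightarrow> 'y"
    and T :: "real \<Rightarrow> 'x \<Rightarrow> 'x" and \<T> :: "real \<Rightarrow> 'x \<times> 'y \<Rightarrow> 'x \<times> 'y"
    and f :: 'x and g :: 'y and \<psi> :: "real \<Rightarrow> 'y" and U :: "real \<Rightarrow> 'x \<times> 'y"
  assumes X: "banach_space_over sX" and Y: "banach_space_over sY"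
    and A: "linear_operator sX sX DA A" and L: "linear_operator sX sY DA L"
    and G1: "closed_operator (kernel_on DA L) A" "densely_defined (kernel_on DA L)"
            "resolvent_set sX (kernel_on DA L) A \<noteq> {}"
    and G2: "L ` DA = UNIV"
    and G3: "closed_operator DA (\<lambda>u. (A u, L u))"
    and T: "generates_semigroup sX (kernel_on DA L) A T"
    and \<T>: "generates_semigroup (scale_prod sX sY) (block_domain DA L) (block_operator A) \<T>"
    and \<psi>: "L1_halfline \<psi>"
    and U: "\<And>t. t \<ge> 0 \<Longrightarrow>
      U t = \<T> t (f, g) + banach_integral (lebesgue_on {0..t}) (\<lambda>s. \<T> (t - s) (0, \<psi> s))"
  shows
    "(mild_solution (block_domain DA L) (block_operator A) (\<lambda>t. (0, \<psi> t)) (f, g) U \<and>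
      (\<forall>V. mild_solution (block_domain DA L) (block_operator A) (\<lambda>t. (0, \<psi> t)) (f, g) V \<longrightarrow>
           (\<forall>t\<ge>0. V t = U t))) \<and>
     (0 \<in> resolvent_set sX (kernel_on DA L) A \<longrightarrow>
      (let D0 = dirichlet_operator DA A L in
       \<forall>t\<ge>0. U t =
         (T t f + D0 g - T t (D0 g) +
            banach_integral (lebesgue_on {0..t}) (\<lambda>s. D0 (\<psi> s) - T (t - s) (D0 (\<psi> s))),
          g + banach_integral (lebesgue_on {0..t}) \<psi>))) \<and>
     (f \<in> DA \<longrightarrow> L f = g \<longrightarrow> W11_halfline \<psi> \<longrightarrow>
      classical_solution (block_domain DA L) (block_operator A) (\<lambda>t. (0, \<psi> t)) (f, g) U)"
proof -
  interpret T: semigroup_generator "kernel_on DA L" A T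
    using T by (rule generates_semigroup_imp_semigroup_generator)
  interpret \<T>: semigroup_generator "block_domain DA L" "block_operator A" \<T>
    using \<T> by (rule generates_semigroup_imp_semigroup_generator)
  \<comment> \<open>Embedding the boundary space as second component carries integrability and
    integrals over to the product space.\<close>
  have bl: "bounded_linear (\<lambda>y::'y. (0::'x, y))"
    by (intro bounded_linear_Pair bounded_linear_ident bounded_linear_zero)
  have L1: "L1_halfline (\<lambda>t. (0::'x, \<phi> t))" if "L1_halfline \<phi>" for \<phi> :: "real \<Rightarrow> 'y"
    using banach_integrable_bounded_linear[OF _ bl, of "{0..}" \<phi>] that by (simp add: L1_halfline_def)
  have mild: "mild_solution (block_domain DA L) (block_operator A) (\<lambda>t. (0, \<psi> t)) (f, g) U"
    using L1[OF \<psi>] U by (rule \<T>.mild_solution_duhamel)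
  have formula: "U t = (T t f + D0 g - T t (D0 g) +
            banach_integral (lebesgue_on {0..t}) (\<lambda>s. D0 (\<psi> s) - T (t - s) (D0 (\<psi> s))),
          g + banach_integral (lebesgue_on {0..t}) \<psi>)"
    if res: "0 \<in> resolvent_set sX (kernel_on DA L) A" and D0: "D0 = dirichlet_operator DA A L" and t: "t \<ge> 0" for D0 t
  proof -
    have orbit: "\<T> r (a, b) = (T r a + D0 b - T r (D0 b), b)" if "r \<ge> 0" for r a b
      unfolding D0 using that
      by (intro block_semigroup_dirichlet[OF X Y A L G2 _ _ res] T.semigroup_generator_axioms \<T>.semigroup_generator_axioms)
    let ?M = "lebesgue_on {0..t}" and ?P = "\<lambda>s. \<T> (t - s) (0, \<psi> s)"
    have S: "{0..t} \<in> sets lebesgue" by simp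
    have "banach_integrable ?M (\<lambda>s. (0::'x, \<psi> s))"
      using L1[OF \<psi>] unfolding L1_halfline_def by (rule banach_integrable_subset[rotated 3]) auto
    then have P: "banach_integrable ?M ?P" by (rule \<T>.conv_integrable)
    have eq: "?P s = (D0 (\<psi> s) - T (t - s) (D0 (\<psi> s)), \<psi> s)" if "s \<in> {0..t}" for s
      using that by (simp add: orbit T.T_zero)
    \<comment> \<open>Both integrands are components of \<open>?P\<close> on \<open>{0..t}\<close>,
      so the bounded projections \<open>fst\<close> and \<open>snd\<close> supply their
      integrability as well as their integrals.\<close>
    have int: "banach_integral ?M (\<lambda>s. D0 (\<psi> s) - T (t - s) (D0 (\<psi> s))) = fst (banach_integral ?M ?P)"
      "banach_integral ?M \<psi> = snd (banach_integral ?M ?P)"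
    proof -
      note PI = banach_integrable_has_integral[OF S P]
      have "banach_integrable ?M (\<lambda>s. D0 (\<psi> s) - T (t - s) (D0 (\<psi> s)))"
        using banach_integrable_bounded_linear[OF S bounded_linear_fst P]
        by (rule banach_integrable_cong[OF S]) (simp add: eq)
      moreover have "((\<lambda>s. D0 (\<psi> s) - T (t - s) (D0 (\<psi> s))) has_integral fst (banach_integral ?M ?P)) {0..t}"
        using has_integral_linear[OF PI bounded_linear_fst]
        by (rule has_integral_eq[rotated]) (simp add: eq)
      ultimately show "banach_integral ?M (\<lambda>s. D0 (\<psi> s) - T (t - s) (D0 (\<psi> s))) = fst (banach_integral ?M ?P)"
        by (simp add: banach_integral_eq_integral[OF S] integral_unique)
      have "banach_integrable ?M \<psi>"
        using banach_integrable_bounded_linear[OF S bounded_linear_snd P]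
        by (rule banach_integrable_cong[OF S]) (simp add: eq)
      moreover have "(\<psi> has_integral snd (banach_integral ?M ?P)) {0..t}"
        using has_integral_linear[OF PI bounded_linear_snd]
        by (rule has_integral_eq[rotated]) (simp add: eq)
      ultimately show "banach_integral ?M \<psi> = snd (banach_integral ?M ?P)"
        by (simp add: banach_integral_eq_integral[OF S] integral_unique)
    qed
    show ?thesis unfolding U[OF t] orbit[OF t] int by (simp add: prod_eq_iff)
  qed
  have classical: "classical_solution (block_domain DA L) (block_operator A) (\<lambda>t. (0, \<psi> t)) (f, g) U"
    if f: "f \<in> DA" "L f = g" and W: "W11_halfline \<psi>"
  proof -
    obtain \<phi> where \<phi>: "L1_halfline \<phi>" and \<psi>\<phi>: "\<And>t. t \<ge> 0 \<Longrightarrow> \<psi> t = \<psi> 0 + integral {0..t} \<phi>"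
      using W11_halfline_absolutely_continuous[OF W] by blast
    have "(0, \<psi> t) = (0::'x, \<psi> 0) + integral {0..t} (\<lambda>t. (0, \<phi> t))" if "t \<ge> 0" for t
    proof -
      have "banach_integrable (lebesgue_on {0..t}) \<phi>"
        using \<phi> unfolding L1_halfline_def by (rule banach_integrable_subset[rotated 3]) auto
      then have "\<phi> integrable_on {0..t}" by (rule banach_integrable_integrable_on[rotated]) simp
      from integral_linear[OF this bl] show ?thesis using \<psi>\<phi>[OF that] by (simp add: comp_def)
    qed
    moreover have "(f, g) \<in> block_domain DA L" using f by (simp add: block_domain_def)
    ultimately show ?thesis
      by (rule \<T>.classical_solution_if_absolutely_continuous[OF L1[OF \<psi>] L1[OF \<phi>] _ _ mild])
  qed
  have unique: "\<forall>V. mild_solution (block_domain DA L) (block_operator A) (\<lambda>t. (0, \<psi> t)) (f, g) V \<longrightarrow>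
      (\<forall>t\<ge>0. V t = U t)"
    using \<T>.mild_solution_unique[OF _ mild] by blast
  show ?thesis
    unfolding Let_def using formula[OF _ refl]
    by (intro conjI impI allI mild unique[rule_format] classical) auto
qed

end
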